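(* Let $\mathbb{P} = \mathbb{P}(a_0,\dots,a_n)$ be a weighted projective space. If $\mu_{va}(\mathbb{P}) = n-1$, then $a_i \neq a_j$ for all $i \neq j$. The same is true for $\mu_{norm}$: if $\mu_{norm}(\mathbb{P}) = n-1$, then $a_i \neq a_j$ for all $i \neq j$.
   Context: For positive integers $a_0,\dots,a_n$, $\mathbb{P}(a_0,\dots,a_n) = \operatorname{Proj} k[x_0,\dots,x_n]$ over a field $k$ (one may take $k=\mathbb{C}$) with $\deg x_i = a_i$. The presentation is assumed to be well-formed, i.e. for every $i$ the greatest common divisor of the weights other than $a_i$ is $1$. The Picard group of $\mathbb{P}$ is isomorphic to $\mathbb{Z}$, with ample generator $L = \mathcal{O}_{\mathbb{P}}(l)$, where $l = \operatorname{lcm}(a_0,\dots,a_n)$. The very ample index $\mu_{va}(\mathbb{P})$ is the smallest integer $k \ge 1$ such that $L^{\otimes k}$ is very ample. The normality index $\mu_{norm}(\mathbb{P})$ is the smallest integer $k_0 \ge 1$ such that for every $m \ge k_0$ the line bundle $L^{\otimes m}$ is very ample and the embedding given by its complete linear system is projectively normal.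
   Formalization: The case n = 2 is excluded, because the claim is false there: P(1,1,1) = P^2 is well-formed and has mu_va = mu_norm = 1 = n-1, yet its weights are equal. *)

theory Defs
  imports
    "HOL-Analysis.Abstract_Topology"
    "HOL-Algebra.QuotRing"
    "HOL-Library.Poly_Mapping"
    "HOL-Library.FuncSet"
    "HOL-Computational_Algebra.Fraction_Field"
begin

section \<open>Weighted graded polynomial rings\<close>

text \<open>
  Polynomials in the variables \<open>x\<^sub>0, x\<^sub>1, \<dots>\<close> over a field, as finitely supported functions on
  exponent vectors. \<open>k[x\<^sub>0,\<dots>,x\<^sub>n]\<close> is the subring of those that involve no variable beyond \<open>x\<^sub>n\<close>;
  it is presented as a record so that ideals and quotients of HOL-Algebra apply to it.
\<close>

type_synonym 'k mpoly = "(nat \<Rightarrow>\<^sub>0 nat) \<Rightarrow>\<^sub>0 'k"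

definition mpoly_ring :: "nat \<Rightarrow> ('k::field) mpoly ring" where
  "mpoly_ring n =
     \<lparr>carrier = {p. \<forall>m\<in>Poly_Mapping.keys p. Poly_Mapping.keys m \<subseteq> {..n}},
      mult = (*), one = 1, zero = 0, add = (+)\<rparr>"

definition wdeg :: "(nat \<Rightarrow> nat) \<Rightarrow> (nat \<Rightarrow>\<^sub>0 nat) \<Rightarrow> nat" where
  "wdeg a m = (\<Sum>i\<in>Poly_Mapping.keys m. a i * Poly_Mapping.lookup m i)"

definition graded_part :: "nat \<Rightarrow> (nat \<Rightarrow> nat) \<Rightarrow> nat \<Rightarrow> ('k::field) mpoly set" where
  "graded_part n a d =
     {p \<in> carrier (mpoly_ring n). \<forall>m\<in>Poly_Mapping.keys p. wdeg a m = d}"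

lemma wdeg_add: "wdeg a (m + m') = wdeg a m + wdeg a m'"
proof -
  let ?K = "Poly_Mapping.keys m \<union> Poly_Mapping.keys m'"
  have ext: "wdeg a q = (\<Sum>i\<in>?K. a i * Poly_Mapping.lookup q i)"
    if "Poly_Mapping.keys q \<subseteq> ?K" for q
    unfolding wdeg_def using that
    by (intro sum.mono_neutral_left) (auto simp: in_keys_iff)
  show ?thesis
    unfolding ext[OF Poly_Mapping.keys_add[of m m']] ext[OF Un_upper1] ext[OF Un_upper2]
    by (simp add: lookup_add distrib_left sum.distrib)
qed

lemma graded_part_mult:
  assumes "p \<in> graded_part n a d" "q \<in> graded_part n a e"
  shows "p * q \<in> graded_part n a (d + e)"
proof -
  have "Poly_Mapping.keys m \<subseteq> {..n} \<and> wdeg a m = d + e"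
    if mk: "m \<in> Poly_Mapping.keys (p * q)" for m
  proof -
    obtain u v where "m = u + v" "u \<in> Poly_Mapping.keys p" "v \<in> Poly_Mapping.keys q"
      using subsetD[OF keys_mult mk] by blast
    moreover have "Poly_Mapping.keys (u + v) \<subseteq> Poly_Mapping.keys u \<union> Poly_Mapping.keys v"
      by (rule Poly_Mapping.keys_add)
    ultimately show ?thesis
      using assms by (fastforce simp: graded_part_def mpoly_ring_def wdeg_add)
  qed
  then show ?thesis
    by (auto simp: graded_part_def mpoly_ring_def)
qed

definition hcomp :: "(nat \<Rightarrow> nat) \<Rightarrow> nat \<Rightarrow> ('k::field) mpoly \<Rightarrow> 'k mpoly" where
  "hcomp a d p = (\<Sum>m | m \<in> Poly_Mapping.keys p \<and> wdeg a m = d.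
                    Poly_Mapping.single m (Poly_Mapping.lookup p m))"

definition irrelevant_ideal :: "nat \<Rightarrow> (nat \<Rightarrow> nat) \<Rightarrow> ('k::field) mpoly set" where
  "irrelevant_ideal n a =
     {p \<in> carrier (mpoly_ring n). \<forall>m\<in>Poly_Mapping.keys p. wdeg a m > 0}"

definition mpoly_eval :: "('k::field \<Rightarrow> 'b::comm_ring_1) \<Rightarrow> (nat \<Rightarrow> 'b) \<Rightarrow> 'k mpoly \<Rightarrow> 'b" where
  "mpoly_eval h t p = (\<Sum>m\<in>Poly_Mapping.keys p. h (Poly_Mapping.lookup p m) *
                         (\<Prod>i\<in>Poly_Mapping.keys m. t i ^ Poly_Mapping.lookup m i))"


section \<open>Weighted projective space as \<open>Proj\<close>\<close>

definition Proj :: "nat \<Rightarrow> (nat \<Rightarrow> nat) \<Rightarrow> ('k::field) mpoly set set" where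
  "Proj n a = {P. primeideal P (mpoly_ring n) \<and> (\<forall>p\<in>P. \<forall>d. hcomp a d p \<in> P) \<and>
                  \<not> irrelevant_ideal n a \<subseteq> P}"

definition zariski_open :: "nat \<Rightarrow> (nat \<Rightarrow> nat) \<Rightarrow> ('k::field) mpoly set set \<Rightarrow> bool" where
  "zariski_open n a U \<longleftrightarrow>
     (\<exists>E. E \<subseteq> (\<Union>d. graded_part n a d) \<and> U = {P \<in> Proj n a. \<not> E \<subseteq> P})"

definition zariski :: "nat \<Rightarrow> (nat \<Rightarrow> nat) \<Rightarrow> ('k::field) mpoly set topology" where
  "zariski n a = topology (zariski_open n a)"

lemma istopology_zariski_open:
  "istopology (zariski_open n a :: ('k::field) mpoly set set \<Rightarrow> bool)"
  unfolding istopology_def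
proof safe
  fix S T :: "'k mpoly set set"
  assume "zariski_open n a S" "zariski_open n a T"
  then obtain E F where
    E: "E \<subseteq> (\<Union>d. graded_part n a d)" "S = {P \<in> Proj n a. \<not> E \<subseteq> P}" and
    F: "F \<subseteq> (\<Union>d. graded_part n a d)" "T = {P \<in> Proj n a. \<not> F \<subseteq> P}"
    unfolding zariski_open_def by blast
  define G where "G = {x * y |x y. x \<in> E \<and> y \<in> F}"
  have "G \<subseteq> (\<Union>d. graded_part n a d)"
    using E(1) F(1) unfolding G_def by (blast intro: graded_part_mult)
  have "\<not> G \<subseteq> P \<longleftrightarrow> \<not> E \<subseteq> P \<and> \<not> F \<subseteq> P" if "P \<in> Proj n a" for P
  proof -
    interpret primeideal P "mpoly_ring n" using that by (simp add: Proj_def)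
    have c: "x \<in> carrier (mpoly_ring n)" if "x \<in> E \<union> F" for x
      using that E(1) F(1) by (auto simp: graded_part_def)
    have m: "x \<otimes>\<^bsub>mpoly_ring n\<^esub> y = x * y" for x y :: "'k mpoly"
      by (simp add: mpoly_ring_def)
    have xy: "x * y \<in> P \<longleftrightarrow> x \<in> P \<or> y \<in> P" if "x \<in> E" "y \<in> F" for x y
      using I_prime[of x y, unfolded m] I_l_closed[of y x, unfolded m]
        I_r_closed[of x y, unfolded m] c that by auto
    show ?thesis
    proof
      assume "\<not> E \<subseteq> P \<and> \<not> F \<subseteq> P"
      then obtain x y where "x \<in> E" "x \<notin> P" "y \<in> F" "y \<notin> P" by blast
      then show "\<not> G \<subseteq> P" using xy unfolding G_def by blast
    next
      assume "\<not> G \<subseteq> P"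
      then show "\<not> E \<subseteq> P \<and> \<not> F \<subseteq> P" using xy unfolding G_def by auto
    qed
  qed
  then have "S \<inter> T = {P \<in> Proj n a. \<not> G \<subseteq> P}"
    unfolding E(2) F(2) by blast
  with \<open>G \<subseteq> _\<close> show "zariski_open n a (S \<inter> T)"
    unfolding zariski_open_def by blast
next
  fix \<K> :: "'k mpoly set set set"
  assume "\<forall>K\<in>\<K>. zariski_open n a K"
  then have K: "\<exists>E. E \<subseteq> (\<Union>d. graded_part n a d) \<and> K = {P \<in> Proj n a. \<not> E \<subseteq> P}"
    if "K \<in> \<K>" for K
    using that unfolding zariski_open_def by simp
  define G where
    "G = \<Union>{E. E \<subseteq> (\<Union>d. graded_part n a d) \<and> {P \<in> Proj n a. \<not> E \<subseteq> P} \<in> \<K>}"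
  have "\<Union>\<K> = {P \<in> Proj n a. \<not> G \<subseteq> P}"
  proof (intro Set.set_eqI iffI)
    fix P
    assume "P \<in> \<Union>\<K>"
    then obtain L where L: "L \<in> \<K>" "P \<in> L" by (elim UnionE)
    then obtain E where E: "E \<subseteq> (\<Union>d. graded_part n a d)" "L = {P \<in> Proj n a. \<not> E \<subseteq> P}"
      using K[OF L(1)] by (elim exE conjE)
    then have "E \<subseteq> G" using L(1) unfolding G_def by (intro Union_upper) simp
    then show "P \<in> {P \<in> Proj n a. \<not> G \<subseteq> P}" using L(2) unfolding E(2) by auto
  next
    fix P
    assume P: "P \<in> {P \<in> Proj n a. \<not> G \<subseteq> P}"
    then obtain x where "x \<in> G" "x \<notin> P" by auto
    then obtain E where E: "x \<in> E" "{P \<in> Proj n a. \<not> E \<subseteq> P} \<in> \<K>"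
      unfolding G_def by auto
    have "P \<in> {P \<in> Proj n a. \<not> E \<subseteq> P}" using P E(1) \<open>x \<notin> P\<close> by auto
    then show "P \<in> \<Union>\<K>" using E(2) by (rule UnionI[rotated])
  qed
  moreover have "G \<subseteq> (\<Union>d. graded_part n a d)"
    unfolding G_def by (rule Union_least) simp
  ultimately show "zariski_open n a (\<Union>\<K>)"
    unfolding zariski_open_def by (intro exI[of _ G] conjI)
qed

lemma openin_zariski: "openin (zariski n a) U \<longleftrightarrow> zariski_open n a U"
  unfolding zariski_def by (simp add: topology_inverse' istopology_zariski_open)

text \<open>
  The sheaf \<open>\<O>(d)\<close>, \<open>d \<ge> 0\<close>; \<open>d = 0\<close> is the structure sheaf. A section over \<open>U\<close> is a function
  assigning to each \<open>P \<in> U\<close> an element of the degree \<open>d\<close> part of the homogeneous localization at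
  \<open>P\<close> which is locally a fraction. The polynomial ring is a domain, so all these localizations
  are taken inside one field of fractions.
\<close>

type_synonym 'k sect = "'k mpoly set \<Rightarrow> 'k mpoly fract"

definition twist_sheaf ::
  "nat \<Rightarrow> (nat \<Rightarrow> nat) \<Rightarrow> nat \<Rightarrow> ('k::field) mpoly set set \<Rightarrow> 'k sect set" where
  "twist_sheaf n a d U =
     {s \<in> extensional U. \<forall>P\<in>U. \<exists>V. openin (zariski n a) V \<and> P \<in> V \<and> V \<subseteq> U \<and>
        (\<exists>e. \<exists>f\<in>graded_part n a (e + d). \<exists>g\<in>graded_part n a e.
           \<forall>Q\<in>V. g \<notin> Q \<and> s Q = Fract f g)}"

text \<open>The value at the point \<open>P\<close> of the germ \<open>z \<in> \<O>(d)\<^sub>P\<close> is zero.\<close>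

definition vanishes_at ::
  "nat \<Rightarrow> (nat \<Rightarrow> nat) \<Rightarrow> nat \<Rightarrow> ('k::field) mpoly set \<Rightarrow> 'k mpoly fract \<Rightarrow> bool" where
  "vanishes_at n a d P z \<longleftrightarrow>
     (\<exists>e. \<exists>f\<in>graded_part n a (e + d). \<exists>g\<in>graded_part n a e.
        f \<in> P \<and> g \<notin> P \<and> z = Fract f g)"

definition scalar :: "'k::field \<Rightarrow> 'k mpoly fract" where
  "scalar c = Fract (Poly_Mapping.single 0 c) 1"


section \<open>The morphism given by the complete linear system\<close>

text \<open>\<open>s 0, \<dots>, s N\<close> is a \<open>k\<close>-basis of the space of global sections of \<open>\<O>(d)\<close>.\<close>

definition is_section_basis ::
  "nat \<Rightarrow> (nat \<Rightarrow> nat) \<Rightarrow> nat \<Rightarrow> nat \<Rightarrow> (nat \<Rightarrow> ('k::field) sect) \<Rightarrow> bool" where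
  "is_section_basis n a d N s \<longleftrightarrow>
     bij_betw (\<lambda>c. \<lambda>P\<in>Proj n a. \<Sum>i\<le>N. scalar (c i) * s i P)
       ({..N} \<rightarrow>\<^sub>E (UNIV :: 'k set)) (twist_sheaf n a d (Proj n a))"

definition base_point_free ::
  "nat \<Rightarrow> (nat \<Rightarrow> nat) \<Rightarrow> nat \<Rightarrow> nat \<Rightarrow> (nat \<Rightarrow> ('k::field) sect) \<Rightarrow> bool" where
  "base_point_free n a d N s \<longleftrightarrow>
     (\<forall>P\<in>Proj n a. \<exists>i\<le>N. \<not> vanishes_at n a d P (s i P))"

text \<open>
  The morphism \<open>\<phi>\<close> to \<open>\<P>\<^sup>N = Proj k[y\<^sub>0,\<dots>,y\<^sub>N]\<close> (all weights \<open>1\<close>) with \<open>\<phi>\<^sup>*y\<^sub>i = s\<^sub>i\<close>. On points, a form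
  \<open>F\<close> of degree \<open>e\<close> lies in the homogeneous prime \<open>\<phi>(P)\<close> iff the section \<open>F(s\<^sub>0,\<dots>,s\<^sub>N)\<close> of \<open>\<O>(ed)\<close>
  vanishes at \<open>P\<close>. On functions, \<open>F/G\<close> (\<open>F\<close>, \<open>G\<close> forms of equal degree) is sent to
  \<open>F(s\<^sub>0,\<dots>,s\<^sub>N)/G(s\<^sub>0,\<dots>,s\<^sub>N)\<close>.
\<close>

definition linsys_map ::
  "nat \<Rightarrow> (nat \<Rightarrow> nat) \<Rightarrow> nat \<Rightarrow> nat \<Rightarrow> (nat \<Rightarrow> ('k::field) sect) \<Rightarrow>
   'k mpoly set \<Rightarrow> 'k mpoly set" where
  "linsys_map n a d N s P =
     {F \<in> carrier (mpoly_ring N).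
        \<forall>e. vanishes_at n a (e * d) P (mpoly_eval scalar (\<lambda>i. s i P) (hcomp (\<lambda>_. 1) e F))}"

definition linsys_comorphism ::
  "nat \<Rightarrow> (nat \<Rightarrow> nat) \<Rightarrow> nat \<Rightarrow> nat \<Rightarrow> (nat \<Rightarrow> ('k::field) sect) \<Rightarrow>
   'k mpoly set set \<Rightarrow> 'k sect \<Rightarrow> 'k sect" where
  "linsys_comorphism n a d N s V u =
     (\<lambda>P\<in>{P \<in> Proj n a. linsys_map n a d N s P \<in> V}.
        THE z. \<exists>e. \<exists>F\<in>graded_part N (\<lambda>_. 1) e. \<exists>G\<in>graded_part N (\<lambda>_. 1) e.
          G \<notin> linsys_map n a d N s P \<and> u (linsys_map n a d N s P) = Fract F G \<and>
          z = mpoly_eval scalar (\<lambda>i. s i P) F / mpoly_eval scalar (\<lambda>i. s i P) G)"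

text \<open>
  Closed immersion: a homeomorphism onto a closed subset for which \<open>\<O>\<^sub>Y \<rightarrow> f\<^sub>*\<O>\<^sub>X\<close> is a surjective
  map of sheaves. Sections are functions on points, so restriction of sections is
  restriction of functions.
\<close>

definition closed_immersion ::
  "'x topology \<Rightarrow> ('x set \<Rightarrow> ('x \<Rightarrow> 'c) set) \<Rightarrow> 'y topology \<Rightarrow> ('y set \<Rightarrow> ('y \<Rightarrow> 'e) set) \<Rightarrow>
   ('x \<Rightarrow> 'y) \<Rightarrow> ('y set \<Rightarrow> ('y \<Rightarrow> 'e) \<Rightarrow> ('x \<Rightarrow> 'c)) \<Rightarrow> bool" where
  "closed_immersion X OX Y OY f fsharp \<longleftrightarrow>
     (let pre = (\<lambda>V. {x \<in> topspace X. f x \<in> V}) in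
      embedding_map X Y f \<and> closedin Y (f ` topspace X) \<and>
      (\<forall>V. openin Y V \<longrightarrow> fsharp V ` OY V \<subseteq> OX (pre V)) \<and>
      (\<forall>V t y. openin Y V \<and> t \<in> OX (pre V) \<and> y \<in> V \<longrightarrow>
         (\<exists>W u. openin Y W \<and> y \<in> W \<and> W \<subseteq> V \<and> u \<in> OY W \<and> fsharp W u = restrict t (pre W))))"

definition very_ample :: "('k::field) itself \<Rightarrow> nat \<Rightarrow> (nat \<Rightarrow> nat) \<Rightarrow> nat \<Rightarrow> bool" where
  "very_ample T n a d \<longleftrightarrow>
     (\<exists>N (s :: nat \<Rightarrow> 'k sect).
        is_section_basis n a d N s \<and> base_point_free n a d N s \<and>
        closed_immersion (zariski n a) (twist_sheaf n a 0)
          (zariski N (\<lambda>_. 1)) (twist_sheaf N (\<lambda>_. 1) 0)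
          (linsys_map n a d N s) (linsys_comorphism n a d N s))"


section \<open>Projective normality\<close>

text \<open>
  Integral closedness in the field of fractions, with denominators cleared: if \<open>p/q\<close> satisfies
  a monic equation with coefficients \<open>c\<^sub>i\<close> in \<open>R\<close>, then \<open>p/q\<close> lies in \<open>R\<close>.
\<close>

definition integrally_closed_domain :: "('r, 'm) ring_scheme \<Rightarrow> bool" where
  "integrally_closed_domain R \<longleftrightarrow> domain R \<and>
     (\<forall>p\<in>carrier R. \<forall>q\<in>carrier R - {\<zero>\<^bsub>R\<^esub>}.
        (\<exists>(m::nat) c. c \<in> {..<m} \<rightarrow> carrier R \<and>
           p [^]\<^bsub>R\<^esub> m \<oplus>\<^bsub>R\<^esub>
             (\<Oplus>\<^bsub>R\<^esub>i\<in>{..<m}. c i \<otimes>\<^bsub>R\<^esub> p [^]\<^bsub>R\<^esub> i \<otimes>\<^bsub>R\<^esub> q [^]\<^bsub>R\<^esub> (m - i)) = \<zero>\<^bsub>R\<^esub>) \<longrightarrow>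
        (\<exists>r\<in>carrier R. p = q \<otimes>\<^bsub>R\<^esub> r))"

text \<open>
  The homogeneous ideal of the image; since \<open>Proj\<close> is reduced this is the ideal of the closed
  subscheme, and the quotient by it is the homogeneous coordinate ring of the embedding.
\<close>

definition image_ideal ::
  "nat \<Rightarrow> (nat \<Rightarrow> nat) \<Rightarrow> nat \<Rightarrow> nat \<Rightarrow> (nat \<Rightarrow> ('k::field) sect) \<Rightarrow> 'k mpoly set" where
  "image_ideal n a d N s =
     {F \<in> carrier (mpoly_ring N). \<forall>P\<in>Proj n a. F \<in> linsys_map n a d N s P}"

definition projectively_normal :: "('k::field) itself \<Rightarrow> nat \<Rightarrow> (nat \<Rightarrow> nat) \<Rightarrow> nat \<Rightarrow> bool" where
  "projectively_normal T n a d \<longleftrightarrow>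
     (\<exists>N (s :: nat \<Rightarrow> 'k sect).
        is_section_basis n a d N s \<and>
        integrally_closed_domain (mpoly_ring N Quot image_ideal n a d N s))"


section \<open>The two indices\<close>

definition well_formed :: "nat \<Rightarrow> (nat \<Rightarrow> nat) \<Rightarrow> bool" where
  "well_formed n a \<longleftrightarrow> (\<forall>i\<le>n. Gcd (a ` ({..n} - {i})) = 1)"

text \<open>The ample generator of the Picard group is \<open>L = \<O>(l)\<close>, and \<open>L\<^sup>\<otimes>\<^sup>k = \<O>(k l)\<close>.\<close>

definition lcm_weights :: "nat \<Rightarrow> (nat \<Rightarrow> nat) \<Rightarrow> nat" where
  "lcm_weights n a = Lcm (a ` {..n})"

definition mu_va :: "('k::field) itself \<Rightarrow> nat \<Rightarrow> (nat \<Rightarrow> nat) \<Rightarrow> nat" where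
  "mu_va T n a = (LEAST k. k \<ge> 1 \<and> very_ample T n a (k * lcm_weights n a))"

definition mu_norm :: "('k::field) itself \<Rightarrow> nat \<Rightarrow> (nat \<Rightarrow> nat) \<Rightarrow> nat" where
  "mu_norm T n a = (LEAST k0. k0 \<ge> 1 \<and>
     (\<forall>m\<ge>k0. very_ample T n a (m * lcm_weights n a) \<and>
             projectively_normal T n a (m * lcm_weights n a)))"

end

theory Submission
  imports Defs
begin

text \<open>
  A vector with two equal weights may as well have these two coordinates merged; this lowers the
  dimension of the weight polytope by one, and lattice polytopes of dimension \<open>m\<close> are normal from
  the multiple \<open>m - 1\<close> on. Hence for \<open>k \<ge> max 1 (n - 2)\<close> every monomial of weight \<open>e k l\<close> is a product
  of \<open>e\<close> monomials of weight \<open>k l\<close>, so the Veronese ring of \<open>\<O>(k l)\<close> is generated in degree one. This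
  makes \<open>\<O>(k l)\<close> very ample, and projectively normal because the weighted polynomial ring is
  integrally closed. Thus both indices are at most \<open>max 1 (n - 2)\<close>, which is not \<open>n - 1\<close> unless \<open>n = 2\<close>.
\<close>

text \<open>The multiple \<open>m - 1\<close> arises as follows. Suppose \<open>u\<close> has weight
  \<open>h * l\<close> and no sub-vector of weight \<open>l\<close>, and write it as a nonnegative
  combination of independent lattice points of the simplex of weight \<open>l\<close>. All
  coefficients are below 1 and add up to \<open>h\<close>, so \<open>h\<close> is at most the
  dimension. In the case of equality, the sum of the points minus \<open>u\<close> is another
  lattice point of their simplex; choosing the combination minimal for a strictly convex height
  excludes this. So a summand splits off whenever \<open>h\<close> is at least the dimension. The
  geometric obstacle is that forms of k[x] need not have degree divisible by
  \<open>d = k * l\<close> and then do not come from forms on the target. Passing to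
  \<open>d\<close>-th powers leaves membership in primes unchanged, and expanding a fraction by
  \<open>g ^ (d - 1)\<close> leaves its value unchanged; both make the degrees divisible. The case
  \<open>n = 2\<close> is a true exception: for P(1,1,1) both indices are 1 = n - 1 although all
  weights agree.\<close>

section \<open>Decomposition of monomials\<close>

text \<open>The hypothesis \<open>h + 1 >= card I\<close> says that \<open>h\<close> is at least the
  dimension of the simplex of weight \<open>l\<close>; the vertices of this simplex,
  \<open>l / a i\<close> on the axes, are integral because \<open>a i\<close> divides
  \<open>l\<close>.\<close>

lemma sub_vector_of_weight:
  fixes a u :: "nat \<Rightarrow> nat"
  assumes fin: "finite I" and pos: "\<And>i. i \<in> I \<Longrightarrow> a i > 0" and dvd: "\<And>i. i \<in> I \<Longrightarrow> a i dvd l"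
    and l: "l > 0" and wt: "(\<Sum>i\<in>I. a i * u i) = h * l" and h: "h \<ge> 1" "h + 1 \<ge> card I"
  obtains v where "\<And>i. i \<in> I \<Longrightarrow> v i \<le> u i" "(\<Sum>i\<in>I. a i * v i) = l"
proof (rule ccontr)
  assume "\<not> thesis"
  with that have no: False if "\<And>i. i \<in> I \<Longrightarrow> v i \<le> u i" "(\<Sum>i\<in>I. a i * v i) = l" for v
    using that by blast
  define B where "B = {p \<in> I \<rightarrow>\<^sub>E {..l}. (\<Sum>i\<in>I. a i * p i) = l}"
  have finB: "finite B"
    unfolding B_def by (rule finite_subset[of _ "I \<rightarrow>\<^sub>E {..l}"]) (auto intro: finite_PiE fin)
  \<comment> \<open>Families of vertices are indexed by \<open>I\<close> itself: a simplicial cone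
    of full dimension has as many generators as there are coordinates.\<close>
  define indep where "indep p \<longleftrightarrow> (\<forall>c::nat \<Rightarrow> real. (\<forall>i\<in>I. (\<Sum>j\<in>I. c j * real (p j i)) = 0) \<longrightarrow> (\<forall>j\<in>I. c j = 0))"
    for p :: "nat \<Rightarrow> nat \<Rightarrow> nat"
  define rep where "rep p c \<longleftrightarrow> (\<forall>j\<in>I. 0 \<le> c j) \<and> (\<forall>i\<in>I. (\<Sum>j\<in>I. c j * real (p j i)) = real (u i))"
    for p :: "nat \<Rightarrow> nat \<Rightarrow> nat" and c :: "nat \<Rightarrow> real"
  \<comment> \<open>By strict convexity of the squared norm, a proper convex combination of distinct
    points has a height strictly below the interpolated one; nothing else about the height is
    used.\<close>
  define \<phi> where "\<phi> p = (\<Sum>i\<in>I. (real (p i))\<^sup>2)" for p :: "nat \<Rightarrow> nat"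
  define J where "J p c = (\<Sum>j\<in>I. c j * \<phi> (p j))" for p :: "nat \<Rightarrow> nat \<Rightarrow> nat" and c
  (* A simplex around u with vertices in B that minimises J contains no further point of B. *)
  define X where "X = {J p c |p c. p \<in> I \<rightarrow>\<^sub>E B \<and> indep p \<and> rep p c}"

  \<comment> \<open>Independence determines the coefficients, so \<open>J\<close> takes one value
    per family \<open>p\<close>; this makes \<open>X\<close> finite although \<open>c\<close> ranges
    over real vectors.\<close>
  have uniq: "J p c = J p c'" if "indep p" "rep p c" "rep p c'" for p c c'
  proof -
    have "(\<Sum>j\<in>I. (c j - c' j) * real (p j i)) = 0" if "i \<in> I" for i
      using \<open>rep p c\<close> \<open>rep p c'\<close> that by (auto simp: rep_def left_diff_distrib sum_subtractf)
    then have "\<forall>j\<in>I. c j - c' j = 0"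
      using \<open>indep p\<close>[unfolded indep_def, rule_format, of "\<lambda>j. c j - c' j"] by blast
    then show ?thesis unfolding J_def by (intro sum.cong) auto
  qed
  have "X \<subseteq> (\<lambda>p. J p (SOME c. rep p c)) ` (I \<rightarrow>\<^sub>E B)"
  proof
    fix x assume "x \<in> X"
    then obtain p c where pc: "x = J p c" "p \<in> I \<rightarrow>\<^sub>E B" "indep p" "rep p c"
      by (auto simp: X_def)
    then have "rep p (SOME c. rep p c)" by (metis someI)
    from uniq[OF pc(3,4) this] pc(1,2) show "x \<in> (\<lambda>p. J p (SOME c. rep p c)) ` (I \<rightarrow>\<^sub>E B)"
      by (intro image_eqI) simp_all
  qed
  then have finX: "finite X"
    by (rule finite_subset) (intro finite_imageI finite_PiE fin finB)

  \<comment> \<open>The vertices of the whole simplex provide a first representation of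
    \<open>u\<close>, so that \<open>X\<close> is not empty.\<close>
  define q where "q = (\<lambda>j\<in>I. \<lambda>i\<in>I. if i = j then l div a j else 0)"
  have qB: "q j \<in> B" if "j \<in> I" for j
  proof -
    have "(\<Sum>i\<in>I. a i * (if i = j then l div a j else 0)) = (\<Sum>i\<in>I. if i = j then l else 0)"
      using dvd by (intro sum.cong) auto
    then show ?thesis using that fin by (auto simp: q_def B_def)
  qed
  have qsum: "(\<Sum>j\<in>I. c j * real (q j i)) = c i * real (l div a i)" if "i \<in> I" for c i
  proof -
    have "(\<Sum>j\<in>I. c j * real (q j i)) = (\<Sum>j\<in>I. if j = i then c i * real (l div a i) else 0)"
      using that by (intro sum.cong) (auto simp: q_def)
    then show ?thesis using that fin by simp
  qed
  have ldiv: "l div a i > 0" if "i \<in> I" for i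
    using dvd[OF that] l pos[OF that] by (auto elim: dvdE)
  have "indep q" unfolding indep_def
  proof (intro allI impI ballI)
    fix c :: "nat \<Rightarrow> real" and j
    assume "\<forall>i\<in>I. (\<Sum>j\<in>I. c j * real (q j i)) = 0" and "j \<in> I"
    then show "c j = 0" using qsum[of j c] ldiv[of j] by simp
  qed
  moreover have "rep q (\<lambda>i. real (u i) / real (l div a i))"
    unfolding rep_def using qsum[of _ "\<lambda>i. real (u i) / real (l div a i)"] ldiv
    by (simp del: times_divide_eq_left) (simp add: less_imp_neq[symmetric])
  moreover have "q \<in> I \<rightarrow>\<^sub>E B" using qB by (auto simp: q_def)
  ultimately have "X \<noteq> {}" unfolding X_def by blast
  then have "Min X \<in> X" using finX by simp
  then obtain p c where p: "p \<in> I \<rightarrow>\<^sub>E B" and ind: "indep p" and rep: "rep p c" and Jmin: "Min X = J p c"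
    by (auto simp: X_def)
  have c0: "0 \<le> c j" if "j \<in> I" for j using rep that by (simp add: rep_def)
  have csum: "(\<Sum>j\<in>I. c j * real (p j i)) = real (u i)" if "i \<in> I" for i
    using rep that by (simp add: rep_def)
  have pw: "(\<Sum>i\<in>I. a i * p j i) = l" if "j \<in> I" for j
    using p that by (auto simp: B_def PiE_iff)

  \<comment> \<open>A coefficient of at least 1 would put \<open>p j\<close> below \<open>u\<close>
    in every coordinate, and \<open>p j\<close> has weight \<open>l\<close>.\<close>
  have c1: "c j < 1" if j: "j \<in> I" for j
  proof (rule ccontr)
    assume "\<not> c j < 1"
    have "p j i \<le> u i" if i: "i \<in> I" for i
    proof -
      have "real (p j i) \<le> c j * real (p j i)" using \<open>\<not> c j < 1\<close> mult_right_mono[of 1 "c j" "real (p j i)"] by simp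
      also have "\<dots> \<le> (\<Sum>j\<in>I. c j * real (p j i))"
        using c0 by (intro member_le_sum) (auto simp: fin j)
      finally show ?thesis using csum[OF i] by simp
    qed
    then show False using no pw j by blast
  qed
  have "real l * (\<Sum>j\<in>I. c j) = (\<Sum>j\<in>I. c j * (\<Sum>i\<in>I. real (a i) * real (p j i)))"
    using arg_cong[OF pw, of _ real] by (simp add: sum_distrib_left mult.commute)
  also have "\<dots> = (\<Sum>i\<in>I. real (a i) * (\<Sum>j\<in>I. c j * real (p j i)))"
    unfolding sum_distrib_left by (subst sum.swap) (simp add: ac_simps)
  also have "\<dots> = real (\<Sum>i\<in>I. a i * u i)" using csum by simp
  also have "\<dots> = real l * real h" using wt by simp
  finally have ch: "(\<Sum>j\<in>I. c j) = real h" using l by simp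
  have "I \<noteq> {}" using ch h by auto
  \<comment> \<open>The coefficients are below 1 and sum to \<open>h\<close>, so
    \<open>h < card I\<close>; the hypothesis on \<open>h\<close> leaves only equality.\<close>
  then have "(\<Sum>j\<in>I. c j) < (\<Sum>j\<in>I. 1)" using c1 fin by (intro sum_strict_mono) auto
  then have card: "card I = h + 1" using ch h by simp
  define t where "t j = 1 - c j" for j
  have t0: "t j > 0" if "j \<in> I" for j using c1[OF that] by (simp add: t_def)
  have tsum: "sum t I = 1" using ch card by (simp add: t_def sum_subtractf)

  \<comment> \<open>The reflection of \<open>u\<close> has coefficients \<open>1 - c j\<close>,
    which are positive and sum to 1, so it is a lattice point in the simplex of the
    \<open>p j\<close>. By \<open>wr\<close> the subtraction of naturals is exact.\<close>
  define w where "w = (\<lambda>i\<in>I. (\<Sum>j\<in>I. p j i) - u i)"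
  have wr: "real (w i) = (\<Sum>j\<in>I. t j * real (p j i))" if i: "i \<in> I" for i
  proof -
    have *: "(\<Sum>j\<in>I. t j * real (p j i)) = real (\<Sum>j\<in>I. p j i) - real (u i)"
      using csum[OF i] by (simp add: t_def left_diff_distrib sum_subtractf)
    moreover have "(\<Sum>j\<in>I. t j * real (p j i)) \<ge> 0" using t0 by (intro sum_nonneg) (simp add: less_imp_le)
    ultimately have "u i \<le> (\<Sum>j\<in>I. p j i)" by linarith
    then show ?thesis using i * by (simp only: w_def restrict_apply' of_nat_diff)
  qed
  have "real (\<Sum>i\<in>I. a i * w i) = (\<Sum>i\<in>I. \<Sum>j\<in>I. t j * (real (a i) * real (p j i)))"
    using wr by (simp add: sum_distrib_left ac_simps)
  also have "\<dots> = (\<Sum>j\<in>I. t j * real (\<Sum>i\<in>I. a i * p j i))"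
    by (subst sum.swap) (simp add: sum_distrib_left)
  also have "\<dots> = sum t I * real l" using pw by (simp add: sum_distrib_right)
  finally have ww: "(\<Sum>i\<in>I. a i * w i) = l" by (simp only: tsum mult_1 of_nat_eq_iff)
  have "w i \<le> l" if "i \<in> I" for i
  proof -
    have "w i \<le> a i * w i" using pos[OF that] by simp
    also have "\<dots> \<le> l" unfolding ww[symmetric] by (rule member_le_sum) (use that fin in auto)
    finally show ?thesis .
  qed
  then have wB: "w \<in> B" using ww by (auto simp: B_def w_def)

  \<comment> \<open>Positive coefficients give a positive pivot length \<open>\<tau>\<close>; with
    \<open>\<tau> = 0\<close> the exchange would not change \<open>J\<close>.\<close>
  have cpos: "c j > 0" if j: "j \<in> I" for j
  proof (rule ccontr)
    assume "\<not> c j > 0"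
    then have "t j = 1" using c0[OF j] by (simp add: t_def)
    then have "sum t (I - {j}) = 0" using tsum by (simp add: sum_diff1 fin j)
    then have "I - {j} = {}"
      using sum_pos[of "I - {j}" t] t0 fin by force
    then have "card I \<le> 1" using card_mono[of "{j}" I] by auto
    then show False using card h by simp
  qed

  \<comment> \<open>Ratio test of the simplex method: \<open>j0\<close> is the coefficient that
    reaches 0 first when multiples of \<open>w\<close> are subtracted from \<open>u\<close>, so the
    remaining coefficients stay nonnegative.\<close>
  obtain j0 where j0: "j0 \<in> I" "\<And>j. j \<in> I \<Longrightarrow> c j0 / t j0 \<le> c j / t j"
    using arg_min_if_finite(1)[OF fin \<open>I \<noteq> {}\<close>] arg_min_least[OF fin \<open>I \<noteq> {}\<close>]
    by (rule that)
  define \<tau> where "\<tau> = c j0 / t j0"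
  have \<tau>: "\<tau> > 0" "\<tau> * t j0 = c j0" using cpos[OF j0(1)] t0[OF j0(1)] by (auto simp: \<tau>_def)
  have \<tau>le: "\<tau> * t j \<le> c j" if "j \<in> I" for j
    using j0(2)[OF that] t0[OF that] by (simp add: \<tau>_def pos_le_divide_eq)
  define p' where "p' = p(j0 := w)"
  define c' where "c' = (\<lambda>j. c j - \<tau> * t j)(j0 := \<tau>)"
  \<comment> \<open>The function \<open>f\<close> is arbitrary because two instances are needed:
    coordinates show that the exchanged family still represents \<open>u\<close>, and
    \<open>\<phi>\<close> measures the change of \<open>J\<close>.\<close>
  have pivot: "(\<Sum>j\<in>I. c' j * f (p' j)) = (\<Sum>j\<in>I. c j * f (p j)) - \<tau> * ((\<Sum>j\<in>I. t j * f (p j)) - f w)"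
    for f :: "(nat \<Rightarrow> nat) \<Rightarrow> real"
  proof -
    have "(\<Sum>j\<in>I. c' j * f (p' j)) = \<tau> * f w + (\<Sum>j\<in>I-{j0}. (c j - \<tau> * t j) * f (p j))"
      by (subst sum.remove[OF fin j0(1)]) (auto simp: c'_def p'_def intro: sum.cong)
    also have "(\<Sum>j\<in>I-{j0}. (c j - \<tau> * t j) * f (p j)) = (\<Sum>j\<in>I. (c j - \<tau> * t j) * f (p j))"
      using sum.remove[OF fin j0(1), of "\<lambda>j. (c j - \<tau> * t j) * f (p j)"] \<tau> by simp
    also have "\<dots> = (\<Sum>j\<in>I. c j * f (p j)) - \<tau> * (\<Sum>j\<in>I. t j * f (p j))"
      unfolding left_diff_distrib sum_subtractf sum_distrib_left by (simp add: ac_simps)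
    finally show ?thesis by (simp add: algebra_simps)
  qed
  have "rep p' c'" unfolding rep_def
  proof safe
    fix j assume "j \<in> I" then show "0 \<le> c' j" using \<tau>le \<tau> by (auto simp: c'_def)
  next
    fix i assume "i \<in> I"
    then show "(\<Sum>j\<in>I. c' j * real (p' j i)) = real (u i)"
      using pivot[of "\<lambda>p. real (p i)"] csum wr by simp
  qed
  \<comment> \<open>The exchange keeps independence because \<open>w\<close> has the nonzero
    coefficient \<open>t j0\<close> at the vertex that it replaces.\<close>
  moreover have "indep p'" unfolding indep_def
  proof (intro allI impI ballI)
    fix e :: "nat \<Rightarrow> real" and j
    assume e: "\<forall>i\<in>I. (\<Sum>j\<in>I. e j * real (p' j i)) = 0" and j: "j \<in> I"
    define g where "g j = (if j = j0 then 0 else e j) + e j0 * t j" for j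
    have "(\<Sum>j\<in>I. g j * real (p j i)) = 0" if i: "i \<in> I" for i
    proof -
      have "(\<Sum>j\<in>I. g j * real (p j i)) = (\<Sum>j\<in>I. (if j = j0 then 0 else e j) * real (p j i)) + e j0 * real (w i)"
        unfolding g_def wr[OF i] distrib_right sum.distrib sum_distrib_left by (simp add: ac_simps)
      also have "\<dots> = (\<Sum>j\<in>I. e j * real (p' j i))"
        by (subst (1 2) sum.remove[OF fin j0(1)]) (auto simp: p'_def intro: sum.cong)
      finally show ?thesis using e i by simp
    qed
    then have g: "g j = 0" if "j \<in> I" for j using ind that unfolding indep_def by blast
    have "e j0 = 0" using g[OF j0(1)] t0[OF j0(1)] by (simp add: g_def)
    then show "e j = 0" using g[OF j] by (auto simp: g_def split: if_splits)
  qed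
  moreover have "p' \<in> I \<rightarrow>\<^sub>E B" using p wB j0(1) by (auto simp: p'_def PiE_iff extensional_def)
  ultimately have "J p' c' \<in> X" unfolding X_def by blast
  then have "J p c \<le> J p' c'" using Jmin finX by (metis Min_le)
  then have "\<tau> * ((\<Sum>j\<in>I. t j * \<phi> (p j)) - \<phi> w) \<le> 0"
    using pivot[of \<phi>] by (simp add: J_def)
  then have le: "(\<Sum>j\<in>I. t j * \<phi> (p j)) \<le> \<phi> w" using \<tau> by (simp add: mult_le_0_iff)
  (* equality case of Jensen's inequality for the square *)
  have "(\<Sum>j\<in>I. t j * (real (p j i) - real (w i))\<^sup>2) = (\<Sum>j\<in>I. t j * (real (p j i))\<^sup>2) - (real (w i))\<^sup>2"
    if i: "i \<in> I" for i
  proof -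
    have "(\<Sum>j\<in>I. t j * (real (p j i) - real (w i))\<^sup>2)
      = (\<Sum>j\<in>I. t j * (real (p j i))\<^sup>2) - 2 * real (w i) * (\<Sum>j\<in>I. t j * real (p j i)) + sum t I * (real (w i))\<^sup>2"
      by (simp add: power2_diff algebra_simps sum.distrib sum_subtractf sum_distrib_left sum_distrib_right)
    then show ?thesis using wr[OF i] tsum by (simp add: power2_eq_square)
  qed
  then have "(\<Sum>i\<in>I. \<Sum>j\<in>I. t j * (real (p j i) - real (w i))\<^sup>2)
      = (\<Sum>i\<in>I. \<Sum>j\<in>I. t j * (real (p j i))\<^sup>2) - \<phi> w"
    by (simp add: sum_subtractf \<phi>_def)
  also have "(\<Sum>i\<in>I. \<Sum>j\<in>I. t j * (real (p j i))\<^sup>2) = (\<Sum>j\<in>I. t j * \<phi> (p j))"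
    by (subst sum.swap) (simp add: \<phi>_def sum_distrib_left)
  finally have "(\<Sum>i\<in>I. \<Sum>j\<in>I. t j * (real (p j i) - real (w i))\<^sup>2) \<le> 0" using le by simp
  moreover have nn: "t j * (real (p j i) - real (w i))\<^sup>2 \<ge> 0" if "j \<in> I" for i j
    using t0[OF that] by simp
  ultimately have "(\<Sum>i\<in>I. \<Sum>j\<in>I. t j * (real (p j i) - real (w i))\<^sup>2) = 0"
    by (intro antisym sum_nonneg nn)
  then have "\<forall>i\<in>I. (\<Sum>j\<in>I. t j * (real (p j i) - real (w i))\<^sup>2) = 0"
    by (subst (asm) sum_nonneg_eq_0_iff) (auto intro: sum_nonneg nn fin)
  then have "\<forall>i\<in>I. \<forall>j\<in>I. t j * (real (p j i) - real (w i))\<^sup>2 = 0"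
    using nn fin by (simp add: sum_nonneg_eq_0_iff)
  then have eq: "p j i = w i" if "i \<in> I" "j \<in> I" for i j using that t0 by fastforce
  \<comment> \<open>Since \<open>h >= 1\<close> there are at least two vertices; both equal
    \<open>w\<close>, so their difference is a nontrivial relation.\<close>
  have "I \<noteq> {j0}" using card h by auto
  then obtain j1 where j1: "j1 \<in> I" "j1 \<noteq> j0" using j0(1) by blast
  define e where "e j = (if j = j0 then 1 else if j = j1 then -1 else 0 :: real)" for j
  have "(\<Sum>j\<in>I. e j * real (p j i)) = 0" if i: "i \<in> I" for i
  proof -
    have "(\<Sum>j\<in>I. e j * real (p j i)) = (\<Sum>j\<in>I. e j) * real (w i)"
      using eq i by (simp add: sum_distrib_right)
    also have "(\<Sum>j\<in>I. e j) = (\<Sum>j\<in>I. (if j = j0 then 1 else 0) - (if j = j1 then 1 else 0))"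
      using j1 by (intro sum.cong) (auto simp: e_def)
    also have "\<dots> = 0" using fin j0(1) j1(1) by (simp add: sum_subtractf)
    finally show ?thesis by simp
  qed
  then have "e j0 = 0" using ind j0(1) unfolding indep_def by blast
  then show False by (simp add: e_def)
qed

text \<open>Coordinates of equal weight enter the weight only through their sum, so
  \<open>j0\<close> can be folded into \<open>i0\<close>. The \<open>n\<close> remaining
  coordinates, instead of \<open>n + 1\<close>, account for the improvement of the bound by
  one.\<close>

lemma sub_vector_with_equal_weights:
  fixes a v :: "nat \<Rightarrow> nat"
  assumes pos: "\<And>i. i \<le> n \<Longrightarrow> a i > 0" and dvd: "\<And>i. i \<le> n \<Longrightarrow> a i dvd l" and l: "l > 0"
    and ij: "i0 \<le> n" "j0 \<le> n" "i0 \<noteq> j0" "a i0 = a j0"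
    and wt: "(\<Sum>i\<le>n. a i * v i) = h * l" and h: "h \<ge> 1" "h + 1 \<ge> n"
  obtains w where "\<And>i. i \<le> n \<Longrightarrow> w i \<le> v i" "(\<Sum>i\<le>n. a i * w i) = l"
proof -
  define I where "I = {..n} - {j0}"
  have split: "(\<Sum>i\<le>n. a i * f i) = a j0 * f j0 + (a i0 * f i0 + (\<Sum>i\<in>I - {i0}. a i * f i))" for f
    unfolding I_def using ij by (subst sum.remove[of _ j0]; (subst sum.remove[of _ i0])?) auto
  have splitI: "(\<Sum>i\<in>I. a i * f i) = a i0 * f i0 + (\<Sum>i\<in>I - {i0}. a i * f i)" for f
    unfolding I_def using ij by (subst sum.remove[of _ i0]) auto
  define u where "u = v(i0 := v i0 + v j0)"
  have "(\<Sum>i\<in>I - {i0}. a i * u i) = (\<Sum>i\<in>I - {i0}. a i * v i)"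
    by (intro sum.cong) (auto simp: u_def)
  then have "(\<Sum>i\<in>I. a i * u i) = h * l"
    using wt ij unfolding split splitI by (simp add: u_def algebra_simps)
  moreover have "card I = n" using ij by (simp add: I_def)
  ultimately obtain w' where w': "\<And>i. i \<in> I \<Longrightarrow> w' i \<le> u i" "(\<Sum>i\<in>I. a i * w' i) = l"
    using sub_vector_of_weight[of I a l u h] pos dvd l h by (auto simp: I_def)
  \<comment> \<open>The merged entry is distributed again: as much as possible goes to
    \<open>i0\<close>, and the rest fits into \<open>j0\<close> because
    \<open>w' i0 <= v i0 + v j0\<close>.\<close>
  define w where "w = w'(i0 := min (v i0) (w' i0), j0 := w' i0 - min (v i0) (w' i0))"
  have "w' i0 \<le> v i0 + v j0" using w'(1)[of i0] ij by (auto simp: I_def u_def)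
  then have "w i \<le> v i" if "i \<le> n" for i
    using w'(1)[of i] ij that by (auto simp: w_def I_def u_def)
  moreover have "(\<Sum>i\<in>I - {i0}. a i * w i) = (\<Sum>i\<in>I - {i0}. a i * w' i)"
    by (intro sum.cong) (auto simp: w_def I_def)
  then have "(\<Sum>i\<le>n. a i * w i) = l"
    using w'(2) ij unfolding split splitI by (simp add: w_def flip: add_mult_distrib2 add.assoc)
  ultimately show thesis by (rule that)
qed

lemma wdeg_eq_sum:
  assumes "Poly_Mapping.keys m \<subseteq> {..n}"
  shows "wdeg a m = (\<Sum>i\<le>n. a i * Poly_Mapping.lookup m i)"
  unfolding wdeg_def using assms by (intro sum.mono_neutral_left) (auto simp: in_keys_iff)

text \<open>Vectors of weight \<open>l\<close> are split off until weight \<open>h * l\<close> is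
  left. The last splitting happens at the multiple \<open>h + 1\<close>, which is why
  \<open>h + 2 >= n\<close> suffices.\<close>

lemma monomial_factor_exists:
  assumes pos: "\<And>i. i \<le> n \<Longrightarrow> a i > 0" and dvd: "\<And>i. i \<le> n \<Longrightarrow> a i dvd l" and l: "l > 0"
    and ij: "i0 \<le> n" "j0 \<le> n" "i0 \<noteq> j0" "a i0 = a j0"
    and m: "Poly_Mapping.keys m \<subseteq> {..n}" "wdeg a m = (h + k) * l" and h: "h \<ge> 1" "h + 2 \<ge> n"
  shows "\<exists>m1 m2. m = m1 + m2 \<and> Poly_Mapping.keys m1 \<subseteq> {..n} \<and> Poly_Mapping.keys m2 \<subseteq> {..n} \<and>
           wdeg a m1 = k * l \<and> wdeg a m2 = h * l"
  using m
proof (induction k arbitrary: m)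
  case 0
  then show ?case by (intro exI[of _ 0] exI[of _ m]) (auto simp: wdeg_def)
next
  case (Suc k)
  have "(\<Sum>i\<le>n. a i * Poly_Mapping.lookup m i) = (h + Suc k) * l"
    using Suc.prems by (simp add: wdeg_eq_sum)
  then obtain w where w: "\<And>i. i \<le> n \<Longrightarrow> w i \<le> Poly_Mapping.lookup m i" "(\<Sum>i\<le>n. a i * w i) = l"
    using sub_vector_with_equal_weights[OF pos dvd l ij, of "Poly_Mapping.lookup m" "h + Suc k"] h by auto
  define x where "x = Poly_Mapping.Abs_poly_mapping (\<lambda>i. if i \<le> n then w i else 0)"
  have "{i. (if i \<le> n then w i else 0) \<noteq> 0} \<subseteq> {..n}"
    by (auto split: if_split_asm)
  from Poly_Mapping.lookup_Abs_poly_mapping[OF finite_subset[OF this finite_atMost]]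
  have lx: "Poly_Mapping.lookup x = (\<lambda>i. if i \<le> n then w i else 0)"
    unfolding x_def .
  have kx: "Poly_Mapping.keys x \<subseteq> {..n}" by (auto simp: in_keys_iff lx split: if_split_asm)
  have mx: "m = x + (m - x)"
    by (rule poly_mapping_eqI) (use w(1) in \<open>auto simp: lookup_add lookup_minus lx\<close>)
  have kmx: "Poly_Mapping.keys (m - x) \<subseteq> {..n}"
    using Suc.prems(1) by (auto simp: in_keys_iff lookup_minus subset_iff)
  have wx: "wdeg a x = l" using w(2) by (simp add: wdeg_eq_sum[OF kx] lx)
  have "wdeg a (m - x) = (h + k) * l"
    using arg_cong[OF mx, of "wdeg a"] Suc.prems(2) wx by (simp add: wdeg_add)
  from Suc.IH[OF kmx this] obtain m1 m2 where m12:
    "m - x = m1 + m2" "Poly_Mapping.keys m1 \<subseteq> {..n}" "Poly_Mapping.keys m2 \<subseteq> {..n}"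
    "wdeg a m1 = k * l" "wdeg a m2 = h * l" by blast
  have "m = (x + m1) + m2" using mx m12(1) by (simp add: add.assoc)
  moreover have "Poly_Mapping.keys (x + m1) \<subseteq> {..n}"
    using Poly_Mapping.keys_add[of x m1] kx m12 by blast
  ultimately show ?case using m12 wx by (intro exI[of _ "x + m1"] exI[of _ m2]) (auto simp: wdeg_add)
qed

section \<open>Weighted polynomial rings and homogeneous primes\<close>

lemma mem_mpoly_ring: "p \<in> carrier (mpoly_ring n) \<longleftrightarrow> (\<forall>m\<in>Poly_Mapping.keys p. Poly_Mapping.keys m \<subseteq> {..n})"
  by (simp add: mpoly_ring_def)

lemma mpoly_ring_ops [simp]:
  "x \<otimes>\<^bsub>mpoly_ring n\<^esub> y = x * y" "x \<oplus>\<^bsub>mpoly_ring n\<^esub> y = x + y"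
  "\<one>\<^bsub>mpoly_ring n\<^esub> = 1" "\<zero>\<^bsub>mpoly_ring n\<^esub> = 0"
  by (simp_all add: mpoly_ring_def)

lemma mpoly_ring_zero_one: "0 \<in> carrier (mpoly_ring n)" "1 \<in> carrier (mpoly_ring n)"
  by (auto simp: mem_mpoly_ring)

lemma mpoly_ring_add:
  "p \<in> carrier (mpoly_ring n) \<Longrightarrow> q \<in> carrier (mpoly_ring n) \<Longrightarrow> p + q \<in> carrier (mpoly_ring n)"
  unfolding mem_mpoly_ring using Poly_Mapping.keys_add[of p q] by blast

lemma mpoly_ring_uminus: "p \<in> carrier (mpoly_ring n) \<Longrightarrow> - p \<in> carrier (mpoly_ring n)"
  by (auto simp: mem_mpoly_ring in_keys_iff)

lemma mpoly_ring_diff: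
  "p \<in> carrier (mpoly_ring n) \<Longrightarrow> q \<in> carrier (mpoly_ring n) \<Longrightarrow> p - q \<in> carrier (mpoly_ring n)"
  using mpoly_ring_add[of p n "- q"] mpoly_ring_uminus[of q n] by simp

lemma mpoly_ring_mult:
  assumes "p \<in> carrier (mpoly_ring n)" "q \<in> carrier (mpoly_ring n)"
  shows "p * q \<in> carrier (mpoly_ring n)"
  unfolding mem_mpoly_ring
proof
  fix m assume "m \<in> Poly_Mapping.keys (p * q)"
  then obtain u v where "m = u + v" "u \<in> Poly_Mapping.keys p" "v \<in> Poly_Mapping.keys q"
    using keys_mult[of p q] by blast
  then show "Poly_Mapping.keys m \<subseteq> {..n}"
    using assms Poly_Mapping.keys_add[of u v] unfolding mem_mpoly_ring by blast
qed

lemma mpoly_ring_sum: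
  "(\<And>i. i \<in> I \<Longrightarrow> f i \<in> carrier (mpoly_ring n)) \<Longrightarrow> sum f I \<in> carrier (mpoly_ring n)"
  by (induction I rule: infinite_finite_induct) (auto intro: mpoly_ring_add mpoly_ring_zero_one)

lemma mpoly_ring_power: "p \<in> carrier (mpoly_ring n) \<Longrightarrow> p ^ k \<in> carrier (mpoly_ring n)"
  by (induction k) (auto intro: mpoly_ring_mult mpoly_ring_zero_one)

lemma mpoly_ring_single: "Poly_Mapping.keys m \<subseteq> {..n} \<Longrightarrow> Poly_Mapping.single m c \<in> carrier (mpoly_ring n)"
  by (auto simp: mem_mpoly_ring)

lemmas mpoly_ring_closed = mpoly_ring_zero_one mpoly_ring_add mpoly_ring_uminus mpoly_ring_diff
  mpoly_ring_mult mpoly_ring_power mpoly_ring_sum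

lemma cring_mpoly_ring: "cring (mpoly_ring n :: ('k::field) mpoly ring)"
proof (rule cringI)
  show "abelian_group (mpoly_ring n :: 'k mpoly ring)"
  proof (rule abelian_groupI)
    fix x :: "'k mpoly" assume "x \<in> carrier (mpoly_ring n)"
    then show "\<exists>y\<in>carrier (mpoly_ring n). y \<oplus>\<^bsub>mpoly_ring n\<^esub> x = \<zero>\<^bsub>mpoly_ring n\<^esub>"
      by (intro bexI[of _ "- x"]) (auto intro: mpoly_ring_uminus)
  qed (auto intro: mpoly_ring_closed simp: add.assoc add.commute)
  show "comm_monoid (mpoly_ring n :: 'k mpoly ring)"
    by (rule comm_monoidI) (auto intro: mpoly_ring_closed simp: mult.assoc mult.commute)
qed (simp add: distrib_right)

lemma a_inv_mpoly_ring:
  assumes "x \<in> carrier (mpoly_ring n)" shows "\<ominus>\<^bsub>mpoly_ring n\<^esub> x = - x"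
proof -
  interpret cring "mpoly_ring n :: 'a mpoly ring" by (rule cring_mpoly_ring)
  show ?thesis by (rule minus_equality) (use assms in \<open>auto intro: mpoly_ring_uminus\<close>)
qed

lemma lookup_hcomp:
  "Poly_Mapping.lookup (hcomp a d p) m = (if wdeg a m = d then Poly_Mapping.lookup p m else 0)"
proof -
  let ?K = "{m. m \<in> Poly_Mapping.keys p \<and> wdeg a m = d}"
  have "Poly_Mapping.lookup (hcomp a d p) m =
      (\<Sum>k\<in>?K. if k = m then Poly_Mapping.lookup p m else 0)"
    unfolding hcomp_def lookup_sum by (intro sum.cong) (auto simp: lookup_single when_def)
  also have "\<dots> = (if m \<in> ?K then Poly_Mapping.lookup p m else 0)"
    by (subst sum.delta) auto
  finally show ?thesis by (auto simp: in_keys_iff)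
qed

lemma keys_hcomp: "Poly_Mapping.keys (hcomp a d p) = {m \<in> Poly_Mapping.keys p. wdeg a m = d}"
  by (auto simp: in_keys_iff lookup_hcomp split: if_split_asm)

lemma hcomp_zero [simp]: "hcomp a d 0 = 0"
  by (rule poly_mapping_eqI) (simp add: lookup_hcomp)

lemma hcomp_add: "hcomp a d (p + q) = hcomp a d p + hcomp a d q"
  by (rule poly_mapping_eqI) (simp add: lookup_hcomp lookup_add)

lemma hcomp_sum: "hcomp a d (sum f I) = (\<Sum>i\<in>I. hcomp a d (f i))"
  by (induction I rule: infinite_finite_induct) (auto simp: hcomp_add)

lemma mpoly_sum_singles: "(\<Sum>m\<in>Poly_Mapping.keys p. Poly_Mapping.single m (Poly_Mapping.lookup p m)) = p"
proof (rule poly_mapping_eqI)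
  fix k
  have "(\<Sum>m\<in>Poly_Mapping.keys p. Poly_Mapping.lookup (Poly_Mapping.single m (Poly_Mapping.lookup p m)) k)
      = (\<Sum>m\<in>Poly_Mapping.keys p. if m = k then Poly_Mapping.lookup p k else 0)"
    by (intro sum.cong) (auto simp: lookup_single when_def)
  then show "Poly_Mapping.lookup (\<Sum>m\<in>Poly_Mapping.keys p. Poly_Mapping.single m (Poly_Mapping.lookup p m)) k
      = Poly_Mapping.lookup p k"
    by (simp add: lookup_sum in_keys_iff)
qed

lemma graded_part_carrier: "p \<in> graded_part n a d \<Longrightarrow> p \<in> carrier (mpoly_ring n)"
  by (simp add: graded_part_def)

lemma hcomp_in_graded_part: "p \<in> carrier (mpoly_ring n) \<Longrightarrow> hcomp a d p \<in> graded_part n a d"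
  by (auto simp: graded_part_def mem_mpoly_ring keys_hcomp)

lemmas hcomp_carrier = graded_part_carrier[OF hcomp_in_graded_part]

lemma hcomp_graded_part: "p \<in> graded_part n a d \<Longrightarrow> hcomp a e p = (if e = d then p else 0)"
  by (rule poly_mapping_eqI) (auto simp: lookup_hcomp graded_part_def in_keys_iff)

lemma graded_part_zero: "0 \<in> graded_part n a d"
  by (simp add: graded_part_def mpoly_ring_closed)

lemma graded_part_one: "1 \<in> graded_part n a 0"
  by (auto simp: graded_part_def mpoly_ring_closed wdeg_def)

lemma graded_part_add:
  "p \<in> graded_part n a d \<Longrightarrow> q \<in> graded_part n a d \<Longrightarrow> p + q \<in> graded_part n a d"
  unfolding graded_part_def using Poly_Mapping.keys_add[of p q] by (auto intro: mpoly_ring_closed)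

lemma graded_part_sum:
  "(\<And>i. i \<in> I \<Longrightarrow> f i \<in> graded_part n a d) \<Longrightarrow> sum f I \<in> graded_part n a d"
  by (induction I rule: infinite_finite_induct) (auto intro: graded_part_add graded_part_zero)

lemma graded_part_power: "p \<in> graded_part n a d \<Longrightarrow> p ^ k \<in> graded_part n a (k * d)"
  by (induction k) (auto intro: graded_part_mult graded_part_one)

lemma graded_part_single:
  "Poly_Mapping.keys m \<subseteq> {..n} \<Longrightarrow> wdeg a m = d \<Longrightarrow> Poly_Mapping.single m c \<in> graded_part n a d"
  by (auto simp: graded_part_def mpoly_ring_single)

lemma sum_hcomp:
  assumes "finite D" "wdeg a ` Poly_Mapping.keys p \<subseteq> D"
  shows "(\<Sum>d\<in>D. hcomp a d p) = p"
proof (rule poly_mapping_eqI)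
  fix m
  show "Poly_Mapping.lookup (\<Sum>d\<in>D. hcomp a d p) m = Poly_Mapping.lookup p m"
    unfolding lookup_sum lookup_hcomp using assms by (auto simp: in_keys_iff image_subset_iff)
qed

lemma graded_part_eq_hcomp: "p \<in> carrier (mpoly_ring n) \<Longrightarrow> (\<And>e. e \<noteq> d \<Longrightarrow> hcomp a e p = 0) \<Longrightarrow> p \<in> graded_part n a d"
  unfolding graded_part_def
proof (safe, rule ccontr)
  fix m assume "\<And>e. e \<noteq> d \<Longrightarrow> hcomp a e p = 0" "m \<in> Poly_Mapping.keys p" "wdeg a m \<noteq> d"
  moreover have "m \<in> Poly_Mapping.keys (hcomp a (wdeg a m) p)"
    using \<open>m \<in> Poly_Mapping.keys p\<close> by (simp add: keys_hcomp)
  ultimately show False by simp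
qed

text \<open>A polynomial is the finite sum of its homogeneous components, so additive properties
  need to be checked on forms only.\<close>

lemma mpoly_induct [consumes 1, case_names zero add]:
  assumes "p \<in> carrier (mpoly_ring n)" and zero: "Q 0"
    and add: "\<And>d f p. f \<in> graded_part n a d \<Longrightarrow> p \<in> carrier (mpoly_ring n) \<Longrightarrow> Q p \<Longrightarrow> Q (f + p)"
  shows "Q p"
proof -
  have "Q (\<Sum>d\<in>D. hcomp a d p)" if "finite D" for D
    using that
  proof induction
    case (insert x F)
    then show ?case
      using assms(1) by (auto intro!: add hcomp_in_graded_part mpoly_ring_sum hcomp_carrier)
  qed (simp add: zero)
  from this[of "wdeg a ` Poly_Mapping.keys p"] show ?thesis by (simp add: sum_hcomp)
qed

lemma hcomp_mult_homogeneous: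
  assumes f: "f \<in> graded_part n a e" and p: "p \<in> carrier (mpoly_ring n)"
  shows "hcomp a d (f * p) = (if e \<le> d then f * hcomp a (d - e) p else 0)"
  using p
proof (induction p rule: mpoly_induct[where a = a])
  case (add i g p)
  have "hcomp a d (f * g) = (if d = e + i then f * g else 0)"
    using hcomp_graded_part[OF graded_part_mult[OF f add(1)]] .
  moreover have "hcomp a (d - e) g = (if d - e = i then g else 0)"
    using hcomp_graded_part[OF add(1)] .
  ultimately show ?case using add(3) by (auto simp: distrib_left hcomp_add)
qed simp

lemma hcomp_mult:
  assumes f: "f \<in> carrier (mpoly_ring n)" and p: "p \<in> carrier (mpoly_ring n)"
  shows "hcomp a d (f * p) = (\<Sum>i\<le>d. hcomp a i f * hcomp a (d - i) p)"
  using f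
proof (induction f rule: mpoly_induct[where a = a])
  case (add e f q)
  have "(\<Sum>i\<le>d. hcomp a i f * hcomp a (d - i) p) = (\<Sum>i\<le>d. if i = e then f * hcomp a (d - e) p else 0)"
    using hcomp_graded_part[OF add(1)] by (intro sum.cong) auto
  then show ?case
    using add(3) hcomp_mult_homogeneous[OF add(1) p, of d]
    by (simp add: distrib_right hcomp_add sum.distrib)
qed simp

text \<open>Primality of a homogeneous ideal can be tested on forms. For \<open>f\<close> and
  \<open>g\<close> outside \<open>I\<close>, take the highest components outside \<open>I\<close>,
  of degrees \<open>d\<close> and \<open>e\<close>: in degree \<open>d + e\<close> of
  \<open>f * g\<close> every other product lies in \<open>I\<close>, hence so would the product of
  these two.\<close>

lemma primeideal_homogeneous:
  fixes I :: "('k::field) mpoly set"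
  assumes sub: "I \<subseteq> carrier (mpoly_ring n)" and zero: "0 \<in> I" and one: "1 \<notin> I"
    and add: "\<And>x y. x \<in> I \<Longrightarrow> y \<in> I \<Longrightarrow> x + y \<in> I"
    and mult: "\<And>x y. x \<in> I \<Longrightarrow> y \<in> carrier (mpoly_ring n) \<Longrightarrow> x * y \<in> I"
    and homog: "\<And>x d. x \<in> I \<Longrightarrow> hcomp a d x \<in> I"
    and prime: "\<And>d e f g. f \<in> graded_part n a d \<Longrightarrow> g \<in> graded_part n a e \<Longrightarrow> f * g \<in> I \<Longrightarrow> f \<in> I \<or> g \<in> I"
  shows "primeideal I (mpoly_ring n)"
proof (rule primeidealI)
  let ?R = "mpoly_ring n :: 'k mpoly ring"
  interpret cring ?R by (rule cring_mpoly_ring)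
  have neg: "- x \<in> I" if "x \<in> I" for x
    using mult[OF that, of "- 1"] by (simp add: mpoly_ring_closed)
  have sum: "sum f S \<in> I" if "\<And>i. i \<in> S \<Longrightarrow> f i \<in> I" for f :: "nat \<Rightarrow> 'k mpoly" and S
    using that by (induction S rule: infinite_finite_induct) (auto intro: add zero)
  show "ideal I ?R"
  proof (rule idealI)
    show "ring ?R" by (rule ring_axioms)
    show "subgroup I (add_monoid ?R)"
      by (rule add.subgroupI) (use sub zero add neg in \<open>auto simp: a_inv_def[symmetric] a_inv_mpoly_ring\<close>)
  qed (auto simp: mult mult.commute)
  show "cring ?R" by (rule is_cring)
  show "carrier ?R \<noteq> I" using one by (metis mpoly_ring_zero_one(2))
  have top: "\<exists>d. hcomp a d f \<notin> I \<and> (\<forall>i>d. hcomp a i f \<in> I)" if f: "f \<in> carrier ?R" "f \<notin> I" for f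
  proof -
    let ?D = "{d. hcomp a d f \<notin> I}"
    have sub: "?D \<subseteq> wdeg a ` Poly_Mapping.keys f"
    proof
      fix d assume "d \<in> ?D"
      then have "hcomp a d f \<noteq> 0" using zero by auto
      then obtain m where "Poly_Mapping.lookup (hcomp a d f) m \<noteq> 0"
        by (metis lookup_zero poly_mapping_eqI)
      then show "d \<in> wdeg a ` Poly_Mapping.keys f" by (auto simp: lookup_hcomp in_keys_iff split: if_split_asm)
    qed
    then have fin: "finite ?D" by (rule finite_subset) simp
    moreover have "?D \<noteq> {}"
      using sum[of "wdeg a ` Poly_Mapping.keys f" "\<lambda>d. hcomp a d f"] f(2) by (auto simp: sum_hcomp)
    ultimately have "Max ?D \<in> ?D" by (rule Max_in)
    then show ?thesis using Max_ge[OF fin] by (intro exI[of _ "Max ?D"]) (auto simp: not_le[symmetric])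
  qed
  fix f g assume f: "f \<in> carrier ?R" and g: "g \<in> carrier ?R" and fg: "f \<otimes>\<^bsub>?R\<^esub> g \<in> I"
  show "f \<in> I \<or> g \<in> I"
  proof (rule ccontr)
    assume "\<not> (f \<in> I \<or> g \<in> I)"
    then obtain d e where d: "hcomp a d f \<notin> I" "\<And>i. i > d \<Longrightarrow> hcomp a i f \<in> I"
      and e: "hcomp a e g \<notin> I" "\<And>i. i > e \<Longrightarrow> hcomp a i g \<in> I"
      using top f g by meson
    let ?t = "\<lambda>i. hcomp a i f * hcomp a (d + e - i) g"
    have "?t i \<in> I" if "i \<in> {..d + e} - {d}" for i
    proof (cases "i > d")
      case True then show ?thesis using mult d(2) g hcomp_carrier by blast
    next
      case False
      then have "d + e - i > e" using that by auto
      then show ?thesis using mult[OF e(2) hcomp_carrier[OF f]] by (simp add: mult.commute)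
    qed
    then have "(\<Sum>i\<in>{..d + e} - {d}. ?t i) \<in> I" by (rule sum)
    moreover have "hcomp a (d + e) (f * g) = ?t d + (\<Sum>i\<in>{..d + e} - {d}. ?t i)"
      unfolding hcomp_mult[OF f g] by (subst sum.remove[of _ d]) auto
    moreover have "hcomp a (d + e) (f * g) \<in> I" using homog fg by simp
    ultimately have "?t d + (\<Sum>i\<in>{..d + e} - {d}. ?t i) + - (\<Sum>i\<in>{..d + e} - {d}. ?t i) \<in> I"
      using add neg by presburger
    then have "?t d \<in> I" by simp
    then show False using prime[OF hcomp_in_graded_part[OF f] hcomp_in_graded_part[OF g], of d e] d(1) e(1) by simp
  qed
qed

section \<open>Homogeneous primes as points of Proj\<close>

context
  fixes n :: nat and a :: "nat \<Rightarrow> nat" and P :: "('k::field) mpoly set"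
  assumes P: "P \<in> Proj n a"
begin

lemma Proj_primeideal: "primeideal P (mpoly_ring n)"
  using P by (simp add: Proj_def)

interpretation primeideal P "mpoly_ring n" by (rule Proj_primeideal)

lemma Proj_carrier: "x \<in> P \<Longrightarrow> x \<in> carrier (mpoly_ring n)"
  by (rule Icarr)

lemma Proj_hcomp: "x \<in> P \<Longrightarrow> hcomp a d x \<in> P"
  using P by (simp add: Proj_def)

lemma Proj_zero: "0 \<in> P"
  using additive_subgroup.zero_closed[OF is_additive_subgroup] by simp

lemma Proj_add: "x \<in> P \<Longrightarrow> y \<in> P \<Longrightarrow> x + y \<in> P"
  using additive_subgroup.a_closed[OF is_additive_subgroup, of x y] by simp

lemma Proj_mult: "x \<in> P \<Longrightarrow> y \<in> carrier (mpoly_ring n) \<Longrightarrow> x * y \<in> P"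
  using I_r_closed[of x y] by simp

lemma Proj_mult_iff:
  "x \<in> carrier (mpoly_ring n) \<Longrightarrow> y \<in> carrier (mpoly_ring n) \<Longrightarrow> x * y \<in> P \<longleftrightarrow> x \<in> P \<or> y \<in> P"
  using I_prime[of x y] Proj_mult[of x y] Proj_mult[of y x] by (auto simp: mult.commute)

lemma Proj_one: "1 \<notin> P"
  using one_imp_carrier I_notcarr by auto

lemma Proj_power_iff: "x \<in> carrier (mpoly_ring n) \<Longrightarrow> k > 0 \<Longrightarrow> x ^ k \<in> P \<longleftrightarrow> x \<in> P"
proof (induction k)
  case (Suc k)
  then show ?case using Proj_one by (cases "k = 0") (auto simp: Proj_mult_iff mpoly_ring_closed)
qed simp

lemma Proj_sum: "(\<And>i. i \<in> I \<Longrightarrow> f i \<in> P) \<Longrightarrow> sum f I \<in> P"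
  by (induction I rule: infinite_finite_induct) (auto intro: Proj_add Proj_zero)

lemma Proj_hcompI: "x \<in> carrier (mpoly_ring n) \<Longrightarrow> (\<And>d. hcomp a d x \<in> P) \<Longrightarrow> x \<in> P"
  using Proj_sum[of "wdeg a ` Poly_Mapping.keys x" "\<lambda>d. hcomp a d x"] by (simp add: sum_hcomp)

end

definition mvar :: "nat \<Rightarrow> ('k::field) mpoly" where
  "mvar i = Poly_Mapping.single (Poly_Mapping.single i 1) 1"

lemma wdeg_single [simp]: "wdeg a (Poly_Mapping.single i k) = a i * k"
  by (cases "k = 0") (auto simp: wdeg_def)

lemma wdeg_zero [simp]: "wdeg a 0 = 0"
  by (simp add: wdeg_def)

lemma mvar_in_graded_part: "i \<le> n \<Longrightarrow> mvar i \<in> graded_part n a (a i)"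
  unfolding mvar_def by (rule graded_part_single) auto

lemma mvar_power: "mvar i ^ k = Poly_Mapping.single (Poly_Mapping.single i k) (1 :: 'k::field)"
  by (induction k) (auto simp: mvar_def mult_single single_add[symmetric])

text \<open>Every monomial of positive degree is divisible by a variable, so a prime with all
  variables would contain the irrelevant ideal.\<close>

lemma Proj_mvar:
  fixes P :: "('k::field) mpoly set"
  assumes P: "P \<in> Proj n a"
  obtains i where "i \<le> n" "mvar i \<notin> P"
proof -
  have False if all: "\<And>i. i \<le> n \<Longrightarrow> mvar i \<in> P"
  proof -
    have "irrelevant_ideal n a \<subseteq> P"
    proof
      fix p :: "'k mpoly" assume p: "p \<in> irrelevant_ideal n a"
      have "Poly_Mapping.single m (Poly_Mapping.lookup p m) \<in> P" if m: "m \<in> Poly_Mapping.keys p" for m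
      proof -
        have "wdeg a m > 0" and km: "Poly_Mapping.keys m \<subseteq> {..n}"
          using p m by (auto simp: irrelevant_ideal_def mem_mpoly_ring)
        then obtain i where i: "i \<in> Poly_Mapping.keys m" unfolding wdeg_def by (metis less_irrefl sum.neutral mult_is_0 ex_in_conv sum.empty)
        define m' where "m' = m - Poly_Mapping.single i 1"
        have m': "m = Poly_Mapping.single i 1 + m'"
          by (rule poly_mapping_eqI) (use i in \<open>auto simp: m'_def lookup_add lookup_minus lookup_single in_keys_iff when_def\<close>)
        have "Poly_Mapping.keys m' \<subseteq> {..n}"
          using km by (auto simp: m'_def in_keys_iff lookup_minus subset_iff)
        then have "mvar i * Poly_Mapping.single m' (Poly_Mapping.lookup p m) \<in> P"
          using i km all by (intro Proj_mult[OF P] mpoly_ring_single) auto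
        then show ?thesis by (simp only: mvar_def mult_single m'[symmetric] mult_1)
      qed
      then have "(\<Sum>m\<in>Poly_Mapping.keys p. Poly_Mapping.single m (Poly_Mapping.lookup p m)) \<in> P"
        by (rule Proj_sum[OF P])
      then show "p \<in> P" by (simp only: mpoly_sum_singles)
    qed
    then show False using P by (simp add: Proj_def)
  qed
  then show thesis using that by blast
qed

lemma ProjI:
  assumes "primeideal P (mpoly_ring n)" "\<And>x d. x \<in> P \<Longrightarrow> hcomp a d x \<in> P"
    and "i \<le> n" "a i > 0" "mvar i \<notin> P"
  shows "P \<in> Proj n a"
proof -
  have "mvar i \<in> irrelevant_ideal n a"
    using assms(3,4) mvar_in_graded_part[of i n a] by (auto simp: irrelevant_ideal_def graded_part_def)
  then show ?thesis using assms by (auto simp: Proj_def)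
qed

text \<open>The generic point lies in every nonempty open set, which makes it the place where local
  expressions of a section are compared.\<close>

lemma generic_point:
  assumes "a 0 > 0" shows "{0} \<in> Proj n a"
proof (rule ProjI[of _ _ _ 0])
  show "primeideal {0} (mpoly_ring n)"
    by (rule primeideal_homogeneous[where a = a]) (auto intro: mpoly_ring_closed)
  show "mvar 0 \<notin> {0 :: 'a mpoly}"
    by (metis insertE empty_iff lookup_single_eq lookup_zero one_neq_zero mvar_def)
qed (use assms in auto)

text \<open>Any other representation \<open>f' / g\<close> of the same germ satisfies
  \<open>f * g = f'\<close> with \<open>g\<close> outside the prime, so the choice of fraction does
  not matter.\<close>

lemma vanishes_at_Fract:
  assumes P: "P \<in> Proj n a" and f: "f \<in> graded_part n a d"
  shows "vanishes_at n a d P (Fract f 1) \<longleftrightarrow> f \<in> P"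
proof
  assume "f \<in> P"
  then show "vanishes_at n a d P (Fract f 1)"
    unfolding vanishes_at_def using f Proj_one[OF P] graded_part_one[of n a]
    by (intro exI[of _ 0] bexI[of _ f] bexI[of _ 1]) auto
next
  assume "vanishes_at n a d P (Fract f 1)"
  then obtain e f' g where f': "f' \<in> graded_part n a (e + d)" "g \<in> graded_part n a e"
      "f' \<in> P" "g \<notin> P" "Fract f 1 = Fract f' g"
    unfolding vanishes_at_def by blast
  moreover have "g \<noteq> 0" using f'(4) Proj_zero[OF P] by auto
  ultimately have "f * g = f'" by (simp add: Fraction_Field.eq_fract)
  then show "f \<in> P" using f' Proj_mult_iff[OF P] f graded_part_carrier by metis
qed

section \<open>Evaluation of polynomials\<close>

locale ring_hom_into =
  fixes h :: "'k::field \<Rightarrow> 'b::comm_ring_1"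
  assumes h0: "h 0 = 0" and h1: "h 1 = 1" and hadd: "h (x + y) = h x + h y" and hmult: "h (x * y) = h x * h y"
begin

lemma mpoly_eval_superset:
  assumes "finite K" "Poly_Mapping.keys p \<subseteq> K"
  shows "mpoly_eval h t p = (\<Sum>m\<in>K. h (Poly_Mapping.lookup p m) *
            (\<Prod>i\<in>Poly_Mapping.keys m. t i ^ Poly_Mapping.lookup m i))"
  unfolding mpoly_eval_def using assms by (intro sum.mono_neutral_left) (auto simp: in_keys_iff h0)

lemma mpoly_eval_zero [simp]: "mpoly_eval h t 0 = 0"
  by (simp add: mpoly_eval_def)

lemma mpoly_eval_add: "mpoly_eval h t (p + q) = mpoly_eval h t p + mpoly_eval h t q"
proof -
  let ?K = "Poly_Mapping.keys p \<union> Poly_Mapping.keys q"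
  have "finite ?K" by simp
  from mpoly_eval_superset[OF this] show ?thesis
    using Poly_Mapping.keys_add[of p q] by (simp add: lookup_add hadd distrib_right sum.distrib)
qed

lemma mpoly_eval_sum: "mpoly_eval h t (sum f I) = (\<Sum>i\<in>I. mpoly_eval h t (f i))"
  by (induction I rule: infinite_finite_induct) (auto simp: mpoly_eval_add)

lemma mpoly_eval_single:
  "mpoly_eval h t (Poly_Mapping.single m c) = h c * (\<Prod>i\<in>Poly_Mapping.keys m. t i ^ Poly_Mapping.lookup m i)"
  by (subst mpoly_eval_superset[of "{m}"]) auto

lemma mpoly_eval_one [simp]: "mpoly_eval h t 1 = 1"
  using mpoly_eval_single[of t 0 1] by (simp add: h1)

lemma mpoly_eval_mult: "mpoly_eval h t (p * q) = mpoly_eval h t p * mpoly_eval h t q"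
proof -
  define T where "T m = (\<Prod>i\<in>Poly_Mapping.keys m. t i ^ Poly_Mapping.lookup m i)" for m
  have T: "T m = (\<Prod>i\<in>K. t i ^ Poly_Mapping.lookup m i)" if "finite K" "Poly_Mapping.keys m \<subseteq> K" for m K
    unfolding T_def using that by (intro prod.mono_neutral_left) (auto simp: in_keys_iff)
  have T_add: "T (m + m') = T m * T m'" for m m'
  proof -
    let ?K = "Poly_Mapping.keys m \<union> Poly_Mapping.keys m'"
    have "finite ?K" by simp
    from T[OF this] show ?thesis
      using Poly_Mapping.keys_add[of m m'] by (simp add: lookup_add power_add prod.distrib)
  qed
  have "p * q = (\<Sum>m\<in>Poly_Mapping.keys p. \<Sum>m'\<in>Poly_Mapping.keys q.
      Poly_Mapping.single (m + m') (Poly_Mapping.lookup p m * Poly_Mapping.lookup q m'))"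
    by (subst mpoly_sum_singles[of p, symmetric], subst mpoly_sum_singles[of q, symmetric])
      (simp only: sum_product mult_single)
  then have "mpoly_eval h t (p * q) = (\<Sum>m\<in>Poly_Mapping.keys p. \<Sum>m'\<in>Poly_Mapping.keys q.
      h (Poly_Mapping.lookup p m * Poly_Mapping.lookup q m') * T (m + m'))"
    by (simp add: mpoly_eval_sum mpoly_eval_single T_def)
  also have "\<dots> = mpoly_eval h t p * mpoly_eval h t q"
    unfolding mpoly_eval_def T_def[symmetric] sum_product by (simp add: hmult T_add ac_simps)
  finally show ?thesis .
qed

end

lemma ring_hom_into_const: "ring_hom_into (\<lambda>c :: 'k::field. Poly_Mapping.single 0 c :: 'k mpoly)"
  by unfold_locales (auto simp: single_add mult_single)

lemma Fract_one_add: "Fract (x + y) 1 = Fract x 1 + Fract y (1 :: 'a::idom)"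
  by simp

lemma Fract_one_mult: "Fract (x * y) 1 = Fract x 1 * Fract y (1 :: 'a::idom)"
  by simp

lemma Fract_one_sum: "Fract (sum f I) 1 = (\<Sum>i\<in>I. Fract (f i) (1 :: 'a::idom))"
proof (induction I rule: infinite_finite_induct)
  case (insert x F)
  then show ?case by (simp only: sum.insert[OF insert(1,2)] Fract_one_add)
qed (simp_all add: Fraction_Field.Zero_fract_def)

lemma Fract_one_prod: "Fract (prod f I) 1 = (\<Prod>i\<in>I. Fract (f i) (1 :: 'a::idom))"
proof (induction I rule: infinite_finite_induct)
  case (insert x F)
  then show ?case by (simp only: prod.insert[OF insert(1,2)] Fract_one_mult)
qed (simp_all add: Fraction_Field.One_fract_def)

lemma Fract_one_power: "Fract (x ^ k) 1 = (Fract x (1 :: 'a::idom)) ^ k"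
proof (induction k)
  case (Suc k)
  then show ?case by (simp only: power_Suc Fract_one_mult)
qed (simp add: Fraction_Field.One_fract_def)

text \<open>Moves the evaluation at sections from the fraction field back to the polynomial ring,
  where degrees are available.\<close>

lemma mpoly_eval_scalar_Fract:
  fixes t :: "nat \<Rightarrow> ('k::field) mpoly"
  shows "mpoly_eval scalar (\<lambda>i. Fract (t i) 1) F = Fract (mpoly_eval (Poly_Mapping.single 0) t F) 1"
  unfolding mpoly_eval_def Fract_one_sum Fract_one_mult Fract_one_prod Fract_one_power scalar_def ..

section \<open>Global sections of the twisting sheaves\<close>

text \<open>Homogeneous ideals as bare closure conditions, a form that is easy to check for unions
  of chains in Zorn's lemma.\<close>

definition homogeneous_ideal :: "nat \<Rightarrow> (nat \<Rightarrow> nat) \<Rightarrow> ('k::field) mpoly set \<Rightarrow> bool" where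
  "homogeneous_ideal n a I \<longleftrightarrow> I \<subseteq> carrier (mpoly_ring n) \<and> 0 \<in> I \<and>
     (\<forall>x\<in>I. \<forall>y\<in>I. x + y \<in> I) \<and> (\<forall>x\<in>I. \<forall>y\<in>carrier (mpoly_ring n). x * y \<in> I) \<and>
     (\<forall>x\<in>I. \<forall>d. hcomp a d x \<in> I)"

text \<open>The homogeneous version of a standard fact: an ideal that is maximal among those
  avoiding all powers of an element is prime.\<close>

lemma exists_Proj_avoiding:
  fixes D :: "('k::field) mpoly set"
  assumes D: "homogeneous_ideal n a D" and i: "i \<le> n" "a i > 0" and no: "\<And>k. mvar i ^ k \<notin> D"
  obtains P where "P \<in> Proj n a" "D \<subseteq> P" "mvar i \<notin> P"
proof -
  define \<A> where "\<A> = {J. homogeneous_ideal n a J \<and> D \<subseteq> J \<and> (\<forall>k. mvar i ^ k \<notin> J)}"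
  have "\<exists>M\<in>\<A>. \<forall>X\<in>\<A>. M \<subseteq> X \<longrightarrow> X = M"
  proof (rule subset_Zorn_nonempty)
    show "\<A> \<noteq> {}" using D no by (auto simp: \<A>_def)
    fix C assume C: "C \<noteq> {}" "subset.chain \<A> C"
    then have CA: "J \<in> \<A>" if "J \<in> C" for J using that by (auto simp: subset.chain_def)
    then have CH: "homogeneous_ideal n a J" if "J \<in> C" for J using that by (auto simp: \<A>_def)
    obtain J0 where J0: "J0 \<in> C" using C by blast
    have "homogeneous_ideal n a (\<Union>C)"
      unfolding homogeneous_ideal_def
    proof (intro conjI ballI allI)
      show "\<Union>C \<subseteq> carrier (mpoly_ring n)" using CH unfolding homogeneous_ideal_def by blast
      show "0 \<in> \<Union>C" using CH[OF J0] J0 unfolding homogeneous_ideal_def by blast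
      fix x assume "x \<in> \<Union>C"
      then obtain J where J: "J \<in> C" "x \<in> J" by blast
      show "x * y \<in> \<Union>C" if "y \<in> carrier (mpoly_ring n)" for y
        using that CH[OF J(1)] J unfolding homogeneous_ideal_def by blast
      show "hcomp a d x \<in> \<Union>C" for d
        using CH[OF J(1)] J unfolding homogeneous_ideal_def by blast
      fix y assume "y \<in> \<Union>C"
      then obtain J' where J': "J' \<in> C" "y \<in> J'" by blast
      have "J \<subseteq> J' \<or> J' \<subseteq> J" using C(2) J J' by (auto simp: subset.chain_def)
      then have "x \<in> J' \<and> y \<in> J' \<or> x \<in> J \<and> y \<in> J" using J J' by blast
      then have "x + y \<in> J' \<or> x + y \<in> J"
        using CH[OF J(1)] CH[OF J'(1)] by (auto simp: homogeneous_ideal_def)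
      then show "x + y \<in> \<Union>C" using J(1) J'(1) by blast
    qed
    moreover have "D \<subseteq> \<Union>C" using CA[OF J0] J0 by (auto simp: \<A>_def)
    moreover have "\<forall>k. mvar i ^ k \<notin> \<Union>C" using CA by (auto simp: \<A>_def)
    ultimately show "\<Union>C \<in> \<A>" by (simp add: \<A>_def)
  qed
  then obtain M where M: "M \<in> \<A>" and max: "\<And>X. X \<in> \<A> \<Longrightarrow> M \<subseteq> X \<Longrightarrow> X = M" by blast
  have Mcar: "\<And>x. x \<in> M \<Longrightarrow> x \<in> carrier (mpoly_ring n)" and M0: "0 \<in> M"
    and Madd: "\<And>x y. x \<in> M \<Longrightarrow> y \<in> M \<Longrightarrow> x + y \<in> M"
    and Mmult: "\<And>x y. x \<in> M \<Longrightarrow> y \<in> carrier (mpoly_ring n) \<Longrightarrow> x * y \<in> M"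
    and Mhom: "\<And>x d. x \<in> M \<Longrightarrow> hcomp a d x \<in> M"
    and DM: "D \<subseteq> M" and noM: "\<And>k. mvar i ^ k \<notin> M"
    using M unfolding \<A>_def homogeneous_ideal_def by blast+
  \<comment> \<open>By maximality, adjoining a form outside \<open>M\<close> yields a homogeneous
    ideal that contains a power of the variable.\<close>
  have ext: "\<exists>k u v. mvar i ^ k = u + v * f \<and> u \<in> M \<and> v \<in> carrier (mpoly_ring n)"
    if f: "f \<in> graded_part n a d" "f \<notin> M" for f d
  proof (rule ccontr)
    assume neg: "\<not> ?thesis"
    have fc: "f \<in> carrier (mpoly_ring n)" using f(1) by (rule graded_part_carrier)
    define X where "X = {u + v * f |u v. u \<in> M \<and> v \<in> carrier (mpoly_ring n)}"
    have XI: "u + v * f \<in> X" if "u \<in> M" "v \<in> carrier (mpoly_ring n)" for u v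
      using that by (auto simp: X_def)
    have MX: "M \<subseteq> X" using XI[of _ 0] by (auto intro: mpoly_ring_closed)
    have "homogeneous_ideal n a X"
      unfolding homogeneous_ideal_def
    proof (intro conjI ballI allI)
      show "X \<subseteq> carrier (mpoly_ring n)" using Mcar fc by (auto simp: X_def intro!: mpoly_ring_closed)
      show "0 \<in> X" using MX M0 by blast
      fix x assume "x \<in> X"
      then obtain u v where x: "x = u + v * f" "u \<in> M" "v \<in> carrier (mpoly_ring n)" by (auto simp: X_def)
      show "x * y \<in> X" if "y \<in> carrier (mpoly_ring n)" for y
        using XI[OF Mmult[OF x(2) that] mpoly_ring_mult[OF x(3) that]] by (simp add: x(1) algebra_simps)
      show "hcomp a e x \<in> X" for e
        using XI[OF Mhom[OF x(2), of e], of "if d \<le> e then hcomp a (e - d) v else 0"]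
          hcomp_mult_homogeneous[OF f(1) x(3), of e] hcomp_carrier[OF x(3), of a "e - d"]
        by (auto simp: x(1) hcomp_add mult.commute mpoly_ring_closed split: if_split_asm)
      fix y assume "y \<in> X"
      then obtain u' v' where y: "y = u' + v' * f" "u' \<in> M" "v' \<in> carrier (mpoly_ring n)" by (auto simp: X_def)
      show "x + y \<in> X"
        using XI[OF Madd[OF x(2) y(2)] mpoly_ring_add[OF x(3) y(3)]] by (simp add: x(1) y(1) algebra_simps)
    qed
    moreover have "\<forall>k. mvar i ^ k \<notin> X" using neg unfolding X_def by blast
    ultimately have "X \<in> \<A>" using DM MX by (auto simp: \<A>_def)
    then have "X = M" using max MX by blast
    then show False using XI[OF M0, of 1] f(2) by (simp add: mpoly_ring_closed)
  qed
  have "primeideal M (mpoly_ring n)"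
  proof (rule primeideal_homogeneous[where a = a])
    show "1 \<notin> M" using noM[of 0] by simp
    fix d e f g
    assume f: "f \<in> graded_part n a d" and g: "g \<in> graded_part n a e" and fg: "f * g \<in> M"
    show "f \<in> M \<or> g \<in> M"
    proof (rule ccontr)
      assume "\<not> ?thesis"
      then obtain k u v k' u' v' where
        u: "mvar i ^ k = u + v * f" "u \<in> M" "v \<in> carrier (mpoly_ring n)" and
        u': "mvar i ^ k' = u' + v' * g" "u' \<in> M" "v' \<in> carrier (mpoly_ring n)"
        using ext f g by meson
      note c = graded_part_carrier[OF f] graded_part_carrier[OF g] u(3) u'(3) Mcar[OF u'(2)]
      \<comment> \<open>In the product of the two expressions each summand has a factor
        \<open>u\<close>, \<open>u'\<close> or \<open>f * g\<close>, all of which are in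
        \<open>M\<close>.\<close>
      have "mvar i ^ (k + k') = u * (u' + v' * g) + (u' * (v * f) + f * g * (v * v'))"
        unfolding power_add u(1) u'(1) by (simp add: algebra_simps)
      also have "\<dots> \<in> M"
        by (intro Madd Mmult u u' fg mpoly_ring_closed c)
      finally show False using noM by blast
    qed
  qed (use Mcar M0 Madd Mmult Mhom in auto)
  moreover have "mvar i \<notin> M" using noM[of 1] by simp
  ultimately have "M \<in> Proj n a" using i Mhom by (intro ProjI) auto
  then show thesis using DM \<open>mvar i \<notin> M\<close> by (rule that)
qed

lemma lookup_single_mult: "Poly_Mapping.lookup (Poly_Mapping.single u c * p) (u + m) = c * Poly_Mapping.lookup p m"
  for p :: "('k::field) mpoly"
proof -
  have "Poly_Mapping.single u c * p =
      (\<Sum>v\<in>Poly_Mapping.keys p. Poly_Mapping.single (u + v) (c * Poly_Mapping.lookup p v))"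
    by (subst mpoly_sum_singles[of p, symmetric]) (simp only: sum_distrib_left mult_single)
  also have "Poly_Mapping.lookup \<dots> (u + m) = (\<Sum>v\<in>Poly_Mapping.keys p. if v = m then c * Poly_Mapping.lookup p m else 0)"
    unfolding lookup_sum by (intro sum.cong) (auto simp: lookup_single when_def)
  finally show ?thesis by (simp add: in_keys_iff)
qed

text \<open>Powers of different variables are coprime: multiplication by a power of variable
  \<open>j\<close> does not change the exponent of variable \<open>i\<close>, so that exponent is at
  least \<open>k\<close> already in \<open>p\<close>.\<close>

lemma mvar_power_dvd:
  fixes p q :: "('k::field) mpoly"
  assumes ij: "i \<noteq> j" and eq: "mvar j ^ l * p = mvar i ^ k * q" and p: "p \<in> carrier (mpoly_ring n)"
  obtains r where "r \<in> carrier (mpoly_ring n)" "p = mvar i ^ k * r"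
proof -
  have ge: "Poly_Mapping.lookup m i \<ge> k" if m: "m \<in> Poly_Mapping.keys p" for m
  proof -
    have "Poly_Mapping.lookup (mvar j ^ l * p) (Poly_Mapping.single j l + m) \<noteq> 0"
      unfolding mvar_power lookup_single_mult using m by (simp add: in_keys_iff)
    then have "Poly_Mapping.single j l + m \<in> Poly_Mapping.keys (mvar i ^ k * q)"
      by (simp add: eq in_keys_iff)
    then obtain v where "Poly_Mapping.single j l + m = Poly_Mapping.single i k + v"
      using keys_mult[of "mvar i ^ k" q] by (auto simp: mvar_power)
    from arg_cong[OF this, of "\<lambda>m. Poly_Mapping.lookup m i"] show ?thesis
      using ij by (simp add: lookup_add lookup_single)
  qed
  define r where "r = (\<Sum>m\<in>Poly_Mapping.keys p.
      Poly_Mapping.single (m - Poly_Mapping.single i k) (Poly_Mapping.lookup p m))"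
  have "r \<in> carrier (mpoly_ring n)"
    unfolding r_def
  proof (intro mpoly_ring_sum mpoly_ring_single)
    fix m assume "m \<in> Poly_Mapping.keys p"
    then have "Poly_Mapping.keys m \<subseteq> {..n}" using p by (auto simp: mem_mpoly_ring)
    then show "Poly_Mapping.keys (m - Poly_Mapping.single i k) \<subseteq> {..n}"
      by (auto simp: in_keys_iff lookup_minus subset_iff)
  qed
  moreover have "mvar i ^ k * r = p"
  proof -
    have "Poly_Mapping.single i k + (m - Poly_Mapping.single i k) = m" if "m \<in> Poly_Mapping.keys p" for m
      by (rule poly_mapping_eqI) (use ge[OF that] in \<open>auto simp: lookup_add lookup_minus lookup_single when_def\<close>)
    then have "mvar i ^ k * r = (\<Sum>m\<in>Poly_Mapping.keys p. Poly_Mapping.single m (Poly_Mapping.lookup p m))"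
      unfolding r_def mvar_power sum_distrib_left mult_single by (intro sum.cong) auto
    then show ?thesis by (simp only: mpoly_sum_singles)
  qed
  ultimately show thesis using that by metis
qed

lemma openin_zariski_iff:
  "openin (zariski n a) U \<longleftrightarrow> (\<exists>E. E \<subseteq> (\<Union>d. graded_part n a d) \<and> U = {P \<in> Proj n a. \<not> E \<subseteq> P})"
  by (simp add: openin_zariski zariski_open_def)

lemma openin_zariski_Proj: "openin (zariski n a) (Proj n a)"
  unfolding openin_zariski_iff
  by (intro exI[of _ "{1}"]) (use graded_part_one Proj_one in fast)

lemma topspace_zariski: "topspace (zariski n a) = Proj n a"
proof
  show "topspace (zariski n a) \<subseteq> Proj n a"
    using openin_topspace[of "zariski n a"] unfolding openin_zariski_iff by blast
  show "Proj n a \<subseteq> topspace (zariski n a)"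
    by (rule openin_subset[OF openin_zariski_Proj])
qed

lemma generic_point_in_open:
  assumes "a 0 > 0" "openin (zariski n a) V" "P \<in> V"
  shows "{0} \<in> V"
  using assms generic_point[of a, OF assms(1)] Proj_zero[of P n a] unfolding openin_zariski_iff by blast

lemma twist_sheaf_iff:
  "s \<in> twist_sheaf n a d U \<longleftrightarrow> s \<in> extensional U \<and>
     (\<forall>P\<in>U. \<exists>V e f g. openin (zariski n a) V \<and> P \<in> V \<and> V \<subseteq> U \<and>
        f \<in> graded_part n a (e + d) \<and> g \<in> graded_part n a e \<and> (\<forall>Q\<in>V. g \<notin> Q \<and> s Q = Fract f g))"
  by (simp add: twist_sheaf_def Bex_def)

lemma twist_sheafD:
  assumes "s \<in> twist_sheaf n a d U" "P \<in> U"
  shows "\<exists>V e f g. openin (zariski n a) V \<and> P \<in> V \<and> V \<subseteq> U \<and>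
    f \<in> graded_part n a (e + d) \<and> g \<in> graded_part n a e \<and> (\<forall>Q\<in>V. g \<notin> Q \<and> s Q = Fract f g)"
  using assms(1)[unfolded twist_sheaf_iff, THEN conjunct2, THEN bspec, OF assms(2)] .

lemma const_in_twist_sheaf:
  assumes "f \<in> graded_part n a d"
  shows "(\<lambda>P\<in>Proj n a. Fract f 1) \<in> twist_sheaf n a d (Proj n a)"
  unfolding twist_sheaf_iff
proof (intro conjI ballI)
  fix P :: "'a mpoly set" assume P: "P \<in> Proj n a"
  have no_one: "1 \<notin> Q" if "Q \<in> Proj n a" for Q :: "'a mpoly set" using that by (rule Proj_one)
  show "\<exists>V e f' g. openin (zariski n a) V \<and> P \<in> V \<and> V \<subseteq> Proj n a \<and>
      f' \<in> graded_part n a (e + d) \<and> g \<in> graded_part n a e \<and>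
      (\<forall>Q\<in>V. g \<notin> Q \<and> (\<lambda>P\<in>Proj n a. Fract f 1) Q = Fract f' g)"
    by (rule exI[of _ "Proj n a"], rule exI[of _ 0], rule exI[of _ f], rule exI[of _ 1])
      (use assms P openin_zariski_Proj graded_part_one no_one in auto)
qed simp

text \<open>All local fractions of a section agree with its value at the generic point. The ideal of
  denominators of this value is contained in no point, hence it contains a power of every variable.
  Powers of two different variables as denominators force a polynomial; \<open>n >= 1\<close>
  supplies the second variable.\<close>

theorem twist_sheaf_Proj:
  fixes s :: "('k::field) sect"
  assumes pos: "\<And>i. i \<le> n \<Longrightarrow> a i > 0" and n: "n \<ge> 1" and s: "s \<in> twist_sheaf n a d (Proj n a)"
  obtains f where "f \<in> graded_part n a d" "s = (\<lambda>P\<in>Proj n a. Fract f 1)"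
proof -
  have a0: "a 0 > 0" by (rule pos) simp
  have loc: "\<exists>e. \<exists>f\<in>graded_part n a (e + d). \<exists>g\<in>graded_part n a e. g \<notin> P \<and> s P = Fract f g \<and> s {0} = Fract f g"
    if P: "P \<in> Proj n a" for P
  proof -
    obtain V e f g where *: "openin (zariski n a) V" "P \<in> V" "f \<in> graded_part n a (e + d)" "g \<in> graded_part n a e"
      "\<forall>Q\<in>V. g \<notin> Q \<and> s Q = Fract f g"
      using s P unfolding twist_sheaf_iff by metis
    then show ?thesis using generic_point_in_open[of a, OF a0 *(1,2)] by blast
  qed
  obtain e1 f1 g1 where 1: "f1 \<in> graded_part n a (e1 + d)" "g1 \<in> graded_part n a e1" "g1 \<noteq> 0" "s {0} = Fract f1 g1"
    using loc[OF generic_point[of a, OF a0]] by blast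
  note c1 = graded_part_carrier[OF 1(1)] graded_part_carrier[OF 1(2)]
  define D where "D = {g \<in> carrier (mpoly_ring n). \<exists>h\<in>carrier (mpoly_ring n). g * f1 = h * g1}"
  have D: "homogeneous_ideal n a D"
    unfolding homogeneous_ideal_def
  proof (intro conjI ballI allI)
    show "D \<subseteq> carrier (mpoly_ring n)" by (auto simp: D_def)
    show "0 \<in> D" by (auto simp: D_def intro!: mpoly_ring_closed bexI[of _ 0])
    fix x assume "x \<in> D"
    then obtain h where x: "x \<in> carrier (mpoly_ring n)" "h \<in> carrier (mpoly_ring n)" "x * f1 = h * g1"
      by (auto simp: D_def)
    show "x * y \<in> D" if "y \<in> carrier (mpoly_ring n)" for y
      unfolding D_def using that x by (auto intro!: mpoly_ring_closed bexI[of _ "h * y"] simp: ac_simps)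
    show "hcomp a k x \<in> D" for k
    proof -
      have "f1 * hcomp a k x = hcomp a (k + (e1 + d)) (f1 * x)"
        using hcomp_mult_homogeneous[OF 1(1) x(1), of "k + (e1 + d)"] by simp
      also have "f1 * x = g1 * h" using x(3) by (simp add: mult.commute)
      also have "hcomp a (k + (e1 + d)) (g1 * h) = g1 * hcomp a (k + d) h"
        using hcomp_mult_homogeneous[OF 1(2) x(2), of "k + (e1 + d)"] by (simp add: algebra_simps)
      finally show ?thesis
        unfolding D_def using x hcomp_carrier by (auto simp: mult.commute)
    qed
    fix y assume "y \<in> D"
    then obtain h' where y: "y \<in> carrier (mpoly_ring n)" "h' \<in> carrier (mpoly_ring n)" "y * f1 = h' * g1"
      by (auto simp: D_def)
    show "x + y \<in> D"
      unfolding D_def using x y by (auto intro!: mpoly_ring_closed bexI[of _ "h + h'"] simp: distrib_right)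
  qed
  have pow: "\<exists>k. mvar i ^ k \<in> D" if i: "i \<le> n" for i
  proof (rule ccontr)
    assume "\<not> ?thesis"
    then obtain P where P: "P \<in> Proj n a" "D \<subseteq> P"
      using exists_Proj_avoiding[OF D i pos[OF i]] by blast
    obtain e f g where f: "f \<in> graded_part n a (e + d)" "g \<in> graded_part n a e" "g \<notin> P" "s {0} = Fract f g"
      using loc[OF P(1)] by blast
    have "g \<noteq> 0" using f(3) Proj_zero[OF P(1)] by auto
    then have "f1 * g = f * g1" using f(4) 1(3,4) by (simp add: Fraction_Field.eq_fract)
    then have "g \<in> D" unfolding D_def using f graded_part_carrier by (auto simp: mult.commute)
    then show False using f(3) P(2) by blast
  qed
  obtain k h0 where k: "h0 \<in> carrier (mpoly_ring n)" "mvar 0 ^ k * f1 = h0 * g1"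
    using pow[of 0] by (auto simp: D_def)
  obtain l h1 where l: "h1 \<in> carrier (mpoly_ring n)" "mvar 1 ^ l * f1 = h1 * g1"
    using pow[of 1] n by (auto simp: D_def)
  have "(mvar 1 ^ l * h0) * g1 = (mvar 0 ^ k * h1) * g1"
    using k(2) l(2) by (metis (no_types, lifting) mult.assoc mult.left_commute)
  then have "mvar 1 ^ l * h0 = mvar 0 ^ k * h1" using 1(3) by simp
  then obtain r where r: "r \<in> carrier (mpoly_ring n)" "h0 = mvar 0 ^ k * r"
    using mvar_power_dvd[OF _ _ k(1)] by (metis zero_neq_one)
  have "mvar 0 ^ k \<noteq> (0 :: 'k mpoly)" by (metis mvar_power lookup_single_eq lookup_zero one_neq_zero)
  moreover have "mvar 0 ^ k * f1 = mvar 0 ^ k * (g1 * r)" using k(2) r(2) by (simp add: ac_simps)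
  ultimately have f1: "f1 = g1 * r" by (metis mult_left_cancel)
  have "r \<in> graded_part n a d"
  proof (rule graded_part_eq_hcomp[OF r(1)])
    fix e assume "e \<noteq> d"
    then have "hcomp a (e1 + e) f1 = 0" using hcomp_graded_part[OF 1(1), of "e1 + e"] by simp
    then show "hcomp a e r = 0"
      using hcomp_mult_homogeneous[OF 1(2) r(1), of "e1 + e"] 1(3) by (simp add: f1)
  qed
  moreover have "s = (\<lambda>P\<in>Proj n a. Fract r 1)"
  proof
    fix P
    have z: "s {0} = Fract r 1" using 1(3,4) f1 by (simp add: Fraction_Field.eq_fract mult.commute)
    show "s P = (\<lambda>P\<in>Proj n a. Fract r 1) P"
    proof (cases "P \<in> Proj n a")
      case True then show ?thesis using loc[OF True] z by auto
    next
      case False then show ?thesis using s by (auto simp: twist_sheaf_def extensional_def)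
    qed
  qed
  ultimately show thesis by (rule that)
qed

lemma is_section_basis_monomials:
  fixes \<mu> :: "nat \<Rightarrow> nat \<Rightarrow>\<^sub>0 nat"
  assumes pos: "\<And>i. i \<le> n \<Longrightarrow> a i > 0" and n: "n \<ge> 1"
    and \<mu>: "bij_betw \<mu> {..N} {m. Poly_Mapping.keys m \<subseteq> {..n} \<and> wdeg a m = d}"
  shows "is_section_basis n a d N (\<lambda>i. \<lambda>P\<in>Proj n a. Fract (Poly_Mapping.single (\<mu> i) (1 :: 'k::field)) 1)"
proof -
  define p where "p c = (\<Sum>i\<le>N. Poly_Mapping.single (\<mu> i) (c i :: 'k))" for c
  have a0: "a 0 > 0" by (rule pos) simp
  have \<mu>_mem: "Poly_Mapping.keys (\<mu> i) \<subseteq> {..n}" "wdeg a (\<mu> i) = d" if "i \<le> N" for i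
    using bij_betwE[OF \<mu>] that by auto
  have val: "(\<lambda>P\<in>(Proj n a :: 'k mpoly set set). \<Sum>i\<le>N. scalar (c i) * (\<lambda>P\<in>Proj n a. Fract (Poly_Mapping.single (\<mu> i) (1 :: 'k)) 1) P)
      = (\<lambda>P\<in>Proj n a. Fract (p c) 1)" for c
  proof (rule restrict_ext)
    fix P :: "'k mpoly set" assume "P \<in> Proj n a"
    moreover have "scalar (c i) * Fract (Poly_Mapping.single (\<mu> i) 1) 1 = Fract (Poly_Mapping.single (\<mu> i) (c i)) 1" for i
      by (simp add: scalar_def mult_single)
    ultimately show "(\<Sum>i\<le>N. scalar (c i) * (\<lambda>P\<in>Proj n a. Fract (Poly_Mapping.single (\<mu> i) (1 :: 'k)) 1) P) = Fract (p c) 1"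
      by (simp add: p_def Fract_one_sum)
  qed
  have lookup_p: "Poly_Mapping.lookup (p c) (\<mu> i) = c i" if i: "i \<le> N" for c i
  proof -
    have "Poly_Mapping.lookup (p c) (\<mu> i) = (\<Sum>j\<le>N. if j = i then c i else 0)"
      unfolding p_def lookup_sum
    proof (intro sum.cong refl)
      fix j assume "j \<in> {..N}"
      then have "\<mu> j = \<mu> i \<longleftrightarrow> j = i" using inj_on_eq_iff[OF bij_betw_imp_inj_on[OF \<mu>]] i by auto
      then show "Poly_Mapping.lookup (Poly_Mapping.single (\<mu> j) (c j)) (\<mu> i) = (if j = i then c i else 0)"
        by (auto simp: lookup_single when_def)
    qed
    then show ?thesis using i by simp
  qed
  have p_mem: "p c \<in> graded_part n a d" for c
    unfolding p_def by (intro graded_part_sum graded_part_single \<mu>_mem) auto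
  have "bij_betw (\<lambda>c. \<lambda>P\<in>(Proj n a :: 'k mpoly set set). Fract (p c) 1) ({..N} \<rightarrow>\<^sub>E (UNIV :: 'k set)) (twist_sheaf n a d (Proj n a))"
    unfolding bij_betw_def
  proof
    show "inj_on (\<lambda>c. \<lambda>P\<in>(Proj n a :: 'k mpoly set set). Fract (p c) 1) ({..N} \<rightarrow>\<^sub>E (UNIV :: 'k set))"
    proof (rule inj_onI)
      fix c c' :: "nat \<Rightarrow> 'k"
      assume c: "c \<in> {..N} \<rightarrow>\<^sub>E UNIV" "c' \<in> {..N} \<rightarrow>\<^sub>E UNIV"
        and eq: "(\<lambda>P\<in>(Proj n a :: 'k mpoly set set). Fract (p c) 1) = (\<lambda>P\<in>Proj n a. Fract (p c') 1)"
      have "{0 :: 'k mpoly} \<in> Proj n a" using a0 by (rule generic_point)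
      then have "Fract (p c) 1 = Fract (p c') 1"
        using fun_cong[OF eq, of "{0}"] by simp
      then have "p c = p c'" by (simp add: Fraction_Field.eq_fract)
      then have "c i = c' i" if "i \<in> {..N}" for i using that lookup_p by (metis atMost_iff)
      then show "c = c'" using c by (metis PiE_ext)
    qed
    show "(\<lambda>c. \<lambda>P\<in>(Proj n a :: 'k mpoly set set). Fract (p c) 1) ` ({..N} \<rightarrow>\<^sub>E (UNIV :: 'k set)) = twist_sheaf n a d (Proj n a)"
    proof (intro Set.set_eqI iffI)
      fix s :: "'k sect" assume "s \<in> twist_sheaf n a d (Proj n a)"
      then obtain f where f: "f \<in> graded_part n a d" "s = (\<lambda>P\<in>Proj n a. Fract f 1)"
        using twist_sheaf_Proj[of n a, OF pos n] by blast
      define c where "c = (\<lambda>i\<in>{..N}. Poly_Mapping.lookup f (\<mu> i))"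
      have "p c = f"
      proof (rule poly_mapping_eqI)
        fix m show "Poly_Mapping.lookup (p c) m = Poly_Mapping.lookup f m"
        proof (cases "Poly_Mapping.keys m \<subseteq> {..n} \<and> wdeg a m = d")
          case True
          then have "m \<in> \<mu> ` {..N}" using bij_betw_imp_surj_on[OF \<mu>] by simp
          then obtain i where "i \<le> N" "m = \<mu> i" by auto
          then show ?thesis by (simp add: lookup_p c_def)
        next
          case False
          then have "m \<notin> Poly_Mapping.keys g" if "g \<in> graded_part n a d" for g :: "'k mpoly"
            using that by (auto simp: graded_part_def mem_mpoly_ring)
          then show ?thesis using p_mem f(1) by (simp add: in_keys_iff)
        qed
      qed
      then show "s \<in> (\<lambda>c. \<lambda>P\<in>(Proj n a :: 'k mpoly set set). Fract (p c) 1) ` ({..N} \<rightarrow>\<^sub>E UNIV)"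
        using f(2) by (intro image_eqI[of _ _ c]) (auto simp: c_def)
    qed (auto intro: const_in_twist_sheaf p_mem)
  qed
  then show ?thesis unfolding is_section_basis_def val .
qed

section \<open>Integral closedness of polynomial rings\<close>

text \<open>In infinitely many variables the lexicographic order has the descending chain x_0 > x_1
  > x_2 > ..., so descent on leading monomials is measured by a finite list of exponents.\<close>

lemma lex_less_in_measures:
  assumes "k < length fs" "(fs ! k) x < (fs ! k) y" "\<And>j. j < k \<Longrightarrow> (fs ! j) x = (fs ! j) y"
  shows "(x, y) \<in> measures fs"
  using assms
proof (induction fs arbitrary: k)
  case (Cons f fs)
  show ?case
  proof (cases k)
    case 0 then show ?thesis using Cons.prems by (simp add: measures_less)
  next
    case (Suc j)
    have "(x, y) \<in> measures fs"
      using Cons.prems Suc Cons.prems(3)[of "Suc _"] by (intro Cons.IH[of j]) auto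
    moreover have "f x = f y" using Cons.prems(3)[of 0] Suc by simp
    ultimately show ?thesis by (simp add: measures_lesseq)
  qed
qed simp

text \<open>The maximum refers to the lexicographic order on exponent vectors, which is compatible
  with their addition.\<close>

definition lm :: "('k::field) mpoly \<Rightarrow> (nat \<Rightarrow>\<^sub>0 nat)" where
  "lm p = Max (Poly_Mapping.keys p)"

lemma lm_in_keys: "p \<noteq> 0 \<Longrightarrow> lm p \<in> Poly_Mapping.keys p"
  unfolding lm_def by (intro Max_in) (auto simp: poly_mapping_eq_iff fun_eq_iff in_keys_iff)

lemma le_lm: "m \<in> Poly_Mapping.keys p \<Longrightarrow> m \<le> lm p"
  unfolding lm_def by (intro Max_ge) auto

text \<open>The leading monomials are the only pair of monomials of \<open>p\<close> and
  \<open>q\<close> with sum \<open>lm p + lm q\<close>, so nothing can cancel there.\<close>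

lemma lookup_mult_lm:
  fixes p q :: "('k::field) mpoly"
  shows "Poly_Mapping.lookup (p * q) (lm p + lm q) = Poly_Mapping.lookup p (lm p) * Poly_Mapping.lookup q (lm q)"
proof -
  let ?l = "Poly_Mapping.lookup"
  have "p * q = (\<Sum>m\<in>Poly_Mapping.keys p. \<Sum>m'\<in>Poly_Mapping.keys q. Poly_Mapping.single (m + m') (?l p m * ?l q m'))"
    by (subst mpoly_sum_singles[of p, symmetric], subst mpoly_sum_singles[of q, symmetric])
      (simp only: sum_product mult_single)
  then have "?l (p * q) (lm p + lm q) = (\<Sum>m\<in>Poly_Mapping.keys p. \<Sum>m'\<in>Poly_Mapping.keys q.
      ?l (Poly_Mapping.single (m + m') (?l p m * ?l q m')) (lm p + lm q))"
    by (simp only: lookup_sum)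
  also have "\<dots> = (\<Sum>m\<in>Poly_Mapping.keys p. \<Sum>m'\<in>Poly_Mapping.keys q.
      if m' = lm q then if m = lm p then ?l p (lm p) * ?l q (lm q) else 0 else 0)"
  proof (intro sum.cong refl)
    fix m m' assume m: "m \<in> Poly_Mapping.keys p" "m' \<in> Poly_Mapping.keys q"
    have "m + m' = lm p + lm q \<longleftrightarrow> m = lm p \<and> m' = lm q"
    proof
      assume eq: "m + m' = lm p + lm q"
      have "m = lm p"
      proof (rule ccontr)
        assume "m \<noteq> lm p"
        then have "m < lm p" using le_lm[OF m(1)] by simp
        then have "m + m' < lm p + lm q" using le_lm[OF m(2)] by (rule add_less_le_mono)
        then show False using eq by simp
      qed
      then show "m = lm p \<and> m' = lm q" using eq by simp
    qed simp
    then show "?l (Poly_Mapping.single (m + m') (?l p m * ?l q m')) (lm p + lm q) =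
        (if m' = lm q then if m = lm p then ?l p (lm p) * ?l q (lm q) else 0 else 0)"
      by (auto simp: lookup_single when_def)
  qed
  also have "\<dots> = ?l p (lm p) * ?l q (lm q)"
    by (cases "?l p (lm p) = 0"; cases "?l q (lm q) = 0") (simp_all add: in_keys_iff)
  finally show ?thesis .
qed

lemma keys_mult_le_lm:
  assumes "m \<in> Poly_Mapping.keys (p * q)" shows "m \<le> lm p + lm q"
proof -
  obtain u v where "m = u + v" "u \<in> Poly_Mapping.keys p" "v \<in> Poly_Mapping.keys q"
    using keys_mult[of p q] assms by blast
  then show ?thesis using le_lm by (auto intro: add_mono)
qed

lemma lm_mult: "p \<noteq> 0 \<Longrightarrow> q \<noteq> 0 \<Longrightarrow> lm (p * q) = lm p + lm q"
proof -
  assume "p \<noteq> 0" "q \<noteq> 0"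
  then have "lm p + lm q \<in> Poly_Mapping.keys (p * q)"
    using lm_in_keys[of p] lm_in_keys[of q] by (simp add: lookup_mult_lm in_keys_iff)
  then show ?thesis
    unfolding lm_def[of "p * q"] by (intro Max_eqI) (auto intro: keys_mult_le_lm)
qed

lemma lookup_lm_power: "p \<noteq> 0 \<Longrightarrow> Poly_Mapping.lookup (lm (p ^ i)) k = i * Poly_Mapping.lookup (lm p) k"
proof (induction i)
  case 0
  then show ?case by (simp add: lm_def)
next
  case (Suc i)
  then show ?case by (simp add: lm_mult lookup_add)
qed

text \<open>
  The last hypothesis says that \<open>p/q\<close> is almost integral, so the leading monomial of \<open>q\<close> divides that
  of \<open>p\<close>; subtracting an element of the ring from \<open>p/q\<close> preserves this.
\<close>

lemma almost_integral_dvd: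
  fixes p q c :: "('k::field) mpoly"
  assumes q: "q \<in> carrier (mpoly_ring n)" "q \<noteq> 0" and c: "c \<in> carrier (mpoly_ring n)" "c \<noteq> 0"
    and p: "p \<in> carrier (mpoly_ring n)"
    and s: "\<And>i. \<exists>s\<in>carrier (mpoly_ring n). c * p ^ i = s * q ^ i"
  shows "\<exists>r\<in>carrier (mpoly_ring n). p = q * r"
  using p s
proof (induction p rule: wf_induct_rule[OF wf_inv_image[of "measures (map (\<lambda>i m. Poly_Mapping.lookup m i) [0..<Suc n])" lm, OF wf_measures]])
  case (1 p)
  note p = 1(2) and s = 1(3)
  show ?case
  proof (cases "p = 0")
    case True then show ?thesis by (intro bexI[of _ 0]) (auto intro: mpoly_ring_closed)
  next
    case False
    let ?l = "Poly_Mapping.lookup"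
    have le: "?l (lm q) k \<le> ?l (lm p) k" for k
    proof -
      \<comment> \<open>The relation gives \<open>i * lm q <= lm c + i * lm p\<close> in coordinate
        \<open>k\<close>; once \<open>i\<close> exceeds the exponent in \<open>lm c\<close>, even a
        deficit of 1 in \<open>lm p\<close> is impossible.\<close>
      define i where "i = Suc (?l (lm c) k)"
      obtain s' where s': "c * p ^ i = s' * q ^ i" using s by blast
      have nz: "p ^ i \<noteq> 0" "q ^ i \<noteq> 0" "s' \<noteq> 0" using False q(2) s' c(2) by auto
      have "lm c + lm (p ^ i) = lm s' + lm (q ^ i)"
        using arg_cong[OF s', of lm] lm_mult[OF c(2) nz(1)] lm_mult[OF nz(3,2)] by simp
      from arg_cong[OF this, of "\<lambda>m. ?l m k"]
      have "?l (lm c) k + i * ?l (lm p) k = ?l (lm s') k + i * ?l (lm q) k"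
        using False q(2) by (simp add: lookup_add lookup_lm_power)
      then have "i * ?l (lm q) k < i * Suc (?l (lm p) k)" by (simp add: i_def)
      then have "?l (lm q) k < Suc (?l (lm p) k)" unfolding mult_less_cancel1 by blast
      then show ?thesis by simp
    qed
    define m where "m = lm p - lm q"
    have m: "lm p = m + lm q"
      by (rule poly_mapping_eqI) (simp add: m_def lookup_add lookup_minus le)
    have kp: "Poly_Mapping.keys (lm p) \<subseteq> {..n}" using p lm_in_keys[OF False] by (auto simp: mem_mpoly_ring)
    have "Poly_Mapping.keys m \<subseteq> {..n}" using kp by (auto simp: m_def in_keys_iff lookup_minus subset_iff)
    \<comment> \<open>One step of polynomial division: \<open>t\<close> is the quotient of the
      leading terms, so \<open>p - t * q\<close> loses the leading monomial of
      \<open>p\<close>.\<close>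
    define t where "t = Poly_Mapping.single m (?l p (lm p) / ?l q (lm q))"
    have t: "t \<in> carrier (mpoly_ring n)" unfolding t_def by (rule mpoly_ring_single) fact
    have lq: "?l q (lm q) \<noteq> 0" using lm_in_keys[OF q(2)] by (simp add: in_keys_iff)
    have lp: "?l p (lm p) \<noteq> 0" using lm_in_keys[OF False] by (simp add: in_keys_iff)
    have lmt: "lm t = m" using lq lp by (simp add: t_def lm_def)
    define p' where "p' = p - t * q"
    have p': "p' \<in> carrier (mpoly_ring n)" unfolding p'_def using p t q by (intro mpoly_ring_closed)
    have lookup_p': "?l p' (lm p) = 0"
      using lookup_mult_lm[of t q] lq by (simp add: p'_def lookup_minus lmt flip: m) (simp add: t_def)
    \<comment> \<open>In the binomial expansion of \<open>c * (p - t * q) ^ i\<close> each term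
      contains \<open>c * p ^ j\<close>, divisible by \<open>q ^ j\<close>, and a factor
      \<open>q ^ (i - j)\<close>.\<close>
    have s': "\<exists>s\<in>carrier (mpoly_ring n). c * p' ^ i = s * q ^ i" for i
    proof -
      obtain s0 where s0: "\<And>j. s0 j \<in> carrier (mpoly_ring n)" "\<And>j. c * p ^ j = s0 j * q ^ j"
        using s by metis
      define S where "S = (\<Sum>j\<le>i. of_nat (i choose j) * (s0 j * (- t) ^ (i - j)))"
      have nat: "(of_nat j :: 'k mpoly) \<in> carrier (mpoly_ring n)" for j
        by (induction j) (auto intro: mpoly_ring_closed)
      have "S \<in> carrier (mpoly_ring n)"
        unfolding S_def by (intro mpoly_ring_closed nat s0 t)
      moreover have "c * p' ^ i = S * q ^ i"
      proof -
        have "p' ^ i = (\<Sum>j\<le>i. of_nat (i choose j) * p ^ j * (- (t * q)) ^ (i - j))"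
          unfolding p'_def diff_conv_add_uminus by (rule binomial_ring)
        then have "c * p' ^ i = (\<Sum>j\<le>i. of_nat (i choose j) * (c * p ^ j) * ((- t) ^ (i - j) * q ^ (i - j)))"
          by (simp add: sum_distrib_left ac_simps flip: power_mult_distrib)
        also have "\<dots> = (\<Sum>j\<le>i. of_nat (i choose j) * (s0 j * (- t) ^ (i - j)) * q ^ i)"
        proof (intro sum.cong refl)
          fix j assume "j \<in> {..i}"
          then have "q ^ i = q ^ j * q ^ (i - j)" by (simp flip: power_add)
          then show "of_nat (i choose j) * (c * p ^ j) * ((- t) ^ (i - j) * q ^ (i - j)) =
              of_nat (i choose j) * (s0 j * (- t) ^ (i - j)) * q ^ i"
            unfolding s0(2) by (simp add: ac_simps)
        qed
        finally show ?thesis unfolding S_def sum_distrib_right .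
      qed
      ultimately show ?thesis by blast
    qed
    have "\<exists>r\<in>carrier (mpoly_ring n). p' = q * r"
    proof (cases "p' = 0")
      case True then show ?thesis by (intro bexI[of _ 0]) (auto intro: mpoly_ring_closed)
    next
      case nz: False
      have "lm p' \<in> Poly_Mapping.keys p \<or> lm p' \<in> Poly_Mapping.keys (t * q)"
        using lm_in_keys[OF nz] by (auto simp: p'_def in_keys_iff lookup_minus)
      then have "lm p' \<le> lm p"
        using le_lm[of "lm p'" p] keys_mult_le_lm[of "lm p'" t q] by (auto simp: lmt m)
      moreover have "lm p' \<noteq> lm p" using lookup_p' lm_in_keys[OF nz] by (auto simp: in_keys_iff)
      ultimately have "lm p' < lm p" by simp
      then obtain k where k: "?l (lm p') k < ?l (lm p) k" "\<And>k'. k' < k \<Longrightarrow> ?l (lm p') k' = ?l (lm p) k'"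
        by (auto simp: less_poly_mapping.rep_eq less_fun_def)
      \<comment> \<open>The first difference of the leading monomials occurs at one of the
        \<open>n + 1\<close> variables, so the finite list of measures detects it.\<close>
      have "k \<in> Poly_Mapping.keys (lm p)" using k(1) by (auto simp: in_keys_iff)
      then have "k \<le> n" using kp by auto
      then have "(lm p', lm p) \<in> measures (map (\<lambda>i m. ?l m i) [0..<Suc n])"
        using k by (intro lex_less_in_measures[of k]) (auto simp: nth_append simp del: upt_Suc)
      then show ?thesis using 1(1)[of p'] p' s' by simp
    qed
    then obtain r where "r \<in> carrier (mpoly_ring n)" "p' = q * r" by blast
    then show ?thesis
      using t by (intro bexI[of _ "r + t"]) (auto simp: p'_def algebra_simps intro: mpoly_ring_closed)
  qed
qed

text \<open>A monic equation of degree \<open>m\<close> makes \<open>q ^ m\<close> a common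
  denominator for all powers of \<open>p/q\<close>, which is almost integrality.\<close>

lemma mpoly_integrally_closed:
  fixes p q :: "('k::field) mpoly"
  assumes p: "p \<in> carrier (mpoly_ring n)" and q: "q \<in> carrier (mpoly_ring n)" "q \<noteq> 0"
    and c: "\<And>i. i < m \<Longrightarrow> c i \<in> carrier (mpoly_ring n)"
    and eq: "p ^ m + (\<Sum>i<m. c i * p ^ i * q ^ (m - i)) = 0"
  shows "\<exists>r\<in>carrier (mpoly_ring n). p = q * r"
proof (rule almost_integral_dvd[OF q _ _ p])
  show "q ^ m \<in> carrier (mpoly_ring n)" "q ^ m \<noteq> 0" using q by (auto intro: mpoly_ring_closed)
  fix i show "\<exists>s\<in>carrier (mpoly_ring n). q ^ m * p ^ i = s * q ^ i"
  proof (induction i rule: less_induct)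
    case (less i)
    show ?case
    proof (cases "i \<le> m")
      case True
      then have "q ^ m = q ^ (m - i) * q ^ i" by (simp flip: power_add)
      then show ?thesis
        using p q by (intro bexI[of _ "q ^ (m - i) * p ^ i"]) (auto simp: ac_simps intro: mpoly_ring_closed)
    next
      case False
      define s where "s j = (SOME s. s \<in> carrier (mpoly_ring n) \<and> q ^ m * p ^ j = s * q ^ j)" for j
      have s: "s j \<in> carrier (mpoly_ring n) \<and> q ^ m * p ^ j = s j * q ^ j" if "j < i" for j
      proof -
        have "\<exists>s. s \<in> carrier (mpoly_ring n) \<and> q ^ m * p ^ j = s * q ^ j"
          using less.IH[OF that] by blast
        then show ?thesis unfolding s_def by (rule someI_ex)
      qed
      \<comment> \<open>Solving the equation for \<open>p ^ m\<close> rewrites a power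
        \<open>i > m\<close> in terms of the exponents \<open>i - m + j\<close>, which are smaller
        than \<open>i\<close>.\<close>
      have pm: "p ^ m = - (\<Sum>j<m. c j * p ^ j * q ^ (m - j))" using eq by (simp add: eq_neg_iff_add_eq_0)
      have "q ^ m * p ^ i = p ^ m * (q ^ m * p ^ (i - m))"
        using False by (simp add: ac_simps flip: power_add)
      also have "\<dots> = - (\<Sum>j<m. c j * q ^ (m - j) * (q ^ m * p ^ (i - m + j)))"
        unfolding pm by (simp add: sum_distrib_right sum_distrib_left power_add ac_simps)
      also have "(\<Sum>j<m. c j * q ^ (m - j) * (q ^ m * p ^ (i - m + j))) = (\<Sum>j<m. c j * s (i - m + j) * q ^ i)"
      proof (intro sum.cong refl)
        fix j assume j: "j \<in> {..<m}"
        then have qi: "q ^ i = q ^ (m - j) * q ^ (i - m + j)" using False by (simp flip: power_add)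
        have "i - m + j < i" using j False by auto
        then have qp: "q ^ m * p ^ (i - m + j) = s (i - m + j) * q ^ (i - m + j)" using s by blast
        show "c j * q ^ (m - j) * (q ^ m * p ^ (i - m + j)) = c j * s (i - m + j) * q ^ i"
          unfolding qp qi by (simp only: ac_simps)
      qed
      finally have "q ^ m * p ^ i = (- (\<Sum>j<m. c j * s (i - m + j))) * q ^ i"
        by (simp add: sum_distrib_right)
      moreover have "- (\<Sum>j<m. c j * s (i - m + j)) \<in> carrier (mpoly_ring n)"
      proof (intro mpoly_ring_closed)
        fix j assume j: "j \<in> {..<m}"
        show "c j \<in> carrier (mpoly_ring n)" using c j by simp
        show "s (i - m + j) \<in> carrier (mpoly_ring n)" using s[of "i - m + j"] j False by auto
      qed
      ultimately show ?thesis by blast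
    qed
  qed
qed

lemma finsum_mpoly_ring:
  assumes "finite I" "\<And>i. i \<in> I \<Longrightarrow> f i \<in> carrier (mpoly_ring n :: ('k::field) mpoly ring)"
  shows "finsum (mpoly_ring n) f I = sum f I"
proof -
  interpret cring "mpoly_ring n :: 'k mpoly ring" by (rule cring_mpoly_ring)
  show ?thesis using assms by (induction I) (auto simp: Pi_iff)
qed

lemma nat_pow_mpoly_ring: "p [^]\<^bsub>mpoly_ring n\<^esub> (k :: nat) = (p :: ('k::field) mpoly) ^ k"
proof -
  interpret cring "mpoly_ring n :: 'k mpoly ring" by (rule cring_mpoly_ring)
  show ?thesis by (induction k) (auto simp: mult.commute)
qed

section \<open>The Veronese embedding\<close>

lemma graded_part_prod:
  "(\<And>i. i \<in> I \<Longrightarrow> f i \<in> graded_part n a (d i)) \<Longrightarrow> prod f I \<in> graded_part n a (sum d I)"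
  by (induction I rule: infinite_finite_induct) (auto intro: graded_part_mult graded_part_one)

(* The weight function \<lambda>_. 1 of the target space must not be rewritten to \<lambda>_. Suc 0. *)
declare One_nat_def [simp del]

text \<open>\<open>\<mu>\<close> numbers the monomials of degree \<open>d\<close>. The substantial
  assumption is \<open>split\<close>, which amounts to generation of the Veronese ring in degree
  one; \<open>dvd\<close> puts a power of each variable among the monomials, so that there are no
  base points.\<close>

locale veronese =
  fixes n :: nat and a :: "nat \<Rightarrow> nat" and d N :: nat and \<mu> :: "nat \<Rightarrow> nat \<Rightarrow>\<^sub>0 nat"
  assumes pos: "\<And>i. i \<le> n \<Longrightarrow> a i > 0" and n: "n \<ge> 1" and d: "d > 0"
    and dvd: "\<And>i. i \<le> n \<Longrightarrow> a i dvd d"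
    and \<mu>: "bij_betw \<mu> {..N} {m. Poly_Mapping.keys m \<subseteq> {..n} \<and> wdeg a m = d}"
    and split: "\<And>m e. Poly_Mapping.keys m \<subseteq> {..n} \<Longrightarrow> wdeg a m = Suc e * d \<Longrightarrow>
      \<exists>m1 m2. m = m1 + m2 \<and> Poly_Mapping.keys m1 \<subseteq> {..n} \<and> Poly_Mapping.keys m2 \<subseteq> {..n} \<and>
        wdeg a m1 = e * d \<and> wdeg a m2 = d"
begin

abbreviation one_weights :: "nat \<Rightarrow> nat" where "one_weights \<equiv> (\<lambda>_. 1)"

text \<open>The homomorphism from k[y_0,...,y_N] to k[x_0,...,x_n] that sends \<open>y_i\<close> to
  the monomial \<open>\<mu> i\<close>. It multiplies degrees by \<open>d\<close>; the morphism of
  the linear system and its coordinate ring are read off from it.\<close>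

definition \<phi> :: "('k::field) mpoly \<Rightarrow> 'k mpoly" where
  "\<phi> = mpoly_eval (Poly_Mapping.single 0) (\<lambda>i. Poly_Mapping.single (\<mu> i) 1)"

definition sec :: "nat \<Rightarrow> ('k::field) sect" where
  "sec = (\<lambda>i. \<lambda>P\<in>Proj n a. Fract (Poly_Mapping.single (\<mu> i) 1) 1)"

lemma \<mu>_mem: "i \<le> N \<Longrightarrow> Poly_Mapping.keys (\<mu> i) \<subseteq> {..n}" "i \<le> N \<Longrightarrow> wdeg a (\<mu> i) = d"
  using bij_betwE[OF \<mu>] by auto

lemma \<mu>_surj: "Poly_Mapping.keys m \<subseteq> {..n} \<Longrightarrow> wdeg a m = d \<Longrightarrow> \<exists>i\<le>N. m = \<mu> i"
proof -
  assume "Poly_Mapping.keys m \<subseteq> {..n}" "wdeg a m = d"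
  then have "m \<in> \<mu> ` {..N}" using bij_betw_imp_surj_on[OF \<mu>] by simp
  then show ?thesis by auto
qed

lemma a0: "a 0 > 0"
  by (rule pos) simp

lemmas eval_const_simps =
  ring_hom_into.mpoly_eval_zero[OF ring_hom_into_const]
  ring_hom_into.mpoly_eval_one[OF ring_hom_into_const]
  ring_hom_into.mpoly_eval_add[OF ring_hom_into_const]
  ring_hom_into.mpoly_eval_mult[OF ring_hom_into_const]
  ring_hom_into.mpoly_eval_sum[OF ring_hom_into_const]
  ring_hom_into.mpoly_eval_single[OF ring_hom_into_const]

lemma \<phi>_zero [simp]: "\<phi> 0 = 0"
  and \<phi>_one [simp]: "\<phi> 1 = 1"
  and \<phi>_add: "\<phi> (F + G) = \<phi> F + \<phi> G"
  and \<phi>_sum: "\<phi> (sum f I) = (\<Sum>i\<in>I. \<phi> (f i))"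
  and \<phi>_mult: "\<phi> (F * G) = \<phi> F * \<phi> G"
  by (simp_all add: \<phi>_def eval_const_simps)

lemma \<phi>_diff: "\<phi> (F - G) = \<phi> F - \<phi> G"
  using \<phi>_add[of "F - G" G] by simp

lemma \<phi>_power: "\<phi> (F ^ k) = \<phi> F ^ k"
  by (induction k) (auto simp: \<phi>_mult)

lemma \<phi>_mvar: "\<phi> (mvar i) = Poly_Mapping.single (\<mu> i) 1"
  by (simp add: \<phi>_def mvar_def eval_const_simps)

lemma \<phi>_const: "\<phi> (Poly_Mapping.single 0 c) = Poly_Mapping.single 0 c"
  by (simp add: \<phi>_def eval_const_simps)

lemma \<phi>_graded:
  fixes F :: "('k::field) mpoly"
  assumes F: "F \<in> graded_part N one_weights e"
  shows "\<phi> F \<in> graded_part n a (e * d)"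
proof -
  have "\<phi> (Poly_Mapping.single m c) \<in> graded_part n a (e * d)" if m: "m \<in> Poly_Mapping.keys F" for m and c :: 'k
  proof -
    have m: "Poly_Mapping.keys m \<subseteq> {..N}" "(\<Sum>i\<in>Poly_Mapping.keys m. Poly_Mapping.lookup m i) = e"
      using F m by (auto simp: graded_part_def mem_mpoly_ring wdeg_def)
    have 1: "(\<Prod>i\<in>Poly_Mapping.keys m. Poly_Mapping.single (\<mu> i) (1 :: 'k) ^ Poly_Mapping.lookup m i)
        \<in> graded_part n a (\<Sum>i\<in>Poly_Mapping.keys m. Poly_Mapping.lookup m i * d)"
      by (intro graded_part_prod graded_part_power graded_part_single \<mu>_mem) (use m in auto)
    have 2: "Poly_Mapping.single 0 c \<in> graded_part n a 0" for c :: 'k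
      by (rule graded_part_single) auto
    have "\<phi> (Poly_Mapping.single m c) \<in> graded_part n a (0 + (\<Sum>i\<in>Poly_Mapping.keys m. Poly_Mapping.lookup m i * d))"
      unfolding \<phi>_def eval_const_simps by (rule graded_part_mult[OF 2 1])
    then show ?thesis using m(2) by (simp add: sum_distrib_right[symmetric])
  qed
  then have "(\<Sum>m\<in>Poly_Mapping.keys F. \<phi> (Poly_Mapping.single m (Poly_Mapping.lookup F m))) \<in> graded_part n a (e * d)"
    by (rule graded_part_sum)
  then show ?thesis by (simp only: \<phi>_sum[symmetric] mpoly_sum_singles)
qed

lemma \<phi>_carrier: "F \<in> carrier (mpoly_ring N) \<Longrightarrow> \<phi> F \<in> carrier (mpoly_ring n)"
proof (induction F rule: mpoly_induct[where a = one_weights])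
  case (add e f p)
  then show ?case using graded_part_carrier[OF \<phi>_graded[OF add(1)]] by (simp add: \<phi>_add mpoly_ring_add)
qed (simp add: mpoly_ring_closed)

lemma hcomp_\<phi>:
  assumes "F \<in> carrier (mpoly_ring N)"
  shows "hcomp a (e * d) (\<phi> F) = \<phi> (hcomp one_weights e F)"
  using assms
proof (induction F rule: mpoly_induct[where a = one_weights])
  case (add i f p)
  then show ?case
    using hcomp_graded_part[OF \<phi>_graded[OF add(1)], of "e * d"] hcomp_graded_part[OF add(1), of e] d
    by (simp add: \<phi>_add hcomp_add)
qed simp

lemma hcomp_\<phi>_eq_0:
  assumes "F \<in> carrier (mpoly_ring N)" "\<not> d dvd k"
  shows "hcomp a k (\<phi> F) = 0"
  using assms(1)
proof (induction F rule: mpoly_induct[where a = one_weights])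
  case (add i f p)
  have "k \<noteq> i * d" using assms(2) by auto
  then show ?case
    using hcomp_graded_part[OF \<phi>_graded[OF add(1)], of k] add(3) by (simp add: \<phi>_add hcomp_add)
qed simp

text \<open>Each application of \<open>split\<close> removes a factor of degree \<open>d\<close>,
  which is the image of a variable.\<close>

lemma \<phi>_surj_monomial:
  "Poly_Mapping.keys m \<subseteq> {..n} \<Longrightarrow> wdeg a m = e * d \<Longrightarrow>
   \<exists>F\<in>graded_part N one_weights e. \<phi> F = Poly_Mapping.single m (1 :: 'k::field)"
proof (induction e arbitrary: m)
  case 0
  have "m = 0"
  proof (rule poly_mapping_eqI)
    fix i
    have "\<forall>i\<le>n. a i = 0 \<or> Poly_Mapping.lookup m i = 0"
      using 0 by (simp add: wdeg_eq_sum)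
    then show "Poly_Mapping.lookup m i = Poly_Mapping.lookup 0 i"
      using 0(1) pos[of i] by (cases "i \<le> n") (auto simp: subset_iff in_keys_iff)
  qed
  then show ?case by (intro bexI[of _ 1]) (auto simp: graded_part_one)
next
  case (Suc e)
  obtain m1 m2 where m: "m = m1 + m2" "Poly_Mapping.keys m1 \<subseteq> {..n}" "Poly_Mapping.keys m2 \<subseteq> {..n}"
    "wdeg a m1 = e * d" "wdeg a m2 = d" using split[OF Suc.prems] by blast
  obtain F where F: "F \<in> graded_part N one_weights e" "\<phi> F = Poly_Mapping.single m1 (1 :: 'k)"
    using Suc.IH[OF m(2,4)] by blast
  obtain i where i: "i \<le> N" "m2 = \<mu> i" using \<mu>_surj[OF m(3,5)] by blast
  have "F * mvar i \<in> graded_part N one_weights (e + 1)"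
    by (intro graded_part_mult F mvar_in_graded_part i)
  moreover have "\<phi> (F * mvar i) = Poly_Mapping.single m 1"
    by (simp add: \<phi>_mult F \<phi>_mvar mult_single m(1) i(2))
  ultimately show ?case unfolding Suc_eq_plus1 by blast
qed

lemma \<phi>_surj:
  fixes f :: "('k::field) mpoly"
  assumes f: "f \<in> graded_part n a (e * d)"
  obtains F where "F \<in> graded_part N one_weights e" "\<phi> F = f"
proof -
  have "\<exists>F\<in>graded_part N one_weights e. \<phi> F = Poly_Mapping.single m (1 :: 'k)" if "m \<in> Poly_Mapping.keys f" for m
  proof -
    have "Poly_Mapping.keys m \<subseteq> {..n}" "wdeg a m = e * d"
      using f that by (auto simp: graded_part_def mem_mpoly_ring)
    then show ?thesis by (rule \<phi>_surj_monomial)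
  qed
  then obtain F where F: "\<And>m. m \<in> Poly_Mapping.keys f \<Longrightarrow> F m \<in> graded_part N one_weights e"
    "\<And>m. m \<in> Poly_Mapping.keys f \<Longrightarrow> \<phi> (F m) = Poly_Mapping.single m (1 :: 'k)" by metis
  define G where "G = (\<Sum>m\<in>Poly_Mapping.keys f. Poly_Mapping.single 0 (Poly_Mapping.lookup f m) * F m)"
  have "Poly_Mapping.single 0 c * F m \<in> graded_part N one_weights (0 + e)" if "m \<in> Poly_Mapping.keys f" for c m
    by (intro graded_part_mult F that graded_part_single) auto
  then have "G \<in> graded_part N one_weights e"
    unfolding G_def by (intro graded_part_sum) simp
  moreover have "\<phi> G = (\<Sum>m\<in>Poly_Mapping.keys f. Poly_Mapping.single m (Poly_Mapping.lookup f m))"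
    unfolding G_def \<phi>_sum by (intro sum.cong refl) (simp add: \<phi>_mult \<phi>_const F mult_single)
  ultimately show thesis using that by (simp add: mpoly_sum_singles)
qed

text \<open>A nonzero form whose degree is not a multiple of \<open>d\<close> is not in the image of
  \<open>\<phi>\<close>, but its \<open>d\<close>-th power is and belongs to the same
  primes.\<close>

lemma \<phi>_surj_power:
  assumes "h \<in> graded_part n a e"
  obtains F where "F \<in> graded_part N one_weights e" "\<phi> F = h ^ d"
  using \<phi>_surj[of "h ^ d" e] graded_part_power[OF assms, of d] by (auto simp: mult.commute)

lemma eval_sec:
  assumes "P \<in> Proj n a"
  shows "mpoly_eval scalar (\<lambda>i. sec i P) F = Fract (\<phi> F) 1"
  unfolding sec_def \<phi>_def mpoly_eval_scalar_Fract[symmetric] using assms by simp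

section \<open>The morphism on points: contraction of primes along \<open>\<phi>\<close>\<close>

definition \<psi> :: "('k::field) mpoly set \<Rightarrow> 'k mpoly set" where
  "\<psi> P = {F \<in> carrier (mpoly_ring N). \<phi> F \<in> P}"

text \<open>The sections tested by \<open>linsys_map\<close> are the components of
  \<open>\<phi> F\<close> in degrees divisible by \<open>d\<close>. The other components vanish, and
  a homogeneous prime contains a polynomial iff it contains its components.\<close>

lemma linsys_map_eq:
  assumes P: "P \<in> Proj n a"
  shows "linsys_map n a d N sec P = \<psi> P"
proof -
  have "(\<forall>e. vanishes_at n a (e * d) P (Fract (\<phi> (hcomp one_weights e F)) 1)) \<longleftrightarrow> \<phi> F \<in> P"
    if F: "F \<in> carrier (mpoly_ring N)" for F
  proof -
    have "(\<forall>e. vanishes_at n a (e * d) P (Fract (\<phi> (hcomp one_weights e F)) 1)) \<longleftrightarrow>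
        (\<forall>e. \<phi> (hcomp one_weights e F) \<in> P)"
      by (simp add: vanishes_at_Fract[OF P \<phi>_graded[OF hcomp_in_graded_part[OF F]]])
    also have "\<dots> \<longleftrightarrow> (\<forall>k. hcomp a k (\<phi> F) \<in> P)"
    proof
      assume *: "\<forall>e. \<phi> (hcomp one_weights e F) \<in> P"
      show "\<forall>k. hcomp a k (\<phi> F) \<in> P"
      proof
        fix k show "hcomp a k (\<phi> F) \<in> P"
        proof (cases "d dvd k")
          case True
          then obtain e where "k = e * d" by (metis dvd_div_mult_self)
          then show ?thesis using * hcomp_\<phi>[OF F] by simp
        next
          case False
          then show ?thesis using hcomp_\<phi>_eq_0[OF F] Proj_zero[OF P] by simp
        qed
      qed
    qed (use hcomp_\<phi>[OF F] in metis)
    also have "\<dots> \<longleftrightarrow> \<phi> F \<in> P"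
      using Proj_hcompI[OF P \<phi>_carrier[OF F]] Proj_hcomp[OF P] by blast
    finally show ?thesis .
  qed
  then show ?thesis unfolding linsys_map_def \<psi>_def eval_sec[OF P] by blast
qed

text \<open>A variable outside \<open>P\<close> has a power of degree exactly \<open>d\<close>, and
  this power is one of the \<open>\<mu> i\<close>.\<close>

lemma \<mu>_not_in_Proj:
  assumes P: "P \<in> Proj n a"
  obtains i where "i \<le> N" "Poly_Mapping.single (\<mu> i) 1 \<notin> P"
proof -
  obtain j where j: "j \<le> n" "mvar j \<notin> P" using Proj_mvar[OF P] .
  have "wdeg a (Poly_Mapping.single j (d div a j)) = d"
    using dvd[OF j(1)] by simp
  moreover have "Poly_Mapping.keys (Poly_Mapping.single j (d div a j)) \<subseteq> {..n}"
    using j(1) by simp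
  ultimately obtain i where i: "i \<le> N" "Poly_Mapping.single j (d div a j) = \<mu> i"
    using \<mu>_surj by blast
  have "d div a j > 0" using dvd[OF j(1)] d by (auto elim: dvdE)
  then have "mvar j ^ (d div a j) \<notin> P"
    using Proj_power_iff[OF P graded_part_carrier[OF mvar_in_graded_part[OF j(1)]]] j(2) by blast
  then show thesis using that i by (simp add: mvar_power)
qed

lemma \<psi>_Proj:
  assumes P: "P \<in> Proj n a"
  shows "\<psi> P \<in> Proj N one_weights"
proof -
  obtain i where i: "i \<le> N" "Poly_Mapping.single (\<mu> i) 1 \<notin> P" using \<mu>_not_in_Proj[OF P] .
  have hom: "hcomp one_weights e F \<in> \<psi> P" if "F \<in> \<psi> P" for F e
    using that hcomp_carrier Proj_hcomp[OF P] hcomp_\<phi> unfolding \<psi>_def by (metis (mono_tags, lifting) mem_Collect_eq)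
  show ?thesis
  proof (rule ProjI[of _ _ _ i])
    show "primeideal (\<psi> P) (mpoly_ring N)"
    proof (rule primeideal_homogeneous[where a = one_weights])
      fix F G e e' assume F: "F \<in> graded_part N one_weights e" and G: "G \<in> graded_part N one_weights e'"
        and FG: "F * G \<in> \<psi> P"
      note c = graded_part_carrier[OF F] graded_part_carrier[OF G]
      have "\<phi> F * \<phi> G \<in> P" using FG by (simp add: \<psi>_def \<phi>_mult)
      then have "\<phi> F \<in> P \<or> \<phi> G \<in> P" using Proj_mult_iff[OF P \<phi>_carrier[OF c(1)] \<phi>_carrier[OF c(2)]] by simp
      then show "F \<in> \<psi> P \<or> G \<in> \<psi> P" using c by (auto simp: \<psi>_def)
    qed (use hom in \<open>auto simp: \<psi>_def \<phi>_add \<phi>_mult Proj_zero[OF P] Proj_one[OF P] Proj_add[OF P] Proj_mult[OF P] \<phi>_carrier intro: mpoly_ring_closed\<close>)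
  qed (use i hom in \<open>auto simp: \<psi>_def \<phi>_mvar\<close>)
qed

lemma graded_in_\<psi>_iff: "F \<in> graded_part N one_weights e \<Longrightarrow> F \<in> \<psi> P \<longleftrightarrow> \<phi> F \<in> P"
  by (simp add: \<psi>_def graded_part_carrier)

text \<open>A homogeneous prime is determined by the \<open>d\<close>-th powers of forms that it
  contains, and these all come from forms on the target.\<close>

lemma \<psi>_inj:
  assumes P: "P \<in> Proj n a" and Q: "Q \<in> Proj n a" and eq: "\<psi> P = \<psi> Q"
  shows "P = Q"
proof -
  have "P \<subseteq> Q" if P: "P \<in> Proj n a" and Q: "Q \<in> Proj n a" and eq: "\<psi> P = \<psi> Q" for P Q :: "'a mpoly set"
  proof
    fix p assume p: "p \<in> P"
    have pc: "p \<in> carrier (mpoly_ring n)" using Proj_carrier[OF P p] .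
    show "p \<in> Q"
    proof (rule Proj_hcompI[OF Q pc])
      fix e
      have h: "hcomp a e p \<in> graded_part n a e" using pc by (rule hcomp_in_graded_part)
      obtain F where F: "F \<in> graded_part N one_weights e" "\<phi> F = hcomp a e p ^ d"
        using \<phi>_surj_power[OF h] .
      have "hcomp a e p ^ d \<in> P"
        using Proj_hcomp[OF P p] Proj_power_iff[OF P graded_part_carrier[OF h] d] by blast
      then have "hcomp a e p ^ d \<in> Q" using graded_in_\<psi>_iff[OF F(1)] F(2) eq by metis
      then show "hcomp a e p \<in> Q" using Proj_power_iff[OF Q graded_part_carrier[OF h] d] by blast
    qed
  qed
  then show ?thesis using assms by blast
qed

text \<open>The forms that define \<open>U\<close> are replaced by lifts of their
  \<open>d\<close>-th powers, which have the same zeros.\<close>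

lemma open_lift:
  assumes "openin (zariski n a) U"
  obtains W where "openin (zariski N one_weights) W" "\<And>P. P \<in> Proj n a \<Longrightarrow> \<psi> P \<in> W \<longleftrightarrow> P \<in> U"
proof -
  obtain E where E: "E \<subseteq> (\<Union>k. graded_part n a k)" "U = {P \<in> Proj n a. \<not> E \<subseteq> P}"
    using assms by (auto simp: openin_zariski_iff)
  define G where "G = {F. \<exists>e. F \<in> graded_part N one_weights e \<and> (\<exists>h\<in>E. \<phi> F = h ^ d)}"
  have "\<psi> P \<in> {Q \<in> Proj N one_weights. \<not> G \<subseteq> Q} \<longleftrightarrow> P \<in> U" if P: "P \<in> Proj n a" for P
  proof -
    have pw: "h ^ d \<in> P \<longleftrightarrow> h \<in> P" if "h \<in> E" for h
      using that E(1) Proj_power_iff[OF P _ d] graded_part_carrier by blast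
    have "G \<subseteq> \<psi> P \<longleftrightarrow> E \<subseteq> P"
    proof
      assume GP: "G \<subseteq> \<psi> P"
      show "E \<subseteq> P"
      proof
        fix h assume h: "h \<in> E"
        then obtain e where "h \<in> graded_part n a e" using E(1) by blast
        then obtain F where "F \<in> graded_part N one_weights e" "\<phi> F = h ^ d" using \<phi>_surj_power by metis
        then have "h ^ d \<in> P" using GP h unfolding G_def \<psi>_def by force
        then show "h \<in> P" using pw[OF h] by simp
      qed
    next
      assume "E \<subseteq> P"
      show "G \<subseteq> \<psi> P"
      proof
        fix F assume "F \<in> G"
        then obtain e h where F: "F \<in> graded_part N one_weights e" "h \<in> E" "\<phi> F = h ^ d"
          unfolding G_def by blast
        then have "\<phi> F \<in> P" using \<open>E \<subseteq> P\<close> pw[OF F(2)] by auto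
        then show "F \<in> \<psi> P" using graded_in_\<psi>_iff[OF F(1)] by blast
      qed
    qed
    then show ?thesis using P \<psi>_Proj[OF P] by (simp add: E(2))
  qed
  moreover have "openin (zariski N one_weights) {Q \<in> Proj N one_weights. \<not> G \<subseteq> Q}"
    unfolding openin_zariski_iff by (intro exI[of _ G]) (auto simp: G_def)
  ultimately show thesis by (rule that[rotated])
qed

lemma open_preimage:
  assumes "openin (zariski N one_weights) W"
  shows "openin (zariski n a) {P \<in> Proj n a. \<psi> P \<in> W}"
proof -
  obtain E where E: "E \<subseteq> (\<Union>k. graded_part N one_weights k)" "W = {P \<in> Proj N one_weights. \<not> E \<subseteq> P}"
    using assms by (auto simp: openin_zariski_iff)
  have "\<psi> P \<in> W \<longleftrightarrow> \<not> \<phi> ` E \<subseteq> P" if "P \<in> Proj n a" for P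
  proof -
    have "F \<in> \<psi> P \<longleftrightarrow> \<phi> F \<in> P" if "F \<in> E" for F
      using that E(1) graded_in_\<psi>_iff by blast
    then show ?thesis using \<psi>_Proj[OF that] by (auto simp: E(2))
  qed
  then have "{P \<in> Proj n a. \<psi> P \<in> W} = {P \<in> Proj n a. \<not> \<phi> ` E \<subseteq> P}" by blast
  moreover have "\<phi> ` E \<subseteq> (\<Union>k. graded_part n a k)" using E(1) \<phi>_graded by blast
  ultimately show ?thesis unfolding openin_zariski_iff by blast
qed

text \<open>A prime over the kernel corresponds to a prime of the Veronese subring, which has to be
  extended to all of k[x]. The prime above it is written down explicitly.\<close>

lemma \<psi>_surj:
  fixes Q :: "('k::field) mpoly set"
  assumes Q: "Q \<in> Proj N one_weights"
    and ker: "\<And>e F. F \<in> graded_part N one_weights e \<Longrightarrow> \<phi> F = 0 \<Longrightarrow> F \<in> Q"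
  obtains P where "P \<in> Proj n a" "\<psi> P = Q"
proof -
  \<comment> \<open>Because \<open>Q\<close> contains the kernel, membership of a form in
    \<open>Q\<close> depends only on its image. Passing to the component of degree \<open>e\<close>
    makes the difference a form, as \<open>ker\<close> requires.\<close>
  have lift: "F \<in> Q" if F: "F \<in> graded_part N one_weights e" and im: "\<phi> F \<in> \<phi> ` Q" for F e
  proof -
    obtain G where G: "G \<in> Q" "\<phi> F = \<phi> G" using im by blast
    have "\<phi> F = hcomp a (e * d) (\<phi> F)" using hcomp_graded_part[OF \<phi>_graded[OF F]] by simp
    also have "\<dots> = \<phi> (hcomp one_weights e G)" using hcomp_\<phi>[OF Proj_carrier[OF Q G(1)]] G(2) by simp
    finally have "\<phi> (F - hcomp one_weights e G) = 0" by (simp add: \<phi>_diff)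
    moreover have "hcomp one_weights e G \<in> graded_part N one_weights e"
      using hcomp_in_graded_part Proj_carrier[OF Q G(1)] by blast
    then have "F + (Poly_Mapping.single 0 (-1)) * hcomp one_weights e G \<in> graded_part N one_weights (0 + e)"
      using F by (intro graded_part_add graded_part_mult graded_part_single) auto
    then have "F - hcomp one_weights e G \<in> graded_part N one_weights e" by (simp add: single_uminus)
    ultimately have "F - hcomp one_weights e G \<in> Q" using ker by blast
    from Proj_add[OF Q this Proj_hcomp[OF Q G(1), of e]] show ?thesis by simp
  qed
  have im0: "0 \<in> \<phi> ` Q" using Proj_zero[OF Q] by (metis \<phi>_zero image_eqI)
  have imadd: "x + y \<in> \<phi> ` Q" if "x \<in> \<phi> ` Q" "y \<in> \<phi> ` Q" for x y
    using that Proj_add[OF Q] by (auto simp: \<phi>_add[symmetric])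
  (* the largest ideal of k[x] whose contraction to the image of \<phi> lies in \<phi> ` Q *)
  define P where "P = {p \<in> carrier (mpoly_ring n). \<forall>k e. \<forall>g\<in>graded_part n a k. hcomp a (e * d) (p * g) \<in> \<phi> ` Q}"
  have Pc: "p \<in> carrier (mpoly_ring n)" if "p \<in> P" for p using that by (simp add: P_def)
  have PD: "hcomp a (e * d) (p * g) \<in> \<phi> ` Q" if "p \<in> P" "g \<in> graded_part n a k" for p g k e
    using that by (auto simp: P_def)
  have P0: "0 \<in> P" using im0 by (simp add: P_def mpoly_ring_closed)
  have Padd: "x + y \<in> P" if "x \<in> P" "y \<in> P" for x y
    using that imadd by (auto simp: P_def distrib_right hcomp_add intro!: mpoly_ring_closed)
  have Pmult: "x * y \<in> P" if x: "x \<in> P" and y: "y \<in> carrier (mpoly_ring n)" for x y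
  proof -
    have "hcomp a (e * d) (x * y * g) \<in> \<phi> ` Q" if g: "g \<in> graded_part n a k" for g k e
      using y
    proof (induction y rule: mpoly_induct[where a = a])
      case zero then show ?case using im0 by simp
    next
      case (add i f p)
      have "hcomp a (e * d) (x * (f * g)) \<in> \<phi> ` Q" using PD[OF x graded_part_mult[OF add(1) g]] .
      then show ?case using imadd add(3) by (simp add: distrib_left distrib_right hcomp_add mult.assoc)
    qed
    then show ?thesis using Pc[OF x] y by (auto simp: P_def intro: mpoly_ring_closed)
  qed
  have Phom: "hcomp a j x \<in> P" if x: "x \<in> P" for j x
  proof -
    have "hcomp a (e * d) (hcomp a j x * g) \<in> \<phi> ` Q" if g: "g \<in> graded_part n a k" for g k e
    proof (cases "k + j = e * d")
      case True
      have "hcomp a (e * d) (x * g) = hcomp a j x * g"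
        unfolding True[symmetric]
        using hcomp_mult_homogeneous[OF g Pc[OF x], of "k + j"] by (simp add: mult.commute)
      moreover have "hcomp a (e * d) (hcomp a j x * g) = hcomp a j x * g"
        using hcomp_graded_part[OF graded_part_mult[OF hcomp_in_graded_part[OF Pc[OF x], of a j] g], of "e * d"] True
        by (simp add: add.commute)
      ultimately show ?thesis using PD[OF x g, of e] by simp
    next
      case False
      then have "hcomp a (e * d) (hcomp a j x * g) = 0"
        using hcomp_graded_part[OF graded_part_mult[OF hcomp_in_graded_part[OF Pc[OF x], of a j] g], of "e * d"]
        by (simp add: add.commute split: if_split_asm)
      then show ?thesis using im0 by simp
    qed
    then show ?thesis using hcomp_carrier[OF Pc[OF x]] by (auto simp: P_def)
  qed
  have Pgraded: "F \<in> Q" if "F \<in> graded_part N one_weights e" "\<phi> F \<in> P" for F e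
  proof -
    have "hcomp a (e * d) (\<phi> F * 1) \<in> \<phi> ` Q" using PD[OF that(2) graded_part_one] .
    then show ?thesis using hcomp_graded_part[OF \<phi>_graded[OF that(1)]] lift[OF that(1)] by simp
  qed
  \<comment> \<open>A form outside \<open>P\<close> has a multiple that is the image of a form
    outside \<open>Q\<close>; multiplying two such witnesses reduces primality of \<open>P\<close>
    to that of \<open>Q\<close>.\<close>
  have Pwitness: "\<exists>e u k F. u \<in> graded_part n a k \<and> F \<in> graded_part N one_weights e \<and> \<phi> F = f * u \<and> F \<notin> Q"
    if f: "f \<in> graded_part n a i" "f \<notin> P" for f i
  proof -
    obtain k e u where u: "u \<in> graded_part n a k" "hcomp a (e * d) (f * u) \<notin> \<phi> ` Q"
      using f graded_part_carrier[OF f(1)] by (auto simp: P_def)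
    have fu: "f * u \<in> graded_part n a (i + k)" using f(1) u(1) by (rule graded_part_mult)
    then have "i + k = e * d" "f * u \<notin> \<phi> ` Q"
      using u(2) hcomp_graded_part[OF fu, of "e * d"] im0 by (auto split: if_split_asm)
    then obtain F where "F \<in> graded_part N one_weights e" "\<phi> F = f * u"
      using \<phi>_surj[of "f * u" e] fu by metis
    then show ?thesis using u(1) \<open>f * u \<notin> \<phi> ` Q\<close> by (metis image_eqI)
  qed
  have "primeideal P (mpoly_ring n)"
  proof (rule primeideal_homogeneous[where a = a])
    show "1 \<notin> P" using Pgraded[OF graded_part_one] Proj_one[OF Q] by auto
    fix i j f g
    assume f: "f \<in> graded_part n a i" and g: "g \<in> graded_part n a j" and fg: "f * g \<in> P"
    show "f \<in> P \<or> g \<in> P"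
    proof (rule ccontr)
      assume "\<not> ?thesis"
      then obtain e u k F e' u' k' F' where
        1: "u \<in> graded_part n a k" "F \<in> graded_part N one_weights e" "\<phi> F = f * u" "F \<notin> Q" and
        2: "u' \<in> graded_part n a k'" "F' \<in> graded_part N one_weights e'" "\<phi> F' = g * u'" "F' \<notin> Q"
        using Pwitness f g by meson
      have "f * g * (u * u') \<in> P"
        by (rule Pmult[OF fg mpoly_ring_mult[OF graded_part_carrier[OF 1(1)] graded_part_carrier[OF 2(1)]]])
      then have "\<phi> (F * F') \<in> P" by (simp add: \<phi>_mult 1(3) 2(3) ac_simps)
      then have "F * F' \<in> Q" using Pgraded graded_part_mult[OF 1(2) 2(2)] by blast
      then show False using Proj_mult_iff[OF Q] 1 2 graded_part_carrier by blast
    qed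
  qed (use Pc P0 Padd Pmult Phom in auto)
  moreover have "\<not> irrelevant_ideal n a \<subseteq> P"
  proof -
    obtain i where i: "i \<le> N" "mvar i \<notin> Q" using Proj_mvar[OF Q] .
    then have "\<phi> (mvar i) \<notin> P" using Pgraded[OF mvar_in_graded_part] by blast
    moreover have "\<phi> (mvar i) \<in> irrelevant_ideal n a"
      unfolding \<phi>_mvar irrelevant_ideal_def using \<mu>_mem[OF i(1)] d by (auto intro: mpoly_ring_single)
    ultimately show ?thesis by blast
  qed
  ultimately have P: "P \<in> Proj n a" using Phom by (auto simp: Proj_def)
  have "\<psi> P = Q"
  proof
    show "\<psi> P \<subseteq> Q"
    proof
      fix F assume "F \<in> \<psi> P"
      then have F: "F \<in> carrier (mpoly_ring N)" "\<phi> F \<in> P" by (auto simp: \<psi>_def)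
      show "F \<in> Q"
      proof (rule Proj_hcompI[OF Q F(1)])
        fix e show "hcomp one_weights e F \<in> Q"
          using Pgraded[OF hcomp_in_graded_part[OF F(1)], of e] Phom[OF F(2), of "e * d"] hcomp_\<phi>[OF F(1)] by simp
      qed
    qed
    show "Q \<subseteq> \<psi> P"
    proof
      fix F assume F: "F \<in> Q"
      have Fc: "F \<in> carrier (mpoly_ring N)" using Proj_carrier[OF Q F] .
      \<comment> \<open>Since \<open>\<phi> F\<close> lives in degrees divisible by
        \<open>d\<close>, a form \<open>g\<close> contributes to degree \<open>e * d\<close> only if
        its own degree is divisible by \<open>d\<close>; then \<open>g\<close> is an image and the
        product comes from a multiple of a component of \<open>F\<close>.\<close>
      have "hcomp a (e * d) (\<phi> F * g) \<in> \<phi> ` Q" if g: "g \<in> graded_part n a k" for g k e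
      proof (cases "k \<le> e * d \<and> d dvd k")
        case True
        then obtain j where k: "k = j * d" by (metis dvd_div_mult_self)
        have "j \<le> e" using True k d by simp
        obtain G where G: "G \<in> graded_part N one_weights j" "\<phi> G = g" using \<phi>_surj g k by metis
        have "hcomp a (e * d) (\<phi> F * g) = g * hcomp a ((e - j) * d) (\<phi> F)"
          using hcomp_mult_homogeneous[OF g \<phi>_carrier[OF Fc], of "e * d"] True
          by (simp add: mult.commute[of "\<phi> F"] k diff_mult_distrib)
        also have "\<dots> = \<phi> (hcomp one_weights (e - j) F * G)"
          unfolding \<phi>_mult G(2) hcomp_\<phi>[OF Fc, symmetric] by (rule mult.commute)
        finally show ?thesis
          using Proj_mult[OF Q Proj_hcomp[OF Q F] graded_part_carrier[OF G(1)]] by blast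
      next
        case False
        have "hcomp a (e * d) (\<phi> F * g) = (if k \<le> e * d then g * hcomp a (e * d - k) (\<phi> F) else 0)"
          using hcomp_mult_homogeneous[OF g \<phi>_carrier[OF Fc], of "e * d"] by (simp add: mult.commute[of "\<phi> F"])
        also have "\<dots> = 0"
        proof (cases "k \<le> e * d")
          case True
          then have "\<not> d dvd e * d - k" using False by (metis dvd_diffD1 dvd_triv_right)
          then show ?thesis using hcomp_\<phi>_eq_0[OF Fc] by simp
        qed simp
        finally show ?thesis using im0 by simp
      qed
      then show "F \<in> \<psi> P" using Fc \<phi>_carrier[OF Fc] by (auto simp: \<psi>_def P_def)
    qed
  qed
  with P show thesis by (rule that)
qed

section \<open>Closed immersion: the embedding of spaces and the comorphism\<close>

lemma topspace_image: "\<psi> ` Proj n a \<subseteq> Proj N one_weights"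
  using \<psi>_Proj by blast

text \<open>The image is cut out by the forms in the kernel of \<open>\<phi>\<close>;
  \<open>\<psi>_surj\<close> shows that these equations suffice.\<close>

lemma closedin_image: "closedin (zariski N one_weights) (\<psi> ` (Proj n a :: ('k::field) mpoly set set))"
  unfolding closedin_def topspace_zariski
proof
  define K where "K = {F :: 'k mpoly. \<phi> F = 0 \<and> (\<exists>e. F \<in> graded_part N one_weights e)}"
  have "Q \<in> \<psi> ` (Proj n a :: 'k mpoly set set) \<longleftrightarrow> K \<subseteq> Q" if Q: "Q \<in> Proj N one_weights" for Q
  proof
    assume "Q \<in> \<psi> ` (Proj n a :: 'k mpoly set set)"
    then obtain P :: "'k mpoly set" where P: "P \<in> Proj n a" "Q = \<psi> P" by blast
    show "K \<subseteq> Q"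
      using Proj_zero[OF P(1)] graded_part_carrier by (auto simp: K_def P(2) \<psi>_def)
  next
    assume K: "K \<subseteq> Q"
    obtain P where "P \<in> Proj n a" "\<psi> P = Q"
      using \<psi>_surj[OF Q] K unfolding K_def by blast
    then show "Q \<in> \<psi> ` (Proj n a :: 'k mpoly set set)" by blast
  qed
  then have "Proj N one_weights - \<psi> ` (Proj n a :: 'k mpoly set set) = {Q \<in> Proj N one_weights. \<not> K \<subseteq> Q}"
    by blast
  then show "openin (zariski N one_weights) (Proj N one_weights - \<psi> ` (Proj n a :: 'k mpoly set set))"
    unfolding openin_zariski_iff by (intro exI[of _ K] conjI) (auto simp: K_def)
qed (rule topspace_image)

lemma embedding_\<psi>: "embedding_map (zariski n a) (zariski N one_weights) \<psi>"
  unfolding embedding_map_def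
proof (rule bijective_open_imp_homeomorphic_map)
  have "continuous_map (zariski n a) (zariski N one_weights) \<psi>"
    unfolding continuous_map topspace_zariski using topspace_image open_preimage by blast
  then show "continuous_map (zariski n a) (subtopology (zariski N one_weights) (\<psi> ` topspace (zariski n a))) \<psi>"
    by (rule continuous_map_into_subtopology) auto
  show "open_map (zariski n a) (subtopology (zariski N one_weights) (\<psi> ` topspace (zariski n a))) \<psi>"
    unfolding open_map_def openin_subtopology topspace_zariski
  proof (intro allI impI)
    fix U assume U: "openin (zariski n a) U"
    obtain W where W: "openin (zariski N one_weights) W" "\<And>P. P \<in> Proj n a \<Longrightarrow> \<psi> P \<in> W \<longleftrightarrow> P \<in> U"
      using open_lift[OF U] by blast
    have "U \<subseteq> Proj n a" using openin_subset[OF U] by (simp add: topspace_zariski)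
    then have "\<psi> ` U = W \<inter> \<psi> ` Proj n a" using W(2) by blast
    then show "\<exists>T. openin (zariski N one_weights) T \<and> \<psi> ` U = T \<inter> \<psi> ` Proj n a" using W(1) by blast
  qed
  show "\<psi> ` topspace (zariski n a) =
      topspace (subtopology (zariski N one_weights) (\<psi> ` topspace (zariski n a)))"
    by (simp add: topspace_zariski Int_absorb1 topspace_image)
  show "inj_on \<psi> (topspace (zariski n a))"
    unfolding topspace_zariski by (rule inj_onI) (rule \<psi>_inj)
qed

text \<open>The description by \<open>THE\<close> is legitimate: if \<open>F / G = F' / G'\<close>,
  then applying \<open>\<phi>\<close> to \<open>F * G' = F' * G\<close> shows that the values agree,
  and the denominators stay nonzero because \<open>G\<close> and \<open>G'\<close> avoid the
  point.\<close>

lemma comorphism_eq: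
  assumes P: "P \<in> Proj n a" "\<psi> P \<in> V"
    and F: "F \<in> graded_part N one_weights e" and G: "G \<in> graded_part N one_weights e"
    and GP: "G \<notin> \<psi> P" and u: "u (\<psi> P) = Fract F G"
  shows "linsys_comorphism n a d N sec V u P = Fract (\<phi> F) (\<phi> G)"
proof -
  have nz: "\<phi> G' \<noteq> 0 \<and> G' \<noteq> 0" if "G' \<in> graded_part N one_weights e'" "G' \<notin> \<psi> P" for G' e'
  proof -
    have "\<phi> G' \<noteq> 0" using that graded_in_\<psi>_iff[OF that(1)] Proj_zero[OF P(1)] by metis
    then show ?thesis by auto
  qed
  have "linsys_comorphism n a d N sec V u P =
      (THE z. \<exists>e. \<exists>F\<in>graded_part N one_weights e. \<exists>G\<in>graded_part N one_weights e.
          G \<notin> \<psi> P \<and> u (\<psi> P) = Fract F G \<and> z = Fract (\<phi> F) 1 / Fract (\<phi> G) 1)"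
    unfolding linsys_comorphism_def using P by (simp add: linsys_map_eq eval_sec)
  also have "\<dots> = Fract (\<phi> F) (\<phi> G)"
  proof (rule the_equality)
    show "\<exists>e. \<exists>F'\<in>graded_part N one_weights e. \<exists>G'\<in>graded_part N one_weights e.
        G' \<notin> \<psi> P \<and> u (\<psi> P) = Fract F' G' \<and> Fract (\<phi> F) (\<phi> G) = Fract (\<phi> F') 1 / Fract (\<phi> G') 1"
      by (intro exI[of _ e] bexI[of _ F] bexI[of _ G] conjI GP u F G) simp
    fix z assume "\<exists>e. \<exists>F\<in>graded_part N one_weights e. \<exists>G\<in>graded_part N one_weights e.
          G \<notin> \<psi> P \<and> u (\<psi> P) = Fract F G \<and> z = Fract (\<phi> F) 1 / Fract (\<phi> G) 1"
    then obtain e' F' G' where 1: "F' \<in> graded_part N one_weights e'" "G' \<in> graded_part N one_weights e'"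
      "G' \<notin> \<psi> P" "u (\<psi> P) = Fract F' G'" "z = Fract (\<phi> F') 1 / Fract (\<phi> G') 1" by blast
    have nz': "G \<noteq> 0" "G' \<noteq> 0" "\<phi> G \<noteq> 0" "\<phi> G' \<noteq> 0" using nz[OF G GP] nz[OF 1(2,3)] by auto
    have "Fract F G = Fract F' G'" using 1(4) u by simp
    then have "F * G' = F' * G" using nz' by (simp add: Fraction_Field.eq_fract)
    then have "\<phi> F * \<phi> G' = \<phi> F' * \<phi> G" by (simp flip: \<phi>_mult)
    then have "Fract (\<phi> F') (\<phi> G') = Fract (\<phi> F) (\<phi> G)" using nz' by (simp add: Fraction_Field.eq_fract)
    then show "z = Fract (\<phi> F) (\<phi> G)" by (simp add: 1(5))
  qed
  finally show ?thesis .
qed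

lemma linsys_preimage:
  "{P \<in> Proj n a. linsys_map n a d N sec P \<in> V} = {P \<in> Proj n a. \<psi> P \<in> V}"
  by (auto simp: linsys_map_eq)

lemma comorphism_extensional:
  "linsys_comorphism n a d N sec V u \<in> extensional {P \<in> Proj n a. \<psi> P \<in> V}"
  unfolding linsys_comorphism_def linsys_preimage by simp

lemma comorphism_in_sheaf:
  assumes V: "openin (zariski N one_weights) V" and u: "u \<in> twist_sheaf N one_weights 0 V"
  shows "linsys_comorphism n a d N sec V u \<in> twist_sheaf n a 0 {P \<in> Proj n a. \<psi> P \<in> V}"
  unfolding twist_sheaf_iff
proof (intro conjI ballI comorphism_extensional)
  fix P assume P: "P \<in> {P \<in> Proj n a. \<psi> P \<in> V}"
  then obtain W e F G where W: "openin (zariski N one_weights) W" "\<psi> P \<in> W" "W \<subseteq> V"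
    "F \<in> graded_part N one_weights (e + 0)" "G \<in> graded_part N one_weights e"
    "\<forall>Q\<in>W. G \<notin> Q \<and> u Q = Fract F G"
    using twist_sheafD[OF u, of "\<psi> P"] by blast
  have F: "F \<in> graded_part N one_weights e" using W(4) by simp
  define U where "U = {P \<in> Proj n a. \<psi> P \<in> W}"
  have "\<phi> G \<notin> Q \<and> linsys_comorphism n a d N sec V u Q = Fract (\<phi> F) (\<phi> G)" if Q: "Q \<in> U" for Q
  proof
    have QW: "Q \<in> Proj n a" "\<psi> Q \<in> W" "\<psi> Q \<in> V" using Q W(3) by (auto simp: U_def)
    then have G: "G \<notin> \<psi> Q" "u (\<psi> Q) = Fract F G" using W(6) by auto
    then show "\<phi> G \<notin> Q" using graded_in_\<psi>_iff[OF W(5)] by blast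
    show "linsys_comorphism n a d N sec V u Q = Fract (\<phi> F) (\<phi> G)"
      using comorphism_eq[of Q V F e G u] QW F W(5) G by blast
  qed
  moreover have "openin (zariski n a) U" unfolding U_def using W(1) by (rule open_preimage)
  moreover have "P \<in> U" "U \<subseteq> {P \<in> Proj n a. \<psi> P \<in> V}" using P W(2,3) by (auto simp: U_def)
  moreover have "\<phi> F \<in> graded_part n a (e * d + 0)" "\<phi> G \<in> graded_part n a (e * d)"
    using \<phi>_graded[OF F] \<phi>_graded[OF W(5)] by auto
  ultimately show "\<exists>U e f g. openin (zariski n a) U \<and> P \<in> U \<and> U \<subseteq> {P \<in> Proj n a. \<psi> P \<in> V} \<and>
      f \<in> graded_part n a (e + 0) \<and> g \<in> graded_part n a e \<and>
      (\<forall>Q\<in>U. g \<notin> Q \<and> linsys_comorphism n a d N sec V u Q = Fract f g)"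
    by blast
qed

lemma const_section:
  assumes W: "openin (zariski N one_weights) W"
    and F: "F \<in> graded_part N one_weights e" and G: "G \<in> graded_part N one_weights e"
    and GW: "\<And>Q. Q \<in> W \<Longrightarrow> G \<notin> Q"
  shows "(\<lambda>Q\<in>W. Fract F G) \<in> twist_sheaf N one_weights 0 W"
  unfolding twist_sheaf_iff
proof (intro conjI ballI)
  fix Q assume "Q \<in> W"
  then show "\<exists>V e f g. openin (zariski N one_weights) V \<and> Q \<in> V \<and> V \<subseteq> W \<and>
        f \<in> graded_part N one_weights (e + 0) \<and> g \<in> graded_part N one_weights e \<and>
        (\<forall>Q\<in>V. g \<notin> Q \<and> (\<lambda>Q\<in>W. Fract F G) Q = Fract f g)"
    by (rule_tac exI[of _ W], rule_tac exI[of _ e], rule_tac exI[of _ F], rule_tac exI[of _ G])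
      (use assms in auto)
qed simp

text \<open>Near a point of the image, \<open>h / g\<close> equals
  \<open>h * g ^ (d - 1) / g ^ d\<close>, where numerator and denominator have degree
  \<open>e * d\<close> and lift to forms. Near any other point, removing the closed image leaves an
  open set with empty preimage.\<close>

lemma comorphism_locally_surj:
  fixes t :: "('k::field) sect"
  assumes V: "openin (zariski N one_weights) V" and t: "t \<in> twist_sheaf n a 0 {P \<in> Proj n a. \<psi> P \<in> V}"
    and y: "y \<in> V"
  shows "\<exists>W u. openin (zariski N one_weights) W \<and> y \<in> W \<and> W \<subseteq> V \<and> u \<in> twist_sheaf N one_weights 0 W \<and>
    linsys_comorphism n a d N sec W u = restrict t {P \<in> Proj n a. \<psi> P \<in> W}"
proof (cases "y \<in> \<psi> ` (Proj n a :: 'k mpoly set set)")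
  case False
  define W where "W = V - \<psi> ` (Proj n a :: 'k mpoly set set)"
  have W: "openin (zariski N one_weights) W"
    unfolding W_def using V closedin_image by (rule openin_diff)
  have "openin (zariski N one_weights) V \<Longrightarrow> W \<subseteq> Proj N one_weights" using openin_subset[OF W] topspace_zariski by blast
  then have "1 \<notin> Q" if "Q \<in> W" for Q using that V Proj_one by blast
  then have u: "(\<lambda>Q\<in>W. Fract 0 1) \<in> twist_sheaf N one_weights 0 W"
    using const_section[OF W graded_part_zero graded_part_one] by blast
  have "{P \<in> Proj n a. \<psi> P \<in> W} = {}" by (auto simp: W_def)
  then have "linsys_comorphism n a d N sec W (\<lambda>Q\<in>W. Fract 0 1) = restrict t {P \<in> Proj n a. \<psi> P \<in> W}"
    using comorphism_extensional[of W "\<lambda>Q\<in>W. Fract 0 1"] by (auto simp: extensional_def fun_eq_iff)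
  then show ?thesis using W u y False by (intro exI[of _ W] exI[of _ "\<lambda>Q\<in>W. Fract 0 1"]) (auto simp: W_def)
next
  case True
  then obtain P where P: "P \<in> Proj n a" "y = \<psi> P" by blast
  then have PV: "P \<in> {P \<in> Proj n a. \<psi> P \<in> V}" using y by simp
  obtain U e h g where U: "openin (zariski n a) U" "P \<in> U" "U \<subseteq> {P \<in> Proj n a. \<psi> P \<in> V}"
    "h \<in> graded_part n a (e + 0)" "g \<in> graded_part n a e" "\<forall>Q\<in>U. g \<notin> Q \<and> t Q = Fract h g"
    using twist_sheafD[OF t PV] by blast
  have gnz: "g \<noteq> 0" using U(2,6) Proj_zero[OF P(1)] by auto
  have hg: "h * g ^ (d - 1) \<in> graded_part n a (e * d)"
    using graded_part_mult[OF U(4) graded_part_power[OF U(5), of "d - 1"]] d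
    by (cases d) (simp_all add: mult.commute)
  obtain H where H: "H \<in> graded_part N one_weights e" "\<phi> H = h * g ^ (d - 1)" using \<phi>_surj[OF hg] .
  obtain G where G: "G \<in> graded_part N one_weights e" "\<phi> G = g ^ d" using \<phi>_surj_power[OF U(5)] .
  have quot: "Fract (\<phi> H) (\<phi> G) = Fract h g"
    using gnz d by (cases d) (simp_all add: H G Fraction_Field.eq_fract)
  \<comment> \<open>Intersecting with \<open>W0\<close> keeps the preimage inside \<open>U\<close>,
    where \<open>t\<close> is \<open>h / g\<close>; discarding the zeros of \<open>G\<close> makes
    \<open>H / G\<close> a section.\<close>
  obtain W0 where W0: "openin (zariski N one_weights) W0" "\<And>P. P \<in> Proj n a \<Longrightarrow> \<psi> P \<in> W0 \<longleftrightarrow> P \<in> U"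
    using open_lift[OF U(1)] by blast
  have "openin (zariski N one_weights) {Q \<in> Proj N one_weights. \<not> {G} \<subseteq> Q}"
    unfolding openin_zariski_iff using G(1) by blast
  then have W: "openin (zariski N one_weights) (W0 \<inter> V \<inter> {Q \<in> Proj N one_weights. \<not> {G} \<subseteq> Q})" (is "openin _ ?W")
    using W0(1) V by (intro openin_Int)
  have G_notin: "G \<notin> \<psi> Q" if "Q \<in> U" "Q \<in> Proj n a" for Q
    using graded_in_\<psi>_iff[OF G(1), of Q] U(6) that Proj_power_iff[OF that(2) graded_part_carrier[OF U(5)] d] G(2) by simp
  have yW: "y \<in> ?W" using P y U(2) W0(2) G_notin \<psi>_Proj by auto
  define u where "u = (\<lambda>Q\<in>?W. Fract H G)"
  have u: "u \<in> twist_sheaf N one_weights 0 ?W"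
    unfolding u_def by (rule const_section[OF W H(1) G(1)]) auto
  have "linsys_comorphism n a d N sec ?W u Q = restrict t {P \<in> Proj n a. \<psi> P \<in> ?W} Q" for Q
  proof (cases "Q \<in> {P \<in> Proj n a. \<psi> P \<in> ?W}")
    case True
    then have Q: "Q \<in> Proj n a" "\<psi> Q \<in> ?W" by auto
    then have "linsys_comorphism n a d N sec ?W u Q = Fract (\<phi> H) (\<phi> G)"
      by (intro comorphism_eq[OF Q H(1) G(1)]) (auto simp: u_def)
    also have "\<dots> = t Q" using U(6) Q W0(2)[OF Q(1)] quot by auto
    finally show ?thesis using True by simp
  next
    case False
    then show ?thesis using comorphism_extensional[of ?W u] by (auto simp: extensional_def)
  qed
  then show ?thesis using W yW u by (intro exI[of _ ?W] exI[of _ u]) auto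
qed

lemma is_section_basis_sec: "is_section_basis n a d N (sec :: nat \<Rightarrow> ('k::field) sect)"
  unfolding sec_def by (rule is_section_basis_monomials[OF pos n \<mu>])

theorem very_ample: "very_ample TYPE('k::field) n a d"
  unfolding very_ample_def
proof (intro exI conjI)
  show "is_section_basis n a d N (sec :: nat \<Rightarrow> 'k sect)" by (rule is_section_basis_sec)
  show "base_point_free n a d N (sec :: nat \<Rightarrow> 'k sect)"
    unfolding base_point_free_def
  proof
    fix P :: "'k mpoly set" assume P: "P \<in> Proj n a"
    obtain i where i: "i \<le> N" "Poly_Mapping.single (\<mu> i) 1 \<notin> P" using \<mu>_not_in_Proj[OF P] .
    moreover have "Poly_Mapping.single (\<mu> i) (1 :: 'k) \<in> graded_part n a d"
      using \<mu>_mem[OF i(1)] by (intro graded_part_single)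
    ultimately show "\<exists>i\<le>N. \<not> vanishes_at n a d P (sec i P)"
      using P vanishes_at_Fract[OF P] by (intro exI[of _ i]) (simp add: sec_def)
  qed
  show "closed_immersion (zariski n a) (twist_sheaf n a 0) (zariski N one_weights) (twist_sheaf N one_weights 0)
      (linsys_map n a d N (sec :: nat \<Rightarrow> 'k sect)) (linsys_comorphism n a d N sec)"
    unfolding closed_immersion_def Let_def topspace_zariski linsys_preimage
  proof (intro conjI allI impI)
    show "embedding_map (zariski n a) (zariski N one_weights) (linsys_map n a d N (sec :: nat \<Rightarrow> 'k sect))"
      by (rule embedding_map_eq[OF embedding_\<psi>]) (simp add: topspace_zariski linsys_map_eq)
    have "linsys_map n a d N sec ` Proj n a = \<psi> ` (Proj n a :: 'k mpoly set set)"
      by (intro image_cong refl linsys_map_eq)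
    then show "closedin (zariski N one_weights) (linsys_map n a d N (sec :: nat \<Rightarrow> 'k sect) ` Proj n a)"
      using closedin_image by simp
  next
    fix V :: "'k mpoly set set" assume "openin (zariski N one_weights) V"
    then show "linsys_comorphism n a d N sec V ` twist_sheaf N one_weights 0 V
        \<subseteq> twist_sheaf n a 0 {P \<in> Proj n a. \<psi> P \<in> V}"
      using comorphism_in_sheaf by blast
  next
    fix V :: "'k mpoly set set" and t y
    assume "openin (zariski N one_weights) V \<and> t \<in> twist_sheaf n a 0 {P \<in> Proj n a. \<psi> P \<in> V} \<and> y \<in> V"
    then show "\<exists>W u. openin (zariski N one_weights) W \<and> y \<in> W \<and> W \<subseteq> V \<and> u \<in> twist_sheaf N one_weights 0 W \<and>
        linsys_comorphism n a d N sec W u = restrict t {P \<in> Proj n a. \<psi> P \<in> W}"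
      using comorphism_locally_surj by blast
  qed
qed

section \<open>The homogeneous coordinate ring of the embedding\<close>

lemma image_ideal_eq: "image_ideal n a d N sec = {F :: ('k::field) mpoly. F \<in> carrier (mpoly_ring N) \<and> \<phi> F = 0}"
proof -
  have g: "{0 :: 'k mpoly} \<in> Proj n a" using a0 by (rule generic_point)
  have "(\<forall>P\<in>Proj n a. F \<in> linsys_map n a d N sec P) \<longleftrightarrow> \<phi> F = 0" if F: "F \<in> carrier (mpoly_ring N)" for F :: "'k mpoly"
  proof
    assume "\<forall>P\<in>Proj n a. F \<in> linsys_map n a d N sec P"
    then have "F \<in> \<psi> {0}" using g linsys_map_eq[OF g] by blast
    then show "\<phi> F = 0" by (simp add: \<psi>_def)
  next
    assume "\<phi> F = 0"
    then show "\<forall>P\<in>Proj n a. F \<in> linsys_map n a d N sec P"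
      using F Proj_zero by (auto simp: linsys_map_eq \<psi>_def)
  qed
  then show ?thesis unfolding image_ideal_def by blast
qed

lemma quotient_in_image:
  assumes F: "F \<in> carrier (mpoly_ring N)" and G: "G \<in> carrier (mpoly_ring N)"
    and r: "r \<in> carrier (mpoly_ring n)" and eq: "\<phi> F = \<phi> G * r"
  obtains H where "H \<in> carrier (mpoly_ring N)" "\<phi> F = \<phi> G * \<phi> H"
proof -
  define K where "K = {k \<in> wdeg a ` Poly_Mapping.keys r. d dvd k}"
  have fin: "finite K" by (simp add: K_def)
  define r' where "r' = (\<Sum>k\<in>K. hcomp a k r)"
  have r': "r' \<in> carrier (mpoly_ring n)" unfolding r'_def by (intro mpoly_ring_sum hcomp_carrier r)
  have hr': "hcomp a k r' = (if d dvd k then hcomp a k r else 0)" for k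
  proof -
    have "hcomp a k r' = (\<Sum>j\<in>K. if k = j then hcomp a k r else 0)"
      unfolding r'_def hcomp_sum using hcomp_graded_part[OF hcomp_in_graded_part[OF r]]
      by (intro sum.cong refl) auto
    also have "\<dots> = (if k \<in> K then hcomp a k r else 0)" using fin by simp
    also have "\<dots> = (if d dvd k then hcomp a k r else 0)"
    proof (cases "k \<in> wdeg a ` Poly_Mapping.keys r")
      case False
      then have "hcomp a k r = 0"
        by (intro poly_mapping_eqI) (auto simp: lookup_hcomp in_keys_iff)
      then show ?thesis by simp
    qed (simp add: K_def)
    finally show ?thesis .
  qed
  have "hcomp a k (\<phi> F) = hcomp a k (\<phi> G * r')" for k
  proof (cases "d dvd k")
    case True
    have "hcomp a i (\<phi> G) * hcomp a (k - i) r = hcomp a i (\<phi> G) * hcomp a (k - i) r'" if "i \<le> k" for i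
      using True that hcomp_\<phi>_eq_0[OF G, of i] by (cases "d dvd i") (auto simp: hr' dvd_diff_nat)
    then show ?thesis unfolding eq hcomp_mult[OF \<phi>_carrier[OF G] r] hcomp_mult[OF \<phi>_carrier[OF G] r']
      by (intro sum.cong) auto
  next
    case False
    have "hcomp a i (\<phi> G) * hcomp a (k - i) r' = 0" if "i \<le> k" for i
    proof (cases "d dvd i")
      case True
      then have "\<not> d dvd k - i" using False that by (metis dvd_diffD)
      then show ?thesis by (simp add: hr')
    qed (simp add: hcomp_\<phi>_eq_0[OF G])
    then have "(\<Sum>i\<le>k. hcomp a i (\<phi> G) * hcomp a (k - i) r') = 0"
      by (intro sum.neutral) auto
    then show ?thesis
      unfolding hcomp_\<phi>_eq_0[OF F False] hcomp_mult[OF \<phi>_carrier[OF G] r'] by simp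
  qed
  note comp = this
  have "\<phi> F = \<phi> G * r'"
  proof (rule poly_mapping_eqI)
    fix m
    show "Poly_Mapping.lookup (\<phi> F) m = Poly_Mapping.lookup (\<phi> G * r') m"
      using arg_cong[OF comp[of "wdeg a m"], of "\<lambda>p. Poly_Mapping.lookup p m"] by (simp add: lookup_hcomp)
  qed
  moreover have "\<exists>H\<in>carrier (mpoly_ring N). \<phi> H = hcomp a k r" if "k \<in> K" for k
  proof -
    have "d dvd k" using \<open>k \<in> K\<close> by (simp add: K_def)
    then obtain e where "k = e * d" by (metis dvd_div_mult_self)
    then obtain H where "H \<in> graded_part N one_weights e" "\<phi> H = hcomp a k r"
      using \<phi>_surj hcomp_in_graded_part[OF r] by metis
    then show ?thesis using graded_part_carrier by blast
  qed
  then obtain H where H: "\<And>k. k \<in> K \<Longrightarrow> H k \<in> carrier (mpoly_ring N)" "\<And>k. k \<in> K \<Longrightarrow> \<phi> (H k) = hcomp a k r"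
    by metis
  moreover have "\<phi> (\<Sum>k\<in>K. H k) = r'" unfolding \<phi>_sum r'_def using H by (intro sum.cong) auto
  ultimately show thesis using that[of "\<Sum>k\<in>K. H k"] by (simp add: mpoly_ring_sum)
qed

text \<open>The coordinate ring is k[y] modulo the kernel of \<open>\<phi>\<close>, that is, the
  Veronese ring. A monic equation over it is solved in k[x], and \<open>quotient_in_image\<close>
  brings the solution back.\<close>

theorem projectively_normal: "projectively_normal TYPE('k::field) n a d"
  unfolding projectively_normal_def
proof (intro exI conjI)
  show "is_section_basis n a d N (sec :: nat \<Rightarrow> 'k sect)"
    by (rule is_section_basis_sec)
  define R where "R = (mpoly_ring N :: 'k mpoly ring)"
  define I where "I = image_ideal n a d N (sec :: nat \<Rightarrow> 'k sect)"
  have I: "F \<in> I \<longleftrightarrow> F \<in> carrier R \<and> \<phi> F = 0" for F by (simp add: I_def image_ideal_eq R_def)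
  \<comment> \<open>The ideal of the image is the contraction of the generic point, hence
    prime.\<close>
  have "I = \<psi> {0}" by (auto simp: I \<psi>_def R_def)
  then have prime: "primeideal I R"
    using Proj_primeideal[OF \<psi>_Proj[OF generic_point[of a n, OF a0]]] by (simp add: R_def)
  interpret I: primeideal I R by (rule prime)
  let ?Q = "R Quot I"
  interpret Q: domain ?Q by (rule I.quotient_is_domain)
  interpret h: ring_hom_cring R ?Q "(+>\<^bsub>R\<^esub>) I" by (rule I.rcos_ring_hom_cring)
  have coset: "\<exists>F\<in>carrier R. X = I +>\<^bsub>R\<^esub> F" if "X \<in> carrier ?Q" for X
    using that by (auto simp: FactRing_def A_RCOSETS_defs a_r_coset_def)
  have zero_eq: "\<zero>\<^bsub>?Q\<^esub> = I" by (simp only: FactRing_def ring.select_convs)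
  have zero: "I +>\<^bsub>R\<^esub> F = \<zero>\<^bsub>?Q\<^esub> \<longleftrightarrow> \<phi> F = 0" if "F \<in> carrier R" for F
  proof
    assume "I +>\<^bsub>R\<^esub> F = \<zero>\<^bsub>?Q\<^esub>"
    then have "F \<in> I" using I.a_rcos_self[OF that] unfolding zero_eq by metis
    then show "\<phi> F = 0" by (simp add: I)
  next
    assume "\<phi> F = 0"
    then have "F \<in> I" using that by (simp add: I)
    then show "I +>\<^bsub>R\<^esub> F = \<zero>\<^bsub>?Q\<^esub>" unfolding zero_eq by (rule I.a_rcos_const)
  qed
  show "integrally_closed_domain (mpoly_ring N Quot image_ideal n a d N (sec :: nat \<Rightarrow> 'k sect))"
    unfolding integrally_closed_domain_def R_def[symmetric] I_def[symmetric]
  proof (intro conjI ballI impI)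
    show "domain ?Q" by (rule Q.domain_axioms)
    fix p q
    assume p: "p \<in> carrier ?Q" and q: "q \<in> carrier ?Q - {\<zero>\<^bsub>?Q\<^esub>}"
      and "\<exists>(m::nat) c. c \<in> {..<m} \<rightarrow> carrier ?Q \<and>
           p [^]\<^bsub>?Q\<^esub> m \<oplus>\<^bsub>?Q\<^esub>
             (\<Oplus>\<^bsub>?Q\<^esub>i\<in>{..<m}. c i \<otimes>\<^bsub>?Q\<^esub> p [^]\<^bsub>?Q\<^esub> i \<otimes>\<^bsub>?Q\<^esub> q [^]\<^bsub>?Q\<^esub> (m - i)) = \<zero>\<^bsub>?Q\<^esub>"
    then obtain m :: nat and c where c: "c \<in> {..<m} \<rightarrow> carrier ?Q" and
      eq: "p [^]\<^bsub>?Q\<^esub> m \<oplus>\<^bsub>?Q\<^esub>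
             (\<Oplus>\<^bsub>?Q\<^esub>i\<in>{..<m}. c i \<otimes>\<^bsub>?Q\<^esub> p [^]\<^bsub>?Q\<^esub> i \<otimes>\<^bsub>?Q\<^esub> q [^]\<^bsub>?Q\<^esub> (m - i)) = \<zero>\<^bsub>?Q\<^esub>" by blast
    obtain F where F: "F \<in> carrier R" "p = I +>\<^bsub>R\<^esub> F" using coset p by blast
    obtain G where G: "G \<in> carrier R" "q = I +>\<^bsub>R\<^esub> G" using coset q by blast
    have "\<forall>i\<in>{..<m}. \<exists>C\<in>carrier R. c i = I +>\<^bsub>R\<^esub> C" using coset c by blast
    then obtain C where C: "\<And>i. i \<in> {..<m} \<Longrightarrow> C i \<in> carrier R" "\<And>i. i \<in> {..<m} \<Longrightarrow> c i = I +>\<^bsub>R\<^esub> C i" by metis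
    define T where "T i = C i \<otimes>\<^bsub>R\<^esub> F [^]\<^bsub>R\<^esub> i \<otimes>\<^bsub>R\<^esub> G [^]\<^bsub>R\<^esub> (m - i)" for i
    have T: "T i \<in> carrier R" if "i \<in> {..<m}" for i using C(1)[OF that] F(1) G(1) by (simp add: T_def)
    have pow: "I +>\<^bsub>R\<^esub> (x [^]\<^bsub>R\<^esub> (k::nat)) = (I +>\<^bsub>R\<^esub> x) [^]\<^bsub>?Q\<^esub> k" if "x \<in> carrier R" for x k
      using that by (induction k) auto
    have "(\<Oplus>\<^bsub>?Q\<^esub>i\<in>{..<m}. c i \<otimes>\<^bsub>?Q\<^esub> p [^]\<^bsub>?Q\<^esub> i \<otimes>\<^bsub>?Q\<^esub> q [^]\<^bsub>?Q\<^esub> (m - i)) = (\<Oplus>\<^bsub>?Q\<^esub>i\<in>{..<m}. I +>\<^bsub>R\<^esub> T i)"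
      by (intro Q.finsum_cong') (use C F G T pow in \<open>auto simp: T_def\<close>)
    also have "\<dots> = I +>\<^bsub>R\<^esub> (\<Oplus>\<^bsub>R\<^esub>i\<in>{..<m}. T i)"
      using h.hom_finsum[of T "{..<m}"] T by (simp add: comp_def Pi_iff)
    finally have "I +>\<^bsub>R\<^esub> (F [^]\<^bsub>R\<^esub> m \<oplus>\<^bsub>R\<^esub> (\<Oplus>\<^bsub>R\<^esub>i\<in>{..<m}. T i)) = \<zero>\<^bsub>?Q\<^esub>"
      using eq F pow[OF F(1)] T by (simp add: Pi_iff)
    then have 0: "\<phi> (F [^]\<^bsub>R\<^esub> m \<oplus>\<^bsub>R\<^esub> (\<Oplus>\<^bsub>R\<^esub>i\<in>{..<m}. T i)) = 0"
      using F(1) T by (subst (asm) zero) (auto simp: Pi_iff)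
    have fs: "(\<Oplus>\<^bsub>R\<^esub>i\<in>{..<m}. T i) = (\<Sum>i<m. T i)"
      unfolding R_def by (rule finsum_mpoly_ring) (use T in \<open>auto simp: R_def\<close>)
    have "F [^]\<^bsub>R\<^esub> m \<oplus>\<^bsub>R\<^esub> (\<Oplus>\<^bsub>R\<^esub>i\<in>{..<m}. T i) = F ^ m + (\<Sum>i<m. C i * F ^ i * G ^ (m - i))"
      unfolding fs by (simp add: R_def T_def nat_pow_mpoly_ring)
    with 0 have "\<phi> F ^ m + (\<Sum>i<m. \<phi> (C i) * \<phi> F ^ i * \<phi> G ^ (m - i)) = 0"
      by (simp add: \<phi>_add \<phi>_sum \<phi>_mult \<phi>_power)
    moreover have "\<phi> G \<noteq> 0" using q G zero[OF G(1)] by auto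
    ultimately obtain r where r: "r \<in> carrier (mpoly_ring n)" "\<phi> F = \<phi> G * r"
      using mpoly_integrally_closed[of "\<phi> F" n "\<phi> G" m "\<lambda>i. \<phi> (C i)"] F(1) G(1) C(1) \<phi>_carrier
      by (auto simp: R_def)
    obtain H where H: "H \<in> carrier R" "\<phi> F = \<phi> G * \<phi> H"
      using quotient_in_image[OF F(1)[unfolded R_def] G(1)[unfolded R_def] r] unfolding R_def by blast
    \<comment> \<open>The class of \<open>D\<close> is zero, so \<open>p\<close> and
      \<open>q\<close> times the class of \<open>H\<close> agree in the quotient although
      \<open>F\<close> and \<open>G * H\<close> may differ.\<close>
    define D where "D = F - G * H"
    have D: "D \<in> carrier R" "\<phi> D = 0" "F = D \<oplus>\<^bsub>R\<^esub> G \<otimes>\<^bsub>R\<^esub> H"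
      using F(1) G(1) H by (simp_all add: D_def R_def \<phi>_diff \<phi>_mult mpoly_ring_closed)
    have GH: "G \<otimes>\<^bsub>R\<^esub> H \<in> carrier R" using G(1) H(1) by simp
    have "p = (I +>\<^bsub>R\<^esub> D) \<oplus>\<^bsub>?Q\<^esub> (I +>\<^bsub>R\<^esub> (G \<otimes>\<^bsub>R\<^esub> H))"
      unfolding F(2) by (subst D(3)) (rule h.hom_add[OF D(1) GH])
    also have "\<dots> = q \<otimes>\<^bsub>?Q\<^esub> (I +>\<^bsub>R\<^esub> H)"
      using G H(1) D zero[of D] GH by (simp add: Q.l_zero)
    finally have "p = q \<otimes>\<^bsub>?Q\<^esub> (I +>\<^bsub>R\<^esub> H)" .
    then show "\<exists>r\<in>carrier ?Q. p = q \<otimes>\<^bsub>?Q\<^esub> r" using H(1) by blast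
  qed
qed

end

section \<open>Bounds for the indices\<close>

lemma finite_monomials:
  assumes "\<And>i. i \<le> n \<Longrightarrow> a i > 0"
  shows "finite {m. Poly_Mapping.keys m \<subseteq> {..n} \<and> wdeg a m = d}" (is "finite ?M")
proof (rule finite_imageD)
  show "finite ((\<lambda>m. restrict (Poly_Mapping.lookup m) {..n}) ` ?M)"
  proof (rule finite_subset)
    show "(\<lambda>m. restrict (Poly_Mapping.lookup m) {..n}) ` ?M \<subseteq> {..n} \<rightarrow>\<^sub>E {..d}"
    proof (intro image_subsetI restrict_PiE_iff[THEN iffD2] ballI)
      fix m i assume m: "m \<in> ?M" and i: "i \<in> {..n}"
      have "Poly_Mapping.lookup m i \<le> a i * Poly_Mapping.lookup m i" using assms[of i] i by (cases "a i") auto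
      also have "\<dots> \<le> (\<Sum>i\<le>n. a i * Poly_Mapping.lookup m i)"
        by (rule member_le_sum) (use i in auto)
      also have "\<dots> = d" using m wdeg_eq_sum[of m n a] by simp
      finally show "Poly_Mapping.lookup m i \<in> {..d}" by simp
    qed
  qed (auto intro: finite_PiE)
  show "inj_on (\<lambda>m. restrict (Poly_Mapping.lookup m) {..n}) ?M"
  proof (rule inj_onI, rule poly_mapping_eqI)
    fix m m' i
    assume m: "m \<in> ?M" "m' \<in> ?M" and eq: "restrict (Poly_Mapping.lookup m) {..n} = restrict (Poly_Mapping.lookup m') {..n}"
    show "Poly_Mapping.lookup m i = Poly_Mapping.lookup m' i"
    proof (cases "i \<le> n")
      case True then show ?thesis using fun_cong[OF eq, of i] by simp
    next
      case False
      then have "i \<notin> Poly_Mapping.keys m" "i \<notin> Poly_Mapping.keys m'" using m by auto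
      then show ?thesis by (simp add: in_keys_iff)
    qed
  qed
qed

text \<open>The equal weights enter only through \<open>split\<close>.\<close>

lemma veronese_if_equal_weights:
  assumes pos: "\<And>i. i \<le> n \<Longrightarrow> a i > 0" and ij: "i0 \<le> n" "j0 \<le> n" "i0 \<noteq> j0" "a i0 = a j0"
    and k: "k \<ge> 1" "k + 2 \<ge> n"
  shows "\<exists>N \<mu>. veronese n a (k * lcm_weights n a) N \<mu>"
proof -
  define l where "l = lcm_weights n a"
  have dvd: "a i dvd l" if "i \<le> n" for i
    unfolding l_def lcm_weights_def using that by (intro dvd_Lcm) auto
  have "0 \<notin> a ` {..n}" using pos by force
  then have l: "l > 0"
    using Lcm_0_iff[of "a ` {..n}"] by (intro Nat.gr0I) (auto simp: l_def lcm_weights_def)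
  let ?M = "{m. Poly_Mapping.keys m \<subseteq> {..n} \<and> wdeg a m = k * l}"
  have fin: "finite ?M" using pos by (rule finite_monomials)
  \<comment> \<open>The index set \<open>{..N}\<close> is never empty, so at least one monomial is
    needed to number them with \<open>N = card - 1\<close>.\<close>
  have "Poly_Mapping.single 0 (k * l div a 0) \<in> ?M"
    using dvd[of 0] by simp
  then have ne: "?M \<noteq> {}" by blast
  obtain \<mu> where "bij_betw \<mu> {0..<card ?M} ?M" using ex_bij_betw_nat_finite[OF fin] by blast
  moreover have "{0..<card ?M} = {..card ?M - 1}"
  proof -
    have "card ?M > 0" using fin ne card_gt_0_iff by blast
    then show ?thesis by auto
  qed
  ultimately have \<mu>: "bij_betw \<mu> {..card ?M - 1} ?M" by simp
  have "veronese n a (k * l) (card ?M - 1) \<mu>"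
  proof
    show "n \<ge> 1" using ij by auto
    show "k * l > 0" using k l by simp
    fix m e assume m: "Poly_Mapping.keys m \<subseteq> {..n}" "wdeg a m = Suc e * (k * l)"
    \<comment> \<open>Used with \<open>h = k\<close>: one factor retains weight
      \<open>k * l\<close>, while \<open>e * k\<close> vectors of weight \<open>l\<close> are
      collected in the other.\<close>
    then have "wdeg a m = (k + e * k) * l" by (simp add: algebra_simps)
    from monomial_factor_exists[OF pos dvd l ij m(1) this k]
    show "\<exists>m1 m2. m = m1 + m2 \<and> Poly_Mapping.keys m1 \<subseteq> {..n} \<and> Poly_Mapping.keys m2 \<subseteq> {..n} \<and>
        wdeg a m1 = e * (k * l) \<and> wdeg a m2 = k * l"
      by (simp add: mult.assoc)
  qed (use pos dvd \<mu> in auto)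
  then show ?thesis unfolding l_def by blast
qed


theorem theorem1p2:
  fixes n :: nat and a :: "nat \<Rightarrow> nat"
  assumes "\<And>i. i \<le> n \<Longrightarrow> a i > 0"
    and "well_formed n a"
    and "n \<noteq> 2"
  shows "(int (mu_va TYPE('k::field) n a) = int n - 1 \<longrightarrow>
            (\<forall>i\<le>n. \<forall>j\<le>n. i \<noteq> j \<longrightarrow> a i \<noteq> a j)) \<and>
         (int (mu_norm TYPE('k) n a) = int n - 1 \<longrightarrow>
            (\<forall>i\<le>n. \<forall>j\<le>n. i \<noteq> j \<longrightarrow> a i \<noteq> a j))"
proof (rule ccontr)
  assume neg: "\<not> ?thesis"
  then obtain i j where ij: "i \<le> n" "j \<le> n" "i \<noteq> j" "a i = a j" by blast
  define r where "r = max 1 (n - 2)"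
  have r: "r \<ge> 1" "r + 2 \<ge> n" by (auto simp: r_def)
  have ample: "very_ample TYPE('k) n a (k * lcm_weights n a)"
    and normal: "projectively_normal TYPE('k) n a (k * lcm_weights n a)" if "k \<ge> r" for k
  proof -
    have "k \<ge> 1" "k + 2 \<ge> n" using that r by auto
    then obtain N \<mu> where "veronese n a (k * lcm_weights n a) N \<mu>"
      using veronese_if_equal_weights[OF assms(1) ij] by blast
    then show "very_ample TYPE('k) n a (k * lcm_weights n a)"
      "projectively_normal TYPE('k) n a (k * lcm_weights n a)"
      by (rule veronese.very_ample, rule veronese.projectively_normal)
  qed
  \<comment> \<open>The witness \<open>r\<close> makes \<open>LEAST\<close> an actual member, so it
    is at least 1. This lower bound settles \<open>n = 1\<close>, where \<open>n - 1 = 0\<close>;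
    for \<open>n >= 3\<close> the upper bound is \<open>r = n - 2\<close>.\<close>
  have Least: "1 \<le> (LEAST k. k \<ge> 1 \<and> Q k) \<and> (LEAST k. k \<ge> 1 \<and> Q k) \<le> r" if "Q r" for Q :: "nat \<Rightarrow> bool"
    using LeastI[of "\<lambda>k. k \<ge> 1 \<and> Q k" r] Least_le[of "\<lambda>k. k \<ge> 1 \<and> Q k" r] r(1) that by simp
  have "1 \<le> mu_va TYPE('k) n a \<and> mu_va TYPE('k) n a \<le> r"
    unfolding mu_va_def by (rule Least) (rule ample[OF order_refl])
  moreover have "1 \<le> mu_norm TYPE('k) n a \<and> mu_norm TYPE('k) n a \<le> r"
    unfolding mu_norm_def by (rule Least) (use ample normal in blast)
  moreover have "n \<ge> 1" using ij by auto
  ultimately have "int (mu_va TYPE('k) n a) \<noteq> int n - 1" "int (mu_norm TYPE('k) n a) \<noteq> int n - 1"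
    using assms(3) by (auto simp: r_def)
  then show False using neg by blast
qed

end
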